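(* Let $h_1,h_2,h_3\in\mathbb R$, $v_{12},v_{23}\in\mathbb C\setminus\{0\}$, $$H_0=\begin{pmatrix}h_1&0&0\\0&h_2&0\\0&0&h_3\end{pmatrix},\qquad V=\begin{pmatrix}0&v_{12}&0\\ \overline{v_{12}}&0&v_{23}\\0&\overline{v_{23}}&0\end{pmatrix},$$ and assume the system is harmonic: $h_2-h_1=h_3-h_2=:\omega\neq0$. Let $\lambda_1>\lambda_3>\lambda_2$ be real, $O=\mathrm{diag}(\lambda_1,\lambda_2,\lambda_3)$, $\rho_0=\mathrm{diag}(0,0,1)$, $T>0$, $\mathfrak H^0=L_2([0,T],\mathbb R)$, and $J_O\colon\mathfrak H^0\to\mathbb R$, $J_O(f)=\mathrm{Tr}[U_T^f\rho_0(U_T^f)^\dagger O]$. Let $\mathfrak H^3\subset\mathfrak H^1\subset\mathfrak H^0$ be the sets $$\mathfrak H^1=\{f\in\mathfrak H^0: A^1_{23}\langle f\rangle=0\},\qquad \mathfrak H^3=\{f\in\mathfrak H^1: A^3_{23}\langle f\rangle=0\}.$$ Then the Taylor expansion of $J_O$ at the zero control $f_0\equiv0$ has the form $$J_O(f_0+\delta f)=J_O(f_0)+\sum_{k\in\{2,4,6,8\}}\frac1{k!}J_O^{(k)}(f_0)(\delta f,\ldots,\delta f)+o(\|\delta f\|^9)\quad\text{as }\|\delta f\|\to0,$$ where (1) for any $\delta f\in\mathfrak H^0\setminus\mathfrak H^1$, $J_O^{(2)}(f_0)(\delta f,\delta f)<0$; (2) for any $\delta f\in\mathfrak H^1$, $J_O^{(2)}(f_0)(\delta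 f,\delta f)=0$ and $J_O^{(4)}(f_0)(\delta f,\ldots,\delta f)=0$; (3) for any $\delta f\in\mathfrak H^1\setminus\mathfrak H^3$, $J_O^{(6)}(f_0)(\delta f,\ldots,\delta f)<0$; (4) for any $\delta f\in\mathfrak H^3$, $J_O^{(6)}(f_0)(\delta f,\ldots,\delta f)=0$ and $J_O^{(8)}(f_0)(\delta f,\ldots,\delta f)\ge0$. Moreover, if $|v_{12}|\neq|v_{23}|$, then for $T\ge 2\pi/|\omega|$ there exists a control $\delta f\in\mathfrak H^3$ such that $J_O^{(8)}(f_0)(\delta f,\ldots,\delta f)>0$. Thus, in this case, $f_0$ is a trap of the seventh order for $J_O$.
   Context: For $f\in L_2([0,T],\mathbb R)$, $U_t^f$ denotes the unique absolutely continuous solution on $[0,T]$ of $i\,\frac{dU_t^f}{dt}=(H_0+f(t)V)U_t^f$, $U_0^f=\mathbb I$. $J_O^{(j)}(f)$ is the $j$-th Fréchet differential of $J_O$ at $f$. Put $V_t:=e^{itH_0}Ve^{-itH_0}$ and, for $n\ge1$ and $l,k\in\{1,2,3\}$, $$A^n_{lk}\langle f\rangle:=\int_0^Tdt_1\int_0^{t_1}dt_2\cdots\int_0^{t_{n-1}}dt_n\,f(t_1)\cdots f(t_n)\,\langle l|V_{t_1}\cdots V_{t_n}|k\rangle,$$ where $\langle l|M|k\rangle$ is the $(l,k)$ entry of the matrix $M$. In particular $A^1_{23}\langle f\rangle=v_{23}\int_0^Te^{-i\omega t}f(t)\,dt$. Definition (trap of $n$-th order). A control $f\in L_2([0,T],\mathbb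 R)$ is a trap of the $n$-th order for $J_O$ if: (i) $f$ is not a point of global maximum of $J_O$; (ii) the Taylor expansion of $J_O$ at $f$ has the form $$J_O(f+\delta f)=J_O(f)+\sum_{j=2}^n\frac1{j!}J_O^{(j)}(f)(\delta f,\ldots,\delta f)+o(\|\delta f\|^n)\quad\text{as }\|\delta f\|\to0$$ (so the first-order term vanishes), and the functional $R(\delta f):=\sum_{j=2}^n\frac1{j!}J_O^{(j)}(f)(\delta f,\ldots,\delta f)$ satisfies: (a) $R$ is not identically zero; (b) for every $\delta f\in L_2([0,T],\mathbb R)$ there is $\varepsilon>0$ such that $R(t\,\delta f)\le0$ for all $t\in(-\varepsilon,\varepsilon)$. *)

theory Defs
  imports "HOL-Analysis.Analysis"
begin

section \<open>Controls: the space \<open>L\<^sub>2([0,T],\<real>)\<close>\<close>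

text \<open>
  Elements of \<open>L\<^sub>2([0,T],\<real>)\<close> are represented by functions \<open>real \<Rightarrow> real\<close>; values outside
  \<open>[0,T]\<close> and on null sets are irrelevant, and \<open>L2_norm\<close> is a seminorm on representatives.
\<close>

definition L2_space :: "real \<Rightarrow> (real \<Rightarrow> real) set" where
  "L2_space T = {f \<in> borel_measurable (lebesgue_on {0..T}).
                   integrable (lebesgue_on {0..T}) (\<lambda>t. (f t)\<^sup>2)}"

definition L2_norm :: "real \<Rightarrow> (real \<Rightarrow> real) \<Rightarrow> real" where
  "L2_norm T f = sqrt (LINT t|lebesgue_on {0..T}. (f t)\<^sup>2)"

text \<open>The filter describing \<open>\<parallel>h\<parallel> \<rightarrow> 0\<close> with \<open>h \<in> L\<^sub>2([0,T],\<real>)\<close> (\<open>h = 0\<close> not excluded).\<close>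

definition L2_nhds0 :: "real \<Rightarrow> (real \<Rightarrow> real) filter" where
  "L2_nhds0 T = inf (filtercomap (L2_norm T) (nhds 0)) (principal (L2_space T))"


section \<open>Higher Frechet differentials of functionals on \<open>L\<^sub>2([0,T],\<real>)\<close>\<close>

text \<open>
  A \<open>k\<close>-linear form is a function on argument lists; only lists of length \<open>k\<close> with entries in
  \<open>L2_space T\<close> matter.
\<close>

definition bounded_multilinear_form ::
    "real \<Rightarrow> nat \<Rightarrow> ((real \<Rightarrow> real) list \<Rightarrow> real) \<Rightarrow> bool" where
  "bounded_multilinear_form T k A \<longleftrightarrow>
     (\<forall>us vs f g a b.
        length us + 1 + length vs = k \<and> set us \<subseteq> L2_space T \<and> set vs \<subseteq> L2_space T \<and>
        f \<in> L2_space T \<and> g \<in> L2_space T \<longrightarrow>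
        A (us @ (\<lambda>t. a * f t + b * g t) # vs) = a * A (us @ f # vs) + b * A (us @ g # vs)) \<and>
     (\<exists>C. \<forall>vs. length vs = k \<and> set vs \<subseteq> L2_space T \<longrightarrow>
        \<bar>A vs\<bar> \<le> C * (\<Prod>v\<leftarrow>vs. L2_norm T v))"

text \<open>
  \<open>has_frechet_diff T k G f A\<close>: the map \<open>G\<close> from controls into bounded \<open>k\<close>-linear forms, with the
  operator norm on the latter, is Frechet differentiable at \<open>f\<close>. Its derivative, a bounded linear
  map into \<open>k\<close>-linear forms, is identified with the \<open>(k+1)\<close>-linear form \<open>A\<close>, the increment being
  the first argument.
\<close>

definition has_frechet_diff ::
    "real \<Rightarrow> nat \<Rightarrow> ((real \<Rightarrow> real) \<Rightarrow> (real \<Rightarrow> real) list \<Rightarrow> real) \<Rightarrow> (real \<Rightarrow> real)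
       \<Rightarrow> ((real \<Rightarrow> real) list \<Rightarrow> real) \<Rightarrow> bool" where
  "has_frechet_diff T k G f A \<longleftrightarrow>
     bounded_multilinear_form T (Suc k) A \<and>
     (\<forall>\<epsilon>>0. \<forall>\<^sub>F h in L2_nhds0 T. \<forall>vs. length vs = k \<and> set vs \<subseteq> L2_space T \<longrightarrow>
        \<bar>G (\<lambda>t. f t + h t) vs - G f vs - A (h # vs)\<bar>
          \<le> \<epsilon> * L2_norm T h * (\<Prod>v\<leftarrow>vs. L2_norm T v))"

text \<open>
  The \<open>k\<close>-th Frechet differential. Where it exists its values on \<open>L2_space T\<close> are unique, so the
  choice operator only selects irrelevant values elsewhere.
\<close>

primrec frechet_diff ::
    "real \<Rightarrow> ((real \<Rightarrow> real) \<Rightarrow> real) \<Rightarrow> nat \<Rightarrow> (real \<Rightarrow> real) \<Rightarrow> (real \<Rightarrow> real) list \<Rightarrow> real" where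
  "frechet_diff T J 0 = (\<lambda>f vs. J f)"
| "frechet_diff T J (Suc k) = (\<lambda>f. SOME A. has_frechet_diff T k (frechet_diff T J k) f A)"

primrec frechet_differentiable ::
    "real \<Rightarrow> ((real \<Rightarrow> real) \<Rightarrow> real) \<Rightarrow> nat \<Rightarrow> (real \<Rightarrow> real) \<Rightarrow> bool" where
  "frechet_differentiable T J 0 = (\<lambda>f. True)"
| "frechet_differentiable T J (Suc k) = (\<lambda>f.
     (\<forall>\<^sub>F h in L2_nhds0 T. frechet_differentiable T J k (\<lambda>t. f t + h t)) \<and>
     (\<exists>A. has_frechet_diff T k (frechet_diff T J k) f A))"

text \<open>The differential on the diagonal, \<open>J\<^sup>(\<^sup>k\<^sup>)(f)(h,\<dots>,h)\<close>.\<close>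

definition diff_diag ::
    "real \<Rightarrow> ((real \<Rightarrow> real) \<Rightarrow> real) \<Rightarrow> nat \<Rightarrow> (real \<Rightarrow> real) \<Rightarrow> (real \<Rightarrow> real) \<Rightarrow> real" where
  "diff_diag T J k f h = frechet_diff T J k f (replicate k h)"

text \<open>
  The Taylor expansion of \<open>J\<close> at \<open>f\<close> to order \<open>n\<close> exists and reduces to the terms of order
  \<open>k \<in> K\<close>: \<open>J(f+h) = J(f) + (\<Sum>k\<in>K. J\<^sup>(\<^sup>k\<^sup>)(f)(h,\<dots>,h)/k!) + o(\<parallel>h\<parallel>\<^sup>n)\<close>.
\<close>

definition taylor_expansion ::
    "real \<Rightarrow> ((real \<Rightarrow> real) \<Rightarrow> real) \<Rightarrow> (real \<Rightarrow> real) \<Rightarrow> nat set \<Rightarrow> nat \<Rightarrow> bool" where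
  "taylor_expansion T J f K n \<longleftrightarrow>
     frechet_differentiable T J n f \<and>
     (\<lambda>h. J (\<lambda>t. f t + h t) - J f - (\<Sum>k\<in>K. diff_diag T J k f h / fact k))
       \<in> o[L2_nhds0 T](\<lambda>h. L2_norm T h ^ n)"

definition trap_of_order ::
    "real \<Rightarrow> ((real \<Rightarrow> real) \<Rightarrow> real) \<Rightarrow> nat \<Rightarrow> (real \<Rightarrow> real) \<Rightarrow> bool" where
  "trap_of_order T J n f \<longleftrightarrow>
     f \<in> L2_space T \<and>
     \<not> (\<forall>g\<in>L2_space T. J g \<le> J f) \<and>
     taylor_expansion T J f {2..n} n \<and>
     (let R = (\<lambda>h. \<Sum>j=2..n. diff_diag T J j f h / fact j) in
        (\<exists>h\<in>L2_space T. R h \<noteq> 0) \<and>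
        (\<forall>h\<in>L2_space T. \<exists>\<epsilon>>0. \<forall>s\<in>{-\<epsilon><..<\<epsilon>}. R (\<lambda>t. s * h t) \<le> 0))"


section \<open>Controlled Schroedinger equation and objective functional\<close>

definition dagger :: "complex^'n^'n \<Rightarrow> complex^'n^'n" where
  "dagger M = (\<chi> i j. cnj (M $ j $ i))"

definition absolutely_continuous_on_Icc ::
    "real \<Rightarrow> real \<Rightarrow> (real \<Rightarrow> 'a::metric_space) \<Rightarrow> bool" where
  "absolutely_continuous_on_Icc a b U \<longleftrightarrow>
     (\<forall>\<epsilon>>0. \<exists>\<delta>>0. \<forall>D. finite D \<and> (\<forall>(s, t)\<in>D. a \<le> s \<and> s \<le> t \<and> t \<le> b) \<and>
        pairwise (\<lambda>p q. {fst p<..<snd p} \<inter> {fst q<..<snd q} = {}) D \<and>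
        (\<Sum>(s, t)\<in>D. t - s) < \<delta> \<longrightarrow>
        (\<Sum>(s, t)\<in>D. dist (U s) (U t)) < \<epsilon>)"

text \<open>
  Absolutely continuous solution of \<open>i dU/dt = (H0 + f(t) V) U\<close>, \<open>U(0) = 1\<close>, on \<open>[0,T]\<close>; the equation
  holds almost everywhere. The factor \<open>mat \<i>\<close> is the scalar matrix of the imaginary unit.
\<close>

definition is_propagator ::
    "real \<Rightarrow> complex^'n^'n \<Rightarrow> complex^'n^'n \<Rightarrow> (real \<Rightarrow> real) \<Rightarrow> (real \<Rightarrow> complex^'n^'n) \<Rightarrow> bool" where
  "is_propagator T H0 V f U \<longleftrightarrow>
     absolutely_continuous_on_Icc 0 T U \<and>
     U 0 = mat 1 \<and>
     (AE t in lebesgue_on {0..T}. \<exists>D. (U has_vector_derivative D) (at t within {0..T}) \<and>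
        mat \<i> ** D = (H0 + f t *\<^sub>R V) ** U t)"

text \<open>The solution is unique only on \<open>[0,T]\<close>, so it is extended by \<open>0\<close> to name it as a total function.\<close>

definition propagator ::
    "real \<Rightarrow> complex^'n^'n \<Rightarrow> complex^'n^'n \<Rightarrow> (real \<Rightarrow> real) \<Rightarrow> real \<Rightarrow> complex^'n^'n" where
  "propagator T H0 V f =
     (THE U. is_propagator T H0 V f U \<and> (\<forall>t. t \<notin> {0..T} \<longrightarrow> U t = 0))"

text \<open>The trace is real for Hermitian \<open>\<rho>\<close> and \<open>O\<close>; \<open>Re\<close> only adjusts the type.\<close>

definition objective ::
    "real \<Rightarrow> complex^'n^'n \<Rightarrow> complex^'n^'n \<Rightarrow> complex^'n^'n \<Rightarrow> complex^'n^'n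
       \<Rightarrow> (real \<Rightarrow> real) \<Rightarrow> real" where
  "objective T H0 V \<rho> Ob f =
     (let U = propagator T H0 V f T in Re (trace (U ** \<rho> ** dagger U ** Ob)))"


section \<open>Iterated integrals \<open>A\<^sup>n\<^sub>l\<^sub>k\<langle>f\<rangle>\<close>\<close>

definition mat_exp :: "complex^'n^'n \<Rightarrow> complex^'n^'n" where
  "mat_exp M = (\<Sum>n. (((**) M) ^^ n) (mat 1) /\<^sub>R fact n)"

definition interaction :: "complex^'n^'n \<Rightarrow> complex^'n^'n \<Rightarrow> real \<Rightarrow> complex^'n^'n" where
  "interaction H0 V t =
     mat_exp (mat (\<i> * of_real t) ** H0) ** V ** mat_exp (mat (- \<i> * of_real t) ** H0)"

text \<open>\<open>simplex_integral n s g\<close> is \<open>\<integral>\<^sub>0\<^sup>s dt\<^sub>1 \<integral>\<^sub>0\<^bsup>t\<^sub>1\<^esup> dt\<^sub>2 \<dots> g [t\<^sub>1,\<dots>,t\<^sub>n]\<close>.\<close>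

primrec simplex_integral :: "nat \<Rightarrow> real \<Rightarrow> (real list \<Rightarrow> complex) \<Rightarrow> complex" where
  "simplex_integral 0 s g = g []"
| "simplex_integral (Suc n) s g =
     (LINT t|lebesgue_on {0..s}. simplex_integral n t (\<lambda>ts. g (t # ts)))"

definition A_coeff ::
    "real \<Rightarrow> complex^'n^'n \<Rightarrow> complex^'n^'n \<Rightarrow> nat \<Rightarrow> 'n \<Rightarrow> 'n \<Rightarrow> (real \<Rightarrow> real) \<Rightarrow> complex" where
  "A_coeff T H0 V n l k f =
     simplex_integral n T (\<lambda>ts. of_real (\<Prod>t\<leftarrow>ts. f t) *
       (foldr (**) (map (interaction H0 V) ts) (mat 1)) $ l $ k)"

end

theory Submission
  imports Defs "HOL-Combinatorics.Permutations"
begin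

text \<open>
  In the interaction picture the propagator is the Dyson series \<open>W = \<Sum>n (- i)^n \<integral> f \<cdots> f V \<cdots> V\<close>, whose
  \<open>n\<close>-th term is a bounded \<open>n\<close>-linear form of norm at most \<open>C^n / sqrt (n!)\<close>. Hence \<open>J\<close> is an entire
  functional: all its Frechet differentials exist, and those at \<open>0\<close> are its homogeneous terms.
  Since \<open>H0\<close> and \<open>O\<close> are diagonal and \<open>W\<close> is unitary,
  \<open>J = lam3 + (lam1 - lam3) |W13|^2 + (lam2 - lam3) |W23|^2\<close>. Here \<open>W13\<close> has only terms of even and \<open>W23\<close>
  only terms of odd order. In the harmonic case the second order term of \<open>W13\<close> is a multiple of the square
  of the first order term of \<open>W23\<close>, so on \<open>\<HH>1\<close> the orders 2 and 4 vanish, and order 6 is governed by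
  the third order term of \<open>W23\<close>. On \<open>\<HH>3\<close> order 8 is \<open>(lam1 - lam3)\<close> times the squared modulus of the fourth
  order term of \<open>W13\<close>. With \<open>g t = f t exp (- i \<omega> t)\<close> and \<open>a\<close> its primitive, the latter is by partial
  integration \<open>v12 v23 (|v23|^2 - |v12|^2) / 2\<close> times \<open>\<integral> cnj g a^3\<close> as soon as \<open>a T = 0\<close>; the control
  \<open>1 + 3 cos (2 \<omega> t)\<close> on one period, continued by \<open>0\<close>, makes it nonzero.
\<close>

text \<open>Two facts replace it: an indefinite integral is differentiable almost everywhere, and an
  absolutely continuous function with derivative zero almost everywhere is constant. They give
  partial integration, the uniqueness behind \<open>propagator\<close>, and every closed formula for
  a Dyson term. The differentials are defined recursively, by choice and at all nearby controls, so
  the series at the zero control alone is not enough: explicit forms are needed at every control and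
  order. That computation wants symmetric forms, while Dyson terms are time-ordered; averaging over
  permutations repairs this and leaves the diagonal unchanged. In
  \<open>1 + 3 cos (2 \<omega> t)\<close> the factor 3 makes the constant of integration of
  \<open>a\<close> vanish, so that \<open>a\<close> has odd frequencies only. Then the integrand of
  the third order condition has odd frequencies only and integrates to zero over a period, whereas
  the fourth order integrand has even frequencies, among them zero.\<close>

section \<open>Lebesgue differentiation on an interval\<close>

text \<open>
  Henstock's lemma bounds the total length of disjoint intervals on which the difference quotient is off
  by more than \<open>e\<close>, and the Vitali covering lemma turns this into a bound on the outer measure of the
  exceptional set.
\<close>

theorem negligible_not_deriv_integral:
  fixes f :: "real \<Rightarrow> 'a::euclidean_space"
  assumes f: "f integrable_on {a..b}"
  shows "negligible {x \<in> {a..b}. \<not> ((\<lambda>u. integral {a..u} f) has_vector_derivative f x) (at x within {a..b})}"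
proof -
  define F where "F = (\<lambda>u. integral {a..u} f)"
  \<comment> \<open>Failure of differentiability at \<open>x\<close> means membership in
    \<open>bad e\<close> for some \<open>e > 0\<close>; the values \<open>1 / Suc n\<close> suffice,
    so a countable union of null sets remains.\<close>
  define bad where "bad = (\<lambda>e. {x \<in> {a..b}. \<forall>d>0. \<exists>y\<in>{a..b}. y \<noteq> x \<and> \<bar>y - x\<bar> < d \<and>
      norm (F y - F x - (y - x) *\<^sub>R f x) > e * \<bar>y - x\<bar>})"
  have F_diff: "F y - F x = integral {x..y} f" if "a \<le> x" "x \<le> y" "y \<le> b" for x y
  proof -
    have "integral {a..x} f + integral {x..y} f = integral {a..y} f"
      using that by (intro Henstock_Kurzweil_Integration.integral_combine integrable_on_subinterval[OF f]) auto
    then show ?thesis by (simp add: F_def algebra_simps)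
  qed
  have "negligible (bad e)" if "e > 0" for e
    unfolding negligible_outer_le
  proof (intro allI impI)
    fix \<eta> :: real assume "\<eta> > 0"
    \<comment> \<open>The 10 anticipates the Vitali enlargement: an interval of radius
      \<open>5 * r\<close> has length \<open>10 * r\<close>, and the sum of the \<open>r\<close> is
      at most the Henstock bound divided by \<open>e\<close>.\<close>
    then have pos: "e * \<eta> / 10 > 0" using \<open>e > 0\<close> by simp
    obtain \<gamma> where \<gamma>: "gauge \<gamma>" and
      hen: "\<And>p. \<lbrakk>p tagged_partial_division_of (cbox a b); \<gamma> fine p\<rbrakk> \<Longrightarrow>
             sum (\<lambda>(x,k). norm(measure lborel k *\<^sub>R f x - integral k f)) p < e * \<eta> / 10"
      by (rule Henstock_lemma[OF f[folded box_real(2)] pos]) blast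
    \<comment> \<open>A pair \<open>(x,y)\<close> stands for the bad interval between
      \<open>x\<close> and \<open>y\<close>, tagged by its endpoint \<open>x\<close>. It lies in the
      ball about \<open>x\<close> whose radius is its length, so disjoint balls give disjoint
      intervals.\<close>
    define I where "I = (\<lambda>(x::real,y). {min x y..max x y})"
    define r where "r = (\<lambda>(x::real,y). \<bar>y - x\<bar>)"
    define K where "K = {(x,y). x \<in> {a..b} \<and> y \<in> {a..b} \<and> y \<noteq> x \<and> I (x,y) \<subseteq> \<gamma> x \<and>
        norm (F y - F x - (y - x) *\<^sub>R f x) > e * \<bar>y - x\<bar>}"
    have cov: "bad e \<subseteq> (\<Union>i\<in>K. cball (fst i) (r i))"
    proof
      fix x assume x: "x \<in> bad e"
      have "open (\<gamma> x)" "x \<in> \<gamma> x" using \<gamma> by (auto simp: gauge_def)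
      then obtain d where d: "d > 0" "ball x d \<subseteq> \<gamma> x"
        by (meson openE)
      then obtain y where y: "y \<in> {a..b}" "y \<noteq> x" "\<bar>y - x\<bar> < d"
        "norm (F y - F x - (y - x) *\<^sub>R f x) > e * \<bar>y - x\<bar>"
        using x by (auto simp: bad_def)
      have "I (x,y) \<subseteq> ball x d" using y by (auto simp: I_def dist_real_def)
      then have "(x,y) \<in> K" using x y d by (auto simp: K_def bad_def)
      then show "x \<in> (\<Union>i\<in>K. cball (fst i) (r i))" by (auto simp: r_def intro!: bexI[of _ "(x,y)"])
    qed
    have r: "\<And>i. i \<in> K \<Longrightarrow> 0 < r i \<and> r i \<le> b - a"
      by (auto simp: K_def r_def)
    obtain C where C: "countable C" "C \<subseteq> K"
      "pairwise (\<lambda>i j. disjnt (cball (fst i) (r i)) (cball (fst j) (r j))) C"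
      "bad e \<subseteq> (\<Union>i\<in>C. cball (fst i) (5 * r i))"
      by (rule Vitali_covering_lemma_cballs[OF cov r])
    have I_sub: "I i \<subseteq> cball (fst i) (r i)" for i
      by (cases i) (auto simp: I_def r_def dist_real_def)
    \<comment> \<open>Henstock's lemma speaks of finite partial divisions only; as the bound is the
      same for every finite subfamily, it passes to the countable union.\<close>
    have bound: "measure lebesgue (\<Union>i\<in>C'. cball (fst i) (5 * r i)) \<le> \<eta>" if C': "C' \<subseteq> C" "finite C'" for C'
    proof -
      have inj: "inj_on (\<lambda>i. (fst i, I i)) C'"
      proof (rule inj_onI)
        fix i j assume ij: "i \<in> C'" "j \<in> C'" "(fst i, I i) = (fst j, I j)"
        show "i = j"
        proof (rule ccontr)
          assume "i \<noteq> j"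
          then have "disjnt (cball (fst i) (r i)) (cball (fst j) (r j))"
            using ij C(3) C'(1) unfolding pairwise_def by blast
          moreover have "fst i \<in> cball (fst i) (r i)" "fst i \<in> cball (fst j) (r j)"
            using ij C' C(2) r[of i] r[of j] by auto
          ultimately show False unfolding disjnt_def by blast
        qed
      qed
      let ?p = "(\<lambda>i. (fst i, I i)) ` C'"
      have p: "?p tagged_partial_division_of (cbox a b)"
        unfolding tagged_partial_division_of_def
      proof (intro conjI allI impI)
        show "finite ?p" using C' by simp
      next
        fix x k assume "(x, k) \<in> ?p"
        then obtain i where i: "i \<in> C'" "x = fst i" "k = I i" by auto
        then have "i \<in> K" using C' C by auto
        then show "x \<in> k" "k \<subseteq> cbox a b" "\<exists>a b. k = cbox a b"
          using i by (auto simp: K_def I_def)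
      next
        fix x1 k1 x2 k2 assume *: "(x1, k1) \<in> ?p \<and> (x2, k2) \<in> ?p \<and> (x1, k1) \<noteq> (x2, k2)"
        then obtain i j where "i \<in> C'" "j \<in> C'" "i \<noteq> j" "k1 = I i" "k2 = I j" by auto
        then have "disjnt k1 k2"
          using I_sub[of i] I_sub[of j] C(3) C'(1) unfolding pairwise_def disjnt_def by blast
        then show "interior k1 \<inter> interior k2 = {}"
          using interior_subset unfolding disjnt_def by blast
      qed
      have "\<gamma> fine ?p"
        using C' C(2) by (fastforce simp: fine_def K_def)
      then have "sum (\<lambda>(x,k). norm(measure lborel k *\<^sub>R f x - integral k f)) ?p < e * \<eta> / 10"
        by (rule hen[OF p])
      then have less: "(\<Sum>i\<in>C'. norm(measure lborel (I i) *\<^sub>R f (fst i) - integral (I i) f)) < e * \<eta> / 10"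
        by (simp add: sum.reindex[OF inj] o_def)
      have "e * r i \<le> norm(measure lborel (I i) *\<^sub>R f (fst i) - integral (I i) f)" if "i \<in> C'" for i
      proof -
        obtain x y where i: "i = (x,y)" by (cases i)
        have iK: "(x,y) \<in> K" using that C' C i by auto
        then have xy: "x \<in> {a..b}" "y \<in> {a..b}" "y \<noteq> x" "norm (F y - F x - (y - x) *\<^sub>R f x) > e * \<bar>y - x\<bar>"
          by (auto simp: K_def)
        have "norm (F y - F x - (y - x) *\<^sub>R f x) = norm(measure lborel (I i) *\<^sub>R f (fst i) - integral (I i) f)"
        proof (cases "x \<le> y")
          case True
          then show ?thesis using xy F_diff[of x y] i
            by (simp add: I_def norm_minus_commute)
        next
          case False
          then have "integral {y..x} f = F x - F y" using xy F_diff[of y x] by simp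
          then have "F y - F x - (y - x) *\<^sub>R f x = (x - y) *\<^sub>R f x - integral {y..x} f"
            by (simp add: scaleR_diff_left)
          then show ?thesis using False i by (simp add: I_def)
        qed
        then show ?thesis using xy(4) i by (simp add: r_def)
      qed
      then have "(\<Sum>i\<in>C'. e * r i) \<le> e * \<eta> / 10"
        using less sum_mono[of C' "\<lambda>i. e * r i"] by (metis (no_types, lifting) dual_order.strict_trans2 less_imp_le)
      then have sr: "(\<Sum>i\<in>C'. r i) \<le> \<eta> / 10"
        using \<open>e > 0\<close> by (simp add: sum_distrib_left[symmetric] field_simps)
      have "measure lebesgue (\<Union>i\<in>C'. cball (fst i) (5 * r i)) \<le> (\<Sum>i\<in>C'. measure lebesgue (cball (fst i) (5 * r i)))"
        by (rule measure_UNION_le) (use C' in auto)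
      also have "\<dots> = (\<Sum>i\<in>C'. 10 * r i)"
        by (rule sum.cong) (auto simp: cball_eq_atLeastAtMost r_def)
      also have "\<dots> \<le> \<eta>" using sr by (simp add: sum_distrib_left[symmetric])
      finally show ?thesis .
    qed
    show "\<exists>T. bad e \<subseteq> T \<and> T \<in> lmeasurable \<and> measure lebesgue T \<le> \<eta>"
    proof (intro exI conjI)
      show "bad e \<subseteq> (\<Union>i\<in>C. cball (fst i) (5 * r i))" by (fact C(4))
      show "(\<Union>i\<in>C. cball (fst i) (5 * r i)) \<in> lmeasurable"
        by (rule fmeasurable_UN_bound[OF C(1) _ bound]) auto
      show "measure lebesgue (\<Union>i\<in>C. cball (fst i) (5 * r i)) \<le> \<eta>"
        by (rule measure_UN_bound[OF C(1) _ bound]) auto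
    qed
  qed
  then have "negligible (\<Union>n::nat. bad (1 / Suc n))"
    by (intro negligible_countable_Union) auto
  moreover have "{x \<in> {a..b}. \<not> (F has_vector_derivative f x) (at x within {a..b})} \<subseteq> (\<Union>n::nat. bad (1 / Suc n))"
  proof
    fix x assume "x \<in> {x \<in> {a..b}. \<not> (F has_vector_derivative f x) (at x within {a..b})}"
    then have x: "x \<in> {a..b}" "\<not> (F has_vector_derivative f x) (at x within {a..b})" by auto
    then obtain e where e: "e > 0" "\<And>d. d > 0 \<Longrightarrow> \<exists>y\<in>{a..b}. \<bar>y - x\<bar> < d \<and>
        \<not> norm (F y - F x - (y - x) *\<^sub>R f x) \<le> e * \<bar>y - x\<bar>"
      unfolding has_vector_derivative_def has_derivative_within_alt
      by (auto simp: bounded_linear_scaleR_left)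
    obtain n where n: "1 / Suc n < e" using e(1) nat_approx_posE by blast
    have "x \<in> bad (1 / Suc n)"
      unfolding bad_def
    proof (intro CollectI conjI allI impI x)
      fix d :: real assume "d > 0"
      then obtain y where y: "y\<in>{a..b}" "\<bar>y - x\<bar> < d" "norm (F y - F x - (y - x) *\<^sub>R f x) > e * \<bar>y - x\<bar>"
        using e(2) by (meson not_le)
      then have "y \<noteq> x" by auto
      moreover have "1 / Suc n * \<bar>y - x\<bar> \<le> e * \<bar>y - x\<bar>" using n by (intro mult_right_mono) auto
      ultimately show "\<exists>y\<in>{a..b}. y \<noteq> x \<and> \<bar>y - x\<bar> < d \<and> 1 / Suc n * \<bar>y - x\<bar> < norm (F y - F x - (y - x) *\<^sub>R f x)"
        using y by force
    qed
    then show "x \<in> (\<Union>n::nat. bad (1 / Suc n))" by blast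
  qed
  ultimately show ?thesis unfolding F_def by (rule negligible_subset)
qed

section \<open>Absolutely continuous functions\<close>

text \<open>Endpoints form a null set, so the closed intervals may be replaced by open ones; these
  are disjoint and their indicators add up to at most 1.\<close>

lemma sum_integral_nonoverlapping_le:
  fixes h :: "real \<Rightarrow> real"
  assumes h: "integrable (lebesgue_on {a..b}) h" "\<And>x. x \<in> {a..b} \<Longrightarrow> 0 \<le> h x"
    and D: "finite D" "\<And>s t. (s, t) \<in> D \<Longrightarrow> a \<le> s \<and> s \<le> t \<and> t \<le> b"
      "pairwise (\<lambda>p q. {fst p<..<snd p} \<inter> {fst q<..<snd q} = {}) D"
  shows "(\<Sum>(s, t)\<in>D. LINT x|lebesgue_on {s..t}. h x) \<le> (LINT x|lebesgue_on {a..b}. h x)"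
proof -
  define H where "H = (\<lambda>x. indicator {a..b} x *\<^sub>R h x)"
  have H: "integrable lebesgue H"
    using h(1) unfolding H_def by (subst (asm) integrable_restrict_space) auto
  let ?I = "\<lambda>p. {fst p<..<snd p}"
  have int: "integrable lebesgue (\<lambda>x. indicator (?I p) x * H x)" for p :: "real \<times> real"
    using integrable_mult_indicator[OF _ H, of "?I p"] by simp
  have eq: "(LINT x|lebesgue_on {fst p..snd p}. h x) = (LINT x|lebesgue. indicator (?I p) x * H x)" if "p \<in> D" for p
  proof -
    have sub: "a \<le> fst p" "fst p \<le> snd p" "snd p \<le> b" using that D(2)[of "fst p" "snd p"] by auto
    have "(LINT x|lebesgue_on {fst p..snd p}. h x) = (LINT x|lebesgue. indicator {fst p..snd p} x *\<^sub>R h x)"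
      by (rule integral_restrict_space) auto
    also have "(\<lambda>x. indicator {fst p..snd p} x *\<^sub>R h x) = (\<lambda>x. indicator {fst p..snd p} x *\<^sub>R H x)"
      using sub by (auto simp: H_def indicator_def)
    also have "(LINT x|lebesgue. indicator {fst p..snd p} x *\<^sub>R H x) = (LINT x|lebesgue. indicator (?I p) x * H x)"
    proof (rule integral_cong_AE)
      have "AE x in lebesgue. x \<notin> {fst p, snd p}"
        by (intro AE_not_in) (simp add: negligible_iff_null_sets[symmetric])
      then show "AE x in lebesgue. indicator {fst p..snd p} x *\<^sub>R H x = indicator {fst p<..<snd p} x * H x"
        by eventually_elim (auto simp: indicator_def)
      show "(\<lambda>x. indicator {fst p..snd p} x *\<^sub>R H x) \<in> borel_measurable lebesgue"
        using H by (intro borel_measurable_scaleR borel_measurable_indicator borel_measurable_integrable) auto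
      show "(\<lambda>x. indicator {fst p<..<snd p} x * H x) \<in> borel_measurable lebesgue"
        using int by auto
    qed
    finally show ?thesis .
  qed
  have "(\<Sum>(s, t)\<in>D. LINT x|lebesgue_on {s..t}. h x) = (\<Sum>p\<in>D. LINT x|lebesgue. indicator (?I p) x * H x)"
    by (rule sum.cong) (use eq in \<open>auto simp: case_prod_beta\<close>)
  also have "\<dots> = (LINT x|lebesgue. (\<Sum>p\<in>D. indicator (?I p) x * H x))"
    using int by (subst Bochner_Integration.integral_sum) auto
  also have "\<dots> \<le> (LINT x|lebesgue. H x)"
  proof (rule integral_mono)
    show "integrable lebesgue (\<lambda>x. (\<Sum>p\<in>D. indicator (?I p) x * H x))"
      using int by auto
    fix x
    have "disjoint_family_on ?I D"
      using D(3) by (auto simp: disjoint_family_on_def pairwise_def)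
    then have "(\<Sum>p\<in>D. indicator (?I p) x :: real) = indicator (\<Union>p\<in>D. ?I p) x"
      using D(1) by (simp add: indicator_UN_disjoint)
    moreover have "H x \<ge> 0" using h(2) by (auto simp: H_def indicator_def)
    ultimately show "(\<Sum>p\<in>D. indicator (?I p) x * H x) \<le> H x"
      by (simp add: sum_distrib_right[symmetric] indicator_def)
  qed (use H in auto)
  also have "\<dots> = (LINT x|lebesgue_on {a..b}. h x)"
    unfolding H_def by (rule integral_restrict_space[symmetric]) auto
  finally show ?thesis .
qed

text \<open>The integrand is cut at a height \<open>N\<close>. By dominated convergence the part
  above \<open>N\<close> has integral less than half of \<open>\<epsilon>\<close>, and the part
  below contributes at most \<open>N\<close> times the total length of the intervals.\<close>

lemma absolutely_continuous_indefinite_integral: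
  fixes g :: "real \<Rightarrow> 'a::euclidean_space"
  assumes g: "integrable (lebesgue_on {a..b}) g"
    and F: "\<And>t. t \<in> {a..b} \<Longrightarrow> F t = F a + (LINT s|lebesgue_on {a..t}. g s)"
  shows "absolutely_continuous_on_Icc a b F"
  unfolding absolutely_continuous_on_Icc_def
proof (intro allI impI)
  fix \<epsilon> :: real assume "\<epsilon> > 0"
  let ?M = "lebesgue_on {a..b}"
  have ng: "integrable ?M (\<lambda>x. norm (g x))" using g by simp
  have [measurable]: "g \<in> borel_measurable ?M" using g by auto
  have "(\<lambda>n. LINT x|?M. norm (g x) * indicator {x. norm (g x) > real n} x) \<longlonglongrightarrow> (LINT x|?M. 0)"
  proof (rule integral_dominated_convergence[where w = "\<lambda>x. norm (g x)"])
    show "AE x in ?M. (\<lambda>n. norm (g x) * indicator {x. norm (g x) > real n} x) \<longlonglongrightarrow> 0"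
    proof (rule AE_I2)
      fix x
      have "\<forall>\<^sub>F n in sequentially. norm (g x) * indicator {x. norm (g x) > real n} x = 0"
        using eventually_ge_at_top[of "nat \<lceil>norm (g x)\<rceil>"]
        by eventually_elim (auto simp: indicator_def nat_le_iff ceiling_le_iff)
      then show "(\<lambda>n. norm (g x) * indicator {x. norm (g x) > real n} x) \<longlonglongrightarrow> 0"
        by (rule tendsto_eventually)
    qed
  qed (use ng in \<open>auto simp: indicator_def\<close>)
  then have "\<forall>\<^sub>F n in sequentially. (LINT x|?M. norm (g x) * indicator {x. norm (g x) > real n} x) < \<epsilon> / 2"
    using \<open>\<epsilon> > 0\<close> by (intro order_tendstoD) auto
  then obtain N :: nat where N: "(LINT x|?M. norm (g x) * indicator {x. norm (g x) > real N} x) < \<epsilon> / 2"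
    by (auto simp: eventually_sequentially)
  let ?h = "\<lambda>x. norm (g x) * indicator {x. norm (g x) > real N} x"
  have h: "integrable ?M ?h"
    by (rule Bochner_Integration.integrable_bound[OF ng]) (auto simp: indicator_def)
  define \<delta> where "\<delta> = \<epsilon> / (2 * (real N + 1))"
  show "\<exists>\<delta>>0. \<forall>D. finite D \<and> (\<forall>(s, t)\<in>D. a \<le> s \<and> s \<le> t \<and> t \<le> b) \<and>
             pairwise (\<lambda>p q. {fst p<..<snd p} \<inter> {fst q<..<snd q} = {}) D \<and> (\<Sum>(s, t)\<in>D. t - s) < \<delta> \<longrightarrow>
             (\<Sum>(s, t)\<in>D. dist (F s) (F t)) < \<epsilon>"
  proof (intro exI[of _ \<delta>] conjI allI impI)
    show "\<delta> > 0" using \<open>\<epsilon> > 0\<close> by (simp add: \<delta>_def)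
    fix D :: "(real \<times> real) set"
    assume "finite D \<and> (\<forall>(s, t)\<in>D. a \<le> s \<and> s \<le> t \<and> t \<le> b) \<and>
             pairwise (\<lambda>p q. {fst p<..<snd p} \<inter> {fst q<..<snd q} = {}) D \<and> (\<Sum>(s, t)\<in>D. t - s) < \<delta>"
    then have D: "finite D" "\<And>s t. (s, t) \<in> D \<Longrightarrow> a \<le> s \<and> s \<le> t \<and> t \<le> b"
      "pairwise (\<lambda>p q. {fst p<..<snd p} \<inter> {fst q<..<snd q} = {}) D" "(\<Sum>(s, t)\<in>D. t - s) < \<delta>"
      by auto
    have le: "dist (F s) (F t) \<le> (LINT x|lebesgue_on {s..t}. ?h x) + N * (t - s)" if "(s,t) \<in> D" for s t :: real
    proof -
      have st: "a \<le> s" "s \<le> t" "t \<le> b" using D(2)[OF that] by auto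
      have sub: "integrable (lebesgue_on {s..t}) f" if "integrable ?M f" for f :: "real \<Rightarrow> 'c::euclidean_space"
        using that by (rule integrable_subinterval) (use st in auto)
      have "integrable (lebesgue_on {a..t}) g"
        using g by (rule integrable_subinterval) (use st in auto)
      then have "(LINT s|lebesgue_on {a..t}. g s) = (LINT s|lebesgue_on {a..s}. g s) + (LINT s|lebesgue_on {s..t}. g s)"
        using st Equivalence_Measurable_On_Borel.integral_combine[of a t g s] by simp
      then have "dist (F s) (F t) = norm (LINT x|lebesgue_on {s..t}. g x)"
        using F[of s] F[of t] st by (simp add: dist_norm)
      also have "\<dots> \<le> (LINT x|lebesgue_on {s..t}. norm (g x))"
        by (rule integral_norm_bound)
      also have "\<dots> \<le> (LINT x|lebesgue_on {s..t}. ?h x + N)"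
        by (intro integral_mono sub ng h Bochner_Integration.integrable_add integrable_const) (auto simp: indicator_def)
      also have "\<dots> = (LINT x|lebesgue_on {s..t}. ?h x) + N * (t - s)"
        using st by (subst Bochner_Integration.integral_add) (auto intro!: sub h simp: measure_restrict_space)
      finally show ?thesis .
    qed
    have "(\<Sum>(s, t)\<in>D. dist (F s) (F t)) \<le> (\<Sum>(s, t)\<in>D. (LINT x|lebesgue_on {s..t}. ?h x) + N * (t - s))"
      by (rule sum_mono) (use le in auto)
    also have "\<dots> = (\<Sum>(s, t)\<in>D. (LINT x|lebesgue_on {s..t}. ?h x)) + N * (\<Sum>(s, t)\<in>D. t - s)"
      by (simp add: case_prod_beta sum.distrib sum_distrib_left)
    also have "\<dots> \<le> (LINT x|?M. ?h x) + N * \<delta>"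
      using D by (intro add_mono sum_integral_nonoverlapping_le mult_left_mono h) (auto simp: indicator_def)
    also have "\<dots> < \<epsilon>"
    proof -
      have "N * \<delta> \<le> \<epsilon> / 2" using \<open>\<epsilon> > 0\<close> by (simp add: \<delta>_def field_simps)
      then show ?thesis using N by simp
    qed
    finally show "(\<Sum>(s, t)\<in>D. dist (F s) (F t)) < \<epsilon>" .
  qed
qed

text \<open>A division that is fine for a suitable gauge has two kinds of cells. Those tagged in the
  exceptional null set lie in an open set of small measure, where absolute continuity bounds the
  total increment; on the others the vanishing derivative bounds the increment by
  \<open>\<epsilon>\<close> times the length.\<close>

lemma absolutely_continuous_zero_derivative_const:
  fixes U :: "real \<Rightarrow> 'a::real_normed_vector"
  assumes ac: "absolutely_continuous_on_Icc a b U"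
    and der: "AE t in lebesgue_on {a..b}. (U has_vector_derivative 0) (at t within {a..b})"
    and x: "x \<in> {a..b}"
  shows "U x = U a"
proof -
  have "norm (U x - U a) \<le> \<epsilon> * (1 + (x - a))" if "\<epsilon> > 0" for \<epsilon>
  proof -
    obtain \<delta> where \<delta>: "\<delta> > 0" "\<And>D. finite D \<Longrightarrow> (\<forall>(s, t)\<in>D. a \<le> s \<and> s \<le> t \<and> t \<le> b) \<Longrightarrow>
        pairwise (\<lambda>p q. {fst p<..<snd p} \<inter> {fst q<..<snd q} = {}) D \<Longrightarrow>
        (\<Sum>(s, t)\<in>D. t - s) < \<delta> \<Longrightarrow> (\<Sum>(s, t)\<in>D. dist (U s) (U t)) < \<epsilon>"
      using ac \<open>\<epsilon> > 0\<close> unfolding absolutely_continuous_on_Icc_def by meson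
    have "AE t in lebesgue. t \<in> {a..b} \<longrightarrow> (U has_vector_derivative 0) (at t within {a..b})"
      using der by (subst (asm) AE_restrict_space_iff) auto
    then obtain N where N: "N \<in> null_sets lebesgue"
      "\<And>t. t \<in> {a..b} - N \<Longrightarrow> (U has_vector_derivative 0) (at t within {a..b})"
    proof (rule AE_E3)
      fix N assume N: "\<And>x. x \<in> space lebesgue - N \<Longrightarrow> x \<in> {a..b} \<longrightarrow> (U has_vector_derivative 0) (at x within {a..b})"
        "N \<in> null_sets lebesgue"
      show thesis by (rule that[OF N(2)]) (use N(1) in force)
    qed
    have "N \<in> sets lebesgue" using N by auto
    then obtain O' where O': "open O'" "N \<subseteq> O'" "(O' - N) \<in> lmeasurable" "emeasure lebesgue (O' - N) < ennreal \<delta>"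
      using sets_lebesgue_outer_open \<delta>(1) by metis
    have "emeasure lebesgue O' = emeasure lebesgue (O' - N)"
      using N(1) O' by (simp add: emeasure_Diff_null_set)
    then have O'm: "O' \<in> lmeasurable" "measure lebesgue O' < \<delta>"
      using O' \<delta>(1) by (auto simp: fmeasurable_def measure_def borel_open enn2real_less_iff)
    have "\<exists>d>0. \<forall>y\<in>{a..b}. \<bar>y - t\<bar> < d \<longrightarrow> norm (U y - U t) \<le> \<epsilon> * \<bar>y - t\<bar>" if "t \<in> {a..b} - N" for t
      using N(2)[OF that] \<open>\<epsilon> > 0\<close> unfolding has_vector_derivative_def has_derivative_within_alt by auto
    then obtain d where d: "\<And>t. t \<in> {a..b} - N \<Longrightarrow> d t > 0"
      "\<And>t y. t \<in> {a..b} - N \<Longrightarrow> y\<in>{a..b} \<Longrightarrow> \<bar>y - t\<bar> < d t \<Longrightarrow> norm (U y - U t) \<le> \<epsilon> * \<bar>y - t\<bar>"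
      by metis
    define \<gamma> where "\<gamma> t = (if t \<in> N then O' else if t \<in> {a..b} then ball t (d t) else UNIV)" for t
    have "gauge \<gamma>" using O' d(1) by (auto simp: gauge_def \<gamma>_def)
    then obtain p where p: "p tagged_division_of {a..x}" "\<gamma> fine p"
      using fine_division_exists_real by metis
    have fin: "finite p" using p(1) by blast
    let ?\<Delta> = "\<lambda>K. U (Sup K) - U (Inf K)"
    have cell: "\<exists>u v. K = {u..v} \<and> a \<le> u \<and> u \<le> t \<and> t \<le> v \<and> v \<le> b \<and> v \<le> x" if "(t, K) \<in> p" for t K
      using p(1) that x unfolding tagged_division_of by (force simp: box_real)
    \<comment> \<open>Degenerate cells are left out: two distinct tagged cells can share both
      endpoints only if they are single points, so without these \<open>?e\<close> is injective on
      \<open>q\<close>.\<close>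
    define q where "q = {(t,K)\<in>p. t \<in> N \<and> Sup K \<noteq> Inf K}"
    have "finite q" using fin by (auto simp: q_def intro: finite_subset)
    have fineD: "K \<subseteq> \<gamma> t" if "(t, K) \<in> p" for t K using p(2) that by (auto simp: fine_def)
    let ?e = "\<lambda>(t::real,K::real set). (Inf K, Sup K)"
    have disj: "{Inf K<..<Sup K} \<inter> {Inf L<..<Sup L} = {}" if "(t,K) \<in> p" "(s,L) \<in> p" "(t,K) \<noteq> (s,L)" for t K s L
    proof -
      have "interior K \<inter> interior L = {}" using p(1) that unfolding tagged_division_of by blast
      moreover from cell[OF that(1)] obtain u v where "K = {u..v}" "u \<le> v" by force
      moreover from cell[OF that(2)] obtain u' v' where "L = {u'..v'}" "u' \<le> v'" by force
      ultimately show ?thesis by auto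
    qed
    have inj: "inj_on ?e q"
    proof (rule inj_onI)
      fix i j assume ij: "i \<in> q" "j \<in> q" "?e i = ?e j"
      obtain t K s L where eq: "i = (t,K)" "j = (s,L)" by (cases i, cases j)
      show "i = j"
      proof (rule ccontr)
        assume "i \<noteq> j"
        then have "{Inf K<..<Sup K} \<inter> {Inf L<..<Sup L} = {}" using ij eq disj[of t K s L] by (auto simp: q_def)
        moreover have "Inf K = Inf L" "Sup K = Sup L" using ij eq by auto
        moreover have "Inf K < Sup K" using ij(1) cell[of t K] eq by (force simp: q_def)
        ultimately show False by (metis Int_absorb dense greaterThanLessThan_iff empty_iff)
      qed
    qed
    let ?D = "?e ` q"
    have "(\<Sum>(s, t)\<in>?D. dist (U s) (U t)) < \<epsilon>"
    proof (rule \<delta>(2))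
      show "finite ?D" using \<open>finite q\<close> by simp
      show "\<forall>(s, t)\<in>?D. a \<le> s \<and> s \<le> t \<and> t \<le> b"
        using cell by (force simp: q_def)
      show pw: "pairwise (\<lambda>p q. {fst p<..<snd p} \<inter> {fst q<..<snd q} = {}) ?D"
      proof (rule pairwiseI)
        fix i j assume "i \<in> ?D" "j \<in> ?D" "i \<noteq> j"
        then obtain t K s L where "(t,K) \<in> q" "(s,L) \<in> q" "i = (Inf K, Sup K)" "j = (Inf L, Sup L)"
          by auto
        then show "{fst i<..<snd i} \<inter> {fst j<..<snd j} = {}"
          using disj[of t K s L] \<open>i \<noteq> j\<close> by (auto simp: q_def)
      qed
      have cell': "fst i \<le> snd i \<and> {fst i<..<snd i} \<subseteq> O'" if "i \<in> ?D" for i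
      proof -
        from that obtain z where "z \<in> q" "i = ?e z" by blast
        then obtain t K where tK: "(t,K) \<in> p" "t \<in> N" "i = (Inf K, Sup K)" by (cases z) (auto simp: q_def)
        then have "K \<subseteq> O'" using fineD[of t K] by (auto simp: \<gamma>_def)
        then show ?thesis using cell[OF tK(1)] tK(3) by fastforce
      qed
      have "(\<Sum>(s, t)\<in>?D. t - s) = (\<Sum>i\<in>?D. measure lebesgue {fst i<..<snd i})"
        by (rule sum.cong) (use cell' in \<open>auto simp: case_prod_beta\<close>)
      also have "\<dots> = measure lebesgue (\<Union>i\<in>?D. {fst i<..<snd i})"
        by (rule measure_UNION'[symmetric]) (use \<open>finite q\<close> pw in \<open>auto simp: disjnt_def pairwise_def\<close>)
      also have "\<dots> \<le> measure lebesgue O'"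
      proof (rule measure_mono_fmeasurable)
        show "(\<Union>i\<in>?D. {fst i<..<snd i}) \<subseteq> O'" using cell' by blast
        show "(\<Union>i\<in>?D. {fst i<..<snd i}) \<in> sets lebesgue"
          using \<open>finite q\<close> by (intro sets.finite_UN) auto
      qed (rule O'm)
      finally show "(\<Sum>(s, t)\<in>?D. t - s) < \<delta>" using O'm by simp
    qed
    then have "(\<Sum>i\<in>q. dist (U (fst (?e i))) (U (snd (?e i)))) < \<epsilon>"
      by (subst (asm) sum.reindex[OF inj]) (simp add: o_def case_prod_beta)
    then have q: "(\<Sum>(t,K)\<in>q. norm (?\<Delta> K)) < \<epsilon>"
      by (simp add: case_prod_beta dist_norm norm_minus_commute)
    have "norm (U x - U a) = norm (\<Sum>(t,K)\<in>p. ?\<Delta> K)"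
      using additive_tagged_division_1[OF _ p(1), of U] x by simp
    also have "\<dots> \<le> (\<Sum>(t,K)\<in>p. norm (?\<Delta> K))"
      by (rule order_trans[OF norm_sum]) (simp add: case_prod_beta)
    also have "\<dots> = (\<Sum>(t,K)\<in>q. norm (?\<Delta> K)) + (\<Sum>(t,K)\<in>p - q. norm (?\<Delta> K))"
      by (subst add.commute, rule sum.subset_diff) (use fin in \<open>auto simp: q_def\<close>)
    also have "(\<Sum>(t,K)\<in>p - q. norm (?\<Delta> K)) \<le> (\<Sum>(t,K)\<in>p - q. \<epsilon> * (Sup K - Inf K))"
    proof (rule sum_mono, clarify)
      fix t K assume tK: "(t,K) \<in> p" "(t,K) \<notin> q"
      obtain u v where uv: "K = {u..v}" "a \<le> u" "u \<le> t" "t \<le> v" "v \<le> b" using cell[OF tK(1)] by auto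
      show "norm (?\<Delta> K) \<le> \<epsilon> * (Sup K - Inf K)"
      proof (cases "t \<in> N")
        case True
        then have "Sup K = Inf K" using tK by (auto simp: q_def)
        then show ?thesis by simp
      next
        case False
        then have t: "t \<in> {a..b} - N" using uv by auto
        have "{u..v} \<subseteq> ball t (d t)" using fineD[OF tK(1)] t uv by (auto simp: \<gamma>_def)
        moreover have "u \<in> {u..v}" "v \<in> {u..v}" using uv by auto
        ultimately have "\<bar>u - t\<bar> < d t" "\<bar>v - t\<bar> < d t" by (auto simp: dist_real_def abs_minus_commute)
        then have "norm (U u - U t) \<le> \<epsilon> * (t - u)" "norm (U v - U t) \<le> \<epsilon> * (v - t)"
          using d(2)[OF t, of u] d(2)[OF t, of v] uv by auto
        moreover have "norm (U v - U u) \<le> norm (U v - U t) + norm (U u - U t)"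
          by (metis dist_norm dist_triangle2)
        ultimately have "norm (U v - U u) \<le> \<epsilon> * (v - u)" by (simp add: algebra_simps)
        then show ?thesis using uv by simp
      qed
    qed
    also have "(\<Sum>(t,K)\<in>p - q. \<epsilon> * (Sup K - Inf K)) \<le> (\<Sum>(t,K)\<in>p. \<epsilon> * (Sup K - Inf K))"
    proof (rule sum_mono2[OF fin])
      fix i assume "i \<in> p - (p - q)"
      then show "0 \<le> (case i of (t, K) \<Rightarrow> \<epsilon> * (Sup K - Inf K))"
        using cell \<open>\<epsilon> > 0\<close> by (cases i) force
    qed auto
    also have "\<dots> = \<epsilon> * (\<Sum>(t,K)\<in>p. Sup K - Inf K)"
      by (simp add: sum_distrib_left case_prod_beta)
    also have "(\<Sum>(t,K)\<in>p. Sup K - Inf K) = x - a"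
      using additive_tagged_division_1[OF _ p(1), of "\<lambda>x. x"] x by simp
    finally show ?thesis using q by (simp add: algebra_simps)
  qed
  note * = this
  have "((\<lambda>\<epsilon>. \<epsilon> * (1 + (x - a))) \<longlongrightarrow> 0 * (1 + (x - a))) (at_right 0)"
    by (intro tendsto_intros)
  moreover have "\<forall>\<^sub>F \<epsilon> in at_right 0. norm (U x - U a) \<le> \<epsilon> * (1 + (x - a))"
    using eventually_at_right_less[of "0::real"] by eventually_elim (rule *)
  ultimately have "norm (U x - U a) \<le> 0 * (1 + (x - a))"
    by (rule tendsto_lowerbound) simp
  then show ?thesis by simp
qed

text \<open>One criterion that serves differences, bilinear products and functions agreeing on the
  interval.\<close>

lemma absolutely_continuous_on_Icc_dist_le:
  assumes F: "absolutely_continuous_on_Icc a b F" and G: "absolutely_continuous_on_Icc a b G"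
    and le: "\<And>s t. s \<in> {a..b} \<Longrightarrow> t \<in> {a..b} \<Longrightarrow> dist (H s) (H t) \<le> C * dist (F s) (F t) + C * dist (G s) (G t)"
  shows "absolutely_continuous_on_Icc a b H"
  unfolding absolutely_continuous_on_Icc_def
proof (intro allI impI)
  fix \<epsilon> :: real assume "\<epsilon> > 0"
  \<comment> \<open>\<open>C\<close> carries no sign condition, hence the absolute value; the added
    1 keeps the denominator positive.\<close>
  define \<epsilon>' where "\<epsilon>' = \<epsilon> / (\<bar>C\<bar> + 1) / 2"
  have "\<epsilon>' > 0" using \<open>\<epsilon> > 0\<close> by (simp add: \<epsilon>'_def)
  let ?P = "\<lambda>D. finite D \<and> (\<forall>(s, t)\<in>D. a \<le> s \<and> s \<le> t \<and> t \<le> b) \<and>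
        pairwise (\<lambda>p q. {fst p<..<snd p} \<inter> {fst q<..<snd q} = {}) D"
  obtain d1 where d1: "d1 > 0" "\<And>D. ?P D \<Longrightarrow> (\<Sum>(s, t)\<in>D. t - s) < d1 \<Longrightarrow> (\<Sum>(s, t)\<in>D. dist (F s) (F t)) < \<epsilon>'"
    using F \<open>\<epsilon>' > 0\<close> unfolding absolutely_continuous_on_Icc_def by meson
  obtain d2 where d2: "d2 > 0" "\<And>D. ?P D \<Longrightarrow> (\<Sum>(s, t)\<in>D. t - s) < d2 \<Longrightarrow> (\<Sum>(s, t)\<in>D. dist (G s) (G t)) < \<epsilon>'"
    using G \<open>\<epsilon>' > 0\<close> unfolding absolutely_continuous_on_Icc_def by meson
  show "\<exists>\<delta>>0. \<forall>D. finite D \<and> (\<forall>(s, t)\<in>D. a \<le> s \<and> s \<le> t \<and> t \<le> b) \<and>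
        pairwise (\<lambda>p q. {fst p<..<snd p} \<inter> {fst q<..<snd q} = {}) D \<and> (\<Sum>(s, t)\<in>D. t - s) < \<delta> \<longrightarrow>
        (\<Sum>(s, t)\<in>D. dist (H s) (H t)) < \<epsilon>"
  proof (intro exI[of _ "min d1 d2"] conjI allI impI)
    show "min d1 d2 > 0" using d1 d2 by simp
    fix D :: "(real \<times> real) set"
    assume "finite D \<and> (\<forall>(s, t)\<in>D. a \<le> s \<and> s \<le> t \<and> t \<le> b) \<and>
        pairwise (\<lambda>p q. {fst p<..<snd p} \<inter> {fst q<..<snd q} = {}) D \<and> (\<Sum>(s, t)\<in>D. t - s) < min d1 d2"
    then have D: "?P D" "(\<Sum>(s, t)\<in>D. t - s) < d1" "(\<Sum>(s, t)\<in>D. t - s) < d2" by auto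
    have "(\<Sum>(s, t)\<in>D. dist (H s) (H t)) \<le> (\<Sum>(s, t)\<in>D. \<bar>C\<bar> * dist (F s) (F t) + \<bar>C\<bar> * dist (G s) (G t))"
    proof (rule sum_mono, clarify)
      fix s t assume "(s,t) \<in> D"
      then have "dist (H s) (H t) \<le> C * dist (F s) (F t) + C * dist (G s) (G t)"
        using D(1) by (intro le) auto
      also have "\<dots> \<le> \<bar>C\<bar> * dist (F s) (F t) + \<bar>C\<bar> * dist (G s) (G t)"
        by (intro add_mono mult_right_mono) auto
      finally show "dist (H s) (H t) \<le> \<bar>C\<bar> * dist (F s) (F t) + \<bar>C\<bar> * dist (G s) (G t)" .
    qed
    also have "\<dots> = \<bar>C\<bar> * ((\<Sum>(s, t)\<in>D. dist (F s) (F t)) + (\<Sum>(s, t)\<in>D. dist (G s) (G t)))"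
      by (simp add: case_prod_beta sum.distrib sum_distrib_left distrib_left)
    also have "\<dots> \<le> \<bar>C\<bar> * (\<epsilon>' + \<epsilon>')"
      using d1(2)[OF D(1,2)] d2(2)[OF D(1,3)] by (intro mult_left_mono) auto
    also have "\<dots> < \<epsilon>"
    proof -
      have "\<epsilon>' + \<epsilon>' = \<epsilon> / (\<bar>C\<bar> + 1)" unfolding \<epsilon>'_def by (rule field_sum_of_halves)
      then have "\<bar>C\<bar> * (\<epsilon>' + \<epsilon>') = \<epsilon> * (\<bar>C\<bar> / (\<bar>C\<bar> + 1))" by simp
      also have "\<dots> < \<epsilon> * 1" using \<open>\<epsilon> > 0\<close> by (intro mult_strict_left_mono) auto
      finally show ?thesis by simp
    qed
    finally show "(\<Sum>(s, t)\<in>D. dist (H s) (H t)) < \<epsilon>" .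
  qed
qed

lemma absolutely_continuous_imp_continuous_on:
  assumes "absolutely_continuous_on_Icc a b F"
  shows "continuous_on {a..b} F"
  unfolding continuous_on_iff
proof (intro ballI allI impI)
  fix x \<epsilon> assume x: "x \<in> {a..b}" and "(\<epsilon>::real) > 0"
  then obtain \<delta> where \<delta>: "\<delta> > 0" "\<And>D. finite D \<Longrightarrow> (\<forall>(s, t)\<in>D. a \<le> s \<and> s \<le> t \<and> t \<le> b) \<Longrightarrow>
      pairwise (\<lambda>p q. {fst p<..<snd p} \<inter> {fst q<..<snd q} = {}) D \<Longrightarrow>
      (\<Sum>(s, t)\<in>D. t - s) < \<delta> \<Longrightarrow> (\<Sum>(s, t)\<in>D. dist (F s) (F t)) < \<epsilon>"
    using assms unfolding absolutely_continuous_on_Icc_def by meson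
  have "dist (F y) (F x) < \<epsilon>" if "y \<in> {a..b}" "dist y x < \<delta>" for y
    using \<delta>(2)[of "{(min x y, max x y)}"] that x
    by (cases "x \<le> y") (auto simp: dist_real_def dist_commute)
  then show "\<exists>d>0. \<forall>x'\<in>{a..b}. dist x' x < d \<longrightarrow> dist (F x') (F x) < \<epsilon>"
    using \<delta>(1) by blast
qed

lemma absolutely_continuous_bounded_bilinear:
  assumes p: "bounded_bilinear p"
    and F: "absolutely_continuous_on_Icc a b F" and G: "absolutely_continuous_on_Icc a b G"
  shows "absolutely_continuous_on_Icc a b (\<lambda>t. p (F t) (G t))"
proof -
  interpret bounded_bilinear p by fact
  obtain K where K: "K > 0" "\<And>x y. norm (p x y) \<le> norm x * norm y * K" using pos_bounded by blast
  have bdd: "\<exists>M>0. \<forall>t\<in>{a..b}. norm (H t) \<le> M" if "absolutely_continuous_on_Icc a b H" for H :: "real \<Rightarrow> 'z::real_normed_vector"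
  proof -
    have "bounded (H ` {a..b})"
      by (rule compact_imp_bounded[OF compact_continuous_image[OF absolutely_continuous_imp_continuous_on[OF that] compact_Icc]])
    then show ?thesis unfolding bounded_pos by auto
  qed
  obtain M1 where M1: "M1 > 0" "\<And>t. t\<in>{a..b} \<Longrightarrow> norm (F t) \<le> M1" using bdd[OF F] by blast
  obtain M2 where M2: "M2 > 0" "\<And>t. t\<in>{a..b} \<Longrightarrow> norm (G t) \<le> M2" using bdd[OF G] by blast
  show ?thesis
  proof (rule absolutely_continuous_on_Icc_dist_le[OF F G, where C = "K * (M1 + M2)"])
    fix s t assume st: "s \<in> {a..b}" "t \<in> {a..b}"
    have "dist (p (F s) (G s)) (p (F t) (G t)) = norm (p (F s - F t) (G s) + p (F t) (G s - G t))"
      by (simp add: dist_norm diff_left diff_right)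
    also have "\<dots> \<le> norm (F s - F t) * norm (G s) * K + norm (F t) * norm (G s - G t) * K"
      by (intro order_trans[OF norm_triangle_ineq] add_mono K)
    also have "\<dots> \<le> norm (F s - F t) * (M1 + M2) * K + (M1 + M2) * norm (G s - G t) * K"
      using M1(1) M2(1) M1(2)[OF st(2)] M2(2)[OF st(1)] K(1)
      by (intro add_mono mult_right_mono mult_left_mono) auto
    finally show "dist (p (F s) (G s)) (p (F t) (G t)) \<le>
        K * (M1 + M2) * dist (F s) (F t) + K * (M1 + M2) * dist (G s) (G t)"
      by (simp add: dist_norm mult_ac)
  qed
qed

lemma integrable_bounded_bilinear_continuous:
  fixes p :: "'a::euclidean_space \<Rightarrow> 'b::euclidean_space \<Rightarrow> 'c::euclidean_space"
  assumes p: "bounded_bilinear p"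
    and F: "continuous_on {a..b::real} F" and g: "integrable (lebesgue_on {a..b}) g"
  shows "integrable (lebesgue_on {a..b}) (\<lambda>t. p (F t) (g t))"
proof -
  interpret bounded_bilinear p by fact
  obtain K where K: "K > 0" "\<And>x y. norm (p x y) \<le> norm x * norm y * K" using pos_bounded by blast
  have "bounded (F ` {a..b})" by (rule compact_imp_bounded[OF compact_continuous_image[OF F compact_Icc]])
  then obtain M where M: "M > 0" "\<And>t. t \<in> {a..b} \<Longrightarrow> norm (F t) \<le> M" unfolding bounded_pos by auto
  have [measurable]: "F \<in> borel_measurable (lebesgue_on {a..b})" "g \<in> borel_measurable (lebesgue_on {a..b})"
    using F g by (auto intro: continuous_imp_measurable_on_sets_lebesgue)
  have "continuous_on UNIV (\<lambda>x. p (fst x) (snd x))"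
    by (rule continuous_on[OF continuous_on_fst[OF continuous_on_id] continuous_on_snd[OF continuous_on_id]])
  then have m: "(\<lambda>t. p (F t) (g t)) \<in> borel_measurable (lebesgue_on {a..b})"
    by (intro borel_measurable_continuous_Pair[where H = p]) auto
  show ?thesis
  proof (rule Bochner_Integration.integrable_bound[OF _ m])
    show "integrable (lebesgue_on {a..b}) (\<lambda>t. (M * K) * norm (g t))" using g by auto
    show "AE x in lebesgue_on {a..b}. norm (p (F x) (g x)) \<le> norm (M * K * norm (g x))"
    proof (rule AE_I2)
      fix t assume "t \<in> space (lebesgue_on {a..b})"
      then have t: "t \<in> {a..b}" by simp
      have "norm (p (F t) (g t)) \<le> norm (F t) * norm (g t) * K" by (rule K)
      also have "\<dots> \<le> M * norm (g t) * K" using M(2)[OF t] K(1) by (intro mult_right_mono) auto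
      finally show "norm (p (F t) (g t)) \<le> norm (M * K * norm (g t))" using M(1) K(1) by (simp add: mult_ac abs_mult)
    qed
  qed
qed

text \<open>This is absolute continuity with almost everywhere derivative \<open>g\<close>, encoded
  through the integral. The integral form makes uniqueness immediate, the derivative form gives the
  product rule; \<open>is_primitive_AE_derivative\<close> and \<open>is_primitiveI\<close> translate
  between the two.\<close>

definition is_primitive :: "real \<Rightarrow> real \<Rightarrow> (real \<Rightarrow> 'a::euclidean_space) \<Rightarrow> (real \<Rightarrow> 'a) \<Rightarrow> bool" where
  "is_primitive a b F g \<longleftrightarrow> integrable (lebesgue_on {a..b}) g \<and>
     (\<forall>t\<in>{a..b}. F t = F a + (LINT s|lebesgue_on {a..t}. g s))"

lemma is_primitive_integrable: "is_primitive a b F g \<Longrightarrow> integrable (lebesgue_on {a..b}) g"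
  unfolding is_primitive_def by blast

lemma is_primitiveD: "is_primitive a b F g \<Longrightarrow> t \<in> {a..b} \<Longrightarrow> F t = F a + (LINT s|lebesgue_on {a..t}. g s)"
  unfolding is_primitive_def by blast

lemma LINT_single:
  fixes g :: "real \<Rightarrow> 'a::euclidean_space"
  assumes g: "integrable (lebesgue_on {a..b}) g" and "a \<le> b"
  shows "(LINT s|lebesgue_on {a..a}. g s) = 0"
proof -
  have "integrable (lebesgue_on {a..a}) g" using g by (rule integrable_subinterval) (use \<open>a \<le> b\<close> in auto)
  then have "(LINT s|lebesgue_on {a..a}. g s) = integral {a..a} g"
    by (rule lebesgue_integral_eq_integral) simp
  then show ?thesis by simp
qed

lemma is_primitive_integral:
  fixes g :: "real \<Rightarrow> 'a::euclidean_space"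
  assumes "integrable (lebesgue_on {a..b}) g"
  shows "is_primitive a b (\<lambda>t. c + (LINT s|lebesgue_on {a..t}. g s)) g"
proof -
  show ?thesis
    unfolding is_primitive_def
  proof (intro conjI ballI assms)
    fix t assume "t \<in> {a..b}"
    then have "a \<le> b" by simp
    from LINT_single[OF assms this] show "c + (LINT s|lebesgue_on {a..t}. g s) =
        c + (LINT s|lebesgue_on {a..a}. g s) + (LINT s|lebesgue_on {a..t}. g s)"
      by (simp only: add_0_right)
  qed
qed

lemma is_primitive_absolutely_continuous:
  "is_primitive a b F g \<Longrightarrow> absolutely_continuous_on_Icc a b F"
  by (rule absolutely_continuous_indefinite_integral[OF is_primitive_integrable is_primitiveD])

lemma is_primitive_continuous_on: "is_primitive a b F g \<Longrightarrow> continuous_on {a..b} F"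
  by (intro absolutely_continuous_imp_continuous_on is_primitive_absolutely_continuous)

lemma is_primitive_integral_eq:
  "is_primitive a b F g \<Longrightarrow> a \<le> b \<Longrightarrow> (LINT s|lebesgue_on {a..b}. g s) = F b - F a"
  using is_primitiveD[of a b F g b] by (metis add_diff_cancel_left' atLeastAtMost_iff order_refl)

text \<open>The Lebesgue integral agrees with the gauge integral here, so the differentiation
  theorem applies.\<close>

lemma is_primitive_AE_derivative:
  assumes "is_primitive a b F g"
  shows "AE t in lebesgue_on {a..b}. (F has_vector_derivative g t) (at t within {a..b})"
proof -
  have g: "integrable (lebesgue_on {a..b}) g" using assms by (rule is_primitive_integrable)
  then have gi: "g integrable_on {a..b}" by (intro integrable_on_lebesgue_on) auto
  have F: "F t = F a + integral {a..t} g" if "t \<in> {a..b}" for t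
  proof -
    have "integrable (lebesgue_on {a..t}) g" using g by (rule integrable_subinterval) (use that in auto)
    then show ?thesis using is_primitiveD[OF assms that] lebesgue_integral_eq_integral[of "{a..t}" g] by (metis lborelD sets_completionI_sets sets_lborel borel_closed closed_atLeastAtMost)
  qed
  let ?N = "{x \<in> {a..b}. \<not> ((\<lambda>u. integral {a..u} g) has_vector_derivative g x) (at x within {a..b})}"
  have "?N \<in> null_sets lebesgue"
    using negligible_not_deriv_integral[OF gi] by (simp add: negligible_iff_null_sets)
  then have "AE t in lebesgue. t \<notin> ?N" by (rule AE_not_in)
  then have "AE t in lebesgue. t \<in> {a..b} \<longrightarrow> (F has_vector_derivative g t) (at t within {a..b})"
  proof eventually_elim
    case (elim t)
    show ?case
    proof
      assume t: "t \<in> {a..b}"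
      then have "((\<lambda>u. F a + integral {a..u} g) has_vector_derivative g t) (at t within {a..b})"
        using elim has_vector_derivative_add[OF has_vector_derivative_const[of "F a"]] by fastforce
      then show "(F has_vector_derivative g t) (at t within {a..b})"
        using has_vector_derivative_transform[OF t, of F "\<lambda>u. F a + integral {a..u} g"] F by blast
    qed
  qed
  then show ?thesis by (subst AE_restrict_space_iff) auto
qed

text \<open>The difference of \<open>F\<close> and the indefinite integral of \<open>g\<close> is
  absolutely continuous with derivative zero almost everywhere, hence constant.\<close>

lemma is_primitiveI:
  fixes F :: "real \<Rightarrow> 'a::euclidean_space"
  assumes F: "absolutely_continuous_on_Icc a b F"
    and der: "AE t in lebesgue_on {a..b}. (F has_vector_derivative g t) (at t within {a..b})"
    and g: "integrable (lebesgue_on {a..b}) g"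
  shows "is_primitive a b F g"
  unfolding is_primitive_def
proof (intro conjI ballI g)
  fix t assume t: "t \<in> {a..b}"
  define G where "G t = 0 + (LINT s|lebesgue_on {a..t}. g s)" for t
  have G: "is_primitive a b G g" unfolding G_def by (rule is_primitive_integral[OF g])
  have "F t - G t = F a - G a"
  proof (rule absolutely_continuous_zero_derivative_const[OF _ _ t])
    show "absolutely_continuous_on_Icc a b (\<lambda>t. F t - G t)"
    proof (rule absolutely_continuous_on_Icc_dist_le[OF F is_primitive_absolutely_continuous[OF G], where C = 1])
      fix s t
      have "dist (F s - G s) (F t - G t) = norm ((F s - F t) - (G s - G t))"
        by (simp add: dist_norm algebra_simps)
      also have "\<dots> \<le> norm (F s - F t) + norm (G s - G t)" by (rule norm_triangle_ineq4)
      finally show "dist (F s - G s) (F t - G t) \<le> 1 * dist (F s) (F t) + 1 * dist (G s) (G t)"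
        by (simp add: dist_norm)
    qed
    show "AE t in lebesgue_on {a..b}. ((\<lambda>t. F t - G t) has_vector_derivative 0) (at t within {a..b})"
      using der is_primitive_AE_derivative[OF G]
      by eventually_elim (drule (1) has_vector_derivative_diff, simp)
  qed
  moreover have "G t = G a + (LINT s|lebesgue_on {a..t}. g s)" by (rule is_primitiveD[OF G t])
  ultimately show "F t = F a + (LINT s|lebesgue_on {a..t}. g s)" by (simp add: algebra_simps)
qed

text \<open>Partial integration: the product rule holds wherever both factors are differentiable,
  and absolute continuity of the product turns this into an integral identity.\<close>

lemma is_primitive_bounded_bilinear:
  fixes p :: "'a::euclidean_space \<Rightarrow> 'b::euclidean_space \<Rightarrow> 'c::euclidean_space"
  assumes p: "bounded_bilinear p" and F: "is_primitive a b F f" and G: "is_primitive a b G g"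
  shows "is_primitive a b (\<lambda>t. p (F t) (G t)) (\<lambda>t. p (F t) (g t) + p (f t) (G t))"
proof (rule is_primitiveI)
  show "absolutely_continuous_on_Icc a b (\<lambda>t. p (F t) (G t))"
    by (rule absolutely_continuous_bounded_bilinear[OF p is_primitive_absolutely_continuous[OF F] is_primitive_absolutely_continuous[OF G]])
  show "AE t in lebesgue_on {a..b}. ((\<lambda>t. p (F t) (G t)) has_vector_derivative p (F t) (g t) + p (f t) (G t)) (at t within {a..b})"
    using is_primitive_AE_derivative[OF F] is_primitive_AE_derivative[OF G]
    by eventually_elim (rule bounded_bilinear.has_vector_derivative[OF p])
  have p': "bounded_bilinear (\<lambda>x y. p y x)" using p by (rule bounded_bilinear.flip)
  show "integrable (lebesgue_on {a..b}) (\<lambda>t. p (F t) (g t) + p (f t) (G t))"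
    using integrable_bounded_bilinear_continuous[OF p is_primitive_continuous_on[OF F], of g]
      integrable_bounded_bilinear_continuous[OF p' is_primitive_continuous_on[OF G], of f]
      is_primitive_integrable[OF F] is_primitive_integrable[OF G] by auto
qed

lemma is_primitive_C1:
  fixes F :: "real \<Rightarrow> 'a::euclidean_space"
  assumes F: "\<And>t. t \<in> {a..b} \<Longrightarrow> (F has_vector_derivative f t) (at t within {a..b})"
    and f: "continuous_on {a..b} f"
  shows "is_primitive a b F f"
  unfolding is_primitive_def
proof (intro conjI ballI)
  show "integrable (lebesgue_on {a..b}) f"
    using continuous_imp_integrable_real[OF f] .
  fix t assume t: "t \<in> {a..b}"
  have "(f has_integral (F t - F a)) {a..t}"
    using t by (intro fundamental_theorem_of_calculus) (auto intro: has_vector_derivative_within_subset[OF F])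
  moreover have "integrable (lebesgue_on {a..t}) f"
    by (intro continuous_imp_integrable_real continuous_on_subset[OF f]) (use t in auto)
  ultimately show "F t = F a + (LINT s|lebesgue_on {a..t}. f s)"
    by (simp add: lebesgue_integral_eq_integral integral_unique)
qed

section \<open>Square integrable controls\<close>

lemma Cauchy_Schwarz_integral:
  fixes f g :: "'a \<Rightarrow> real"
  assumes f: "f \<in> borel_measurable M" "integrable M (\<lambda>x. (f x)\<^sup>2)"
    and g: "g \<in> borel_measurable M" "integrable M (\<lambda>x. (g x)\<^sup>2)"
  shows "integrable M (\<lambda>x. f x * g x)"
    and "\<bar>LINT x|M. f x * g x\<bar> \<le> sqrt (LINT x|M. (f x)\<^sup>2) * sqrt (LINT x|M. (g x)\<^sup>2)"
proof -
  note [measurable] = f(1) g(1)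
  show int: "integrable M (\<lambda>x. f x * g x)"
  proof (rule Bochner_Integration.integrable_bound)
    show "integrable M (\<lambda>x. (f x)\<^sup>2 + (g x)\<^sup>2)" using f g by auto
    show "AE x in M. norm (f x * g x) \<le> norm ((f x)\<^sup>2 + (g x)\<^sup>2)"
    proof (rule AE_I2)
      fix x
      have "2 * (\<bar>f x\<bar> * \<bar>g x\<bar>) \<le> (f x)\<^sup>2 + (g x)\<^sup>2"
        using sum_squares_bound[of "\<bar>f x\<bar>" "\<bar>g x\<bar>"] by (simp add: mult.assoc)
      moreover have "0 \<le> \<bar>f x\<bar> * \<bar>g x\<bar>" by simp
      ultimately have "\<bar>f x\<bar> * \<bar>g x\<bar> \<le> (f x)\<^sup>2 + (g x)\<^sup>2" by linarith
      then show "norm (f x * g x) \<le> norm ((f x)\<^sup>2 + (g x)\<^sup>2)"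
        by (simp add: abs_mult)
    qed
  qed measurable
  define F where "F = (LINT x|M. (f x)\<^sup>2)"
  define G where "G = (LINT x|M. (g x)\<^sup>2)"
  define B where "B = (LINT x|M. f x * g x)"
  have pos: "0 \<le> F" "0 \<le> G" by (auto simp: F_def G_def)
  have quad: "0 \<le> F + 2 * c * B + c\<^sup>2 * G" for c
  proof -
    have "0 \<le> (LINT x|M. (f x + c * g x)\<^sup>2)" by simp
    also have "(\<lambda>x. (f x + c * g x)\<^sup>2) = (\<lambda>x. (f x)\<^sup>2 + (2 * c) * (f x * g x) + c\<^sup>2 * (g x)\<^sup>2)"
      by (auto simp: power2_eq_square algebra_simps)
    also have "(LINT x|M. \<dots> x) = F + 2 * c * B + c\<^sup>2 * G"
      using f(2) g(2) int by (simp add: F_def G_def B_def)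
    finally show ?thesis .
  qed
  have "B\<^sup>2 \<le> F * G"
  proof (cases "G = 0")
    case True
    have "B = 0"
    proof (rule ccontr)
      assume "B \<noteq> 0"
      \<comment> \<open>This value of \<open>c\<close> makes the right side of \<open>quad\<close>
        equal to -1 when \<open>G = 0\<close>.\<close>
      then show False using quad[of "- (F + 1) / (2 * B)"] True by (simp add: field_simps)
    qed
    then show ?thesis using True by simp
  next
    case False
    then have "G > 0" using pos by simp
    \<comment> \<open>The quadratic polynomial in \<open>c\<close> is smallest at
      \<open>c = - B / G\<close>.\<close>
    have "0 \<le> (F + 2 * (- B / G) * B + (- B / G)\<^sup>2 * G) * G"
      using quad[of "- B / G"] pos by (intro mult_nonneg_nonneg) auto
    also have "\<dots> = F * G - B\<^sup>2"
      using \<open>G > 0\<close> by (simp add: field_simps power2_eq_square)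
    finally show ?thesis by simp
  qed
  then have "\<bar>B\<bar> \<le> sqrt (F * G)" by (rule real_le_rsqrt[of "\<bar>B\<bar>", simplified])
  then show "\<bar>LINT x|M. f x * g x\<bar> \<le> sqrt (LINT x|M. (f x)\<^sup>2) * sqrt (LINT x|M. (g x)\<^sup>2)"
    by (simp add: F_def G_def B_def real_sqrt_mult)
qed

lemma L2_spaceD:
  assumes "f \<in> L2_space T"
  shows "f \<in> borel_measurable (lebesgue_on {0..T})" "integrable (lebesgue_on {0..T}) (\<lambda>t. (f t)\<^sup>2)"
  using assms by (auto simp: L2_space_def)

lemma L2_space_lincomb:
  assumes f: "f \<in> L2_space T" and g: "g \<in> L2_space T"
  shows "(\<lambda>t. x * f t + y * g t) \<in> L2_space T"
proof -
  note [measurable] = L2_spaceD(1)[OF f] L2_spaceD(1)[OF g]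
  have "(\<lambda>t. (x * f t + y * g t)\<^sup>2) = (\<lambda>t. x\<^sup>2 * (f t)\<^sup>2 + (2 * x * y) * (f t * g t) + y\<^sup>2 * (g t)\<^sup>2)"
    by (auto simp: power2_eq_square algebra_simps)
  moreover have "integrable (lebesgue_on {0..T}) (\<lambda>t. x\<^sup>2 * (f t)\<^sup>2 + (2 * x * y) * (f t * g t) + y\<^sup>2 * (g t)\<^sup>2)"
    using L2_spaceD[OF f] L2_spaceD[OF g] Cauchy_Schwarz_integral(1)[OF L2_spaceD[OF f] L2_spaceD[OF g]]
    by (intro Bochner_Integration.integrable_add integrable_mult_right) auto
  ultimately show ?thesis by (simp add: L2_space_def)
qed

lemma L2_space_add: "f \<in> L2_space T \<Longrightarrow> g \<in> L2_space T \<Longrightarrow> (\<lambda>t. f t + g t) \<in> L2_space T"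
  using L2_space_lincomb[of f T g 1 1] by simp

lemma L2_space_scale: "f \<in> L2_space T \<Longrightarrow> (\<lambda>t. c * f t) \<in> L2_space T"
  using L2_space_lincomb[of f T f c 0] by simp

lemma L2_space_zero: "(\<lambda>t. 0) \<in> L2_space T"
  by (simp add: L2_space_def)

lemma L2_norm_nonneg: "0 \<le> L2_norm T f"
  by (simp add: L2_norm_def)

lemma L2_norm_scale: "L2_norm T (\<lambda>t. c * f t) = \<bar>c\<bar> * L2_norm T f"
  by (simp add: L2_norm_def power_mult_distrib real_sqrt_mult)

lemma L2_norm_triangle:
  assumes f: "f \<in> L2_space T" and g: "g \<in> L2_space T"
  shows "L2_norm T (\<lambda>t. f t + g t) \<le> L2_norm T f + L2_norm T g"
proof -
  note CS = Cauchy_Schwarz_integral[OF L2_spaceD[OF f] L2_spaceD[OF g]]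
  have "(LINT t|lebesgue_on {0..T}. (f t + g t)\<^sup>2) =
      (LINT t|lebesgue_on {0..T}. (f t)\<^sup>2 + 2 * (f t * g t) + (g t)\<^sup>2)"
    by (intro Bochner_Integration.integral_cong) (auto simp: power2_eq_square algebra_simps)
  also have "\<dots> = (L2_norm T f)\<^sup>2 + 2 * (LINT t|lebesgue_on {0..T}. f t * g t) + (L2_norm T g)\<^sup>2"
    using L2_spaceD[OF f] L2_spaceD[OF g] CS(1) by (simp add: L2_norm_def)
  also have "\<dots> \<le> (L2_norm T f)\<^sup>2 + 2 * (L2_norm T f * L2_norm T g) + (L2_norm T g)\<^sup>2"
    using CS(2) by (auto simp: L2_norm_def)
  also have "\<dots> = (L2_norm T f + L2_norm T g)\<^sup>2" by (simp add: power2_eq_square algebra_simps)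
  finally show ?thesis
    unfolding L2_norm_def[of T "\<lambda>t. f t + g t"] 
    by (intro real_le_lsqrt add_nonneg_nonneg L2_norm_nonneg)
qed

section \<open>Small controls, and replacement and uniqueness of Frechet differentials\<close>

lemma eventually_L2_nhds0:
  "eventually P (L2_nhds0 T) \<longleftrightarrow> (\<exists>d>0. \<forall>h\<in>L2_space T. L2_norm T h < d \<longrightarrow> P h)"
proof
  assume "eventually P (L2_nhds0 T)"
  then obtain Q where "eventually Q (nhds (0::real))" "\<And>h. Q (L2_norm T h) \<Longrightarrow> h \<in> L2_space T \<Longrightarrow> P h"
    unfolding L2_nhds0_def eventually_inf_principal eventually_filtercomap by blast
  then show "\<exists>d>0. \<forall>h\<in>L2_space T. L2_norm T h < d \<longrightarrow> P h"
    unfolding eventually_nhds_metric by (force simp: L2_norm_nonneg)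
next
  assume "\<exists>d>0. \<forall>h\<in>L2_space T. L2_norm T h < d \<longrightarrow> P h"
  then obtain d where d: "d > 0" "\<And>h. h \<in> L2_space T \<Longrightarrow> L2_norm T h < d \<Longrightarrow> P h" by blast
  have "eventually (\<lambda>x. x < d) (nhds (0::real))" using d(1) eventually_nhds_in_open[of "{..<d}" 0] by simp
  then show "eventually P (L2_nhds0 T)"
    unfolding L2_nhds0_def eventually_inf_principal eventually_filtercomap using d(2) by blast
qed

lemma prod_lessThan_add: "(\<Prod>j<m + n. F j) = (\<Prod>j<m. F j) * (\<Prod>j<n. F (m + j :: nat))" for F :: "nat \<Rightarrow> 'a::comm_monoid_mult"
  by (induction n) (simp_all add: mult.assoc)

lemma prod_list_map_rev_nth:
  "(\<Prod>j<length vs. F (rev vs ! j)) = (\<Prod>v\<leftarrow>vs. F v)" for F :: "_ \<Rightarrow> 'a::comm_monoid_mult"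
proof (induction vs)
  case (Cons v vs)
  have "(\<Prod>j<length vs. F ((rev vs @ [v]) ! j)) = (\<Prod>j<length vs. F (rev vs ! j))"
    by (intro prod.cong) (auto simp: nth_append)
  then show ?case using Cons by (simp add: nth_append mult.commute)
qed simp

text \<open>\<open>frechet_diff\<close> is pinned down only on lists of controls, so an explicit
  form can replace it only there. That is enough, because the defining estimate never leaves
  \<open>L2_space T\<close>.\<close>

lemma has_frechet_diff_cong:
  assumes "\<And>g vs. g \<in> L2_space T \<Longrightarrow> length vs = k \<Longrightarrow> set vs \<subseteq> L2_space T \<Longrightarrow> G g vs = G' g vs"
    and f: "f \<in> L2_space T"
    and G: "has_frechet_diff T k G f A"
  shows "has_frechet_diff T k G' f A"
  unfolding has_frechet_diff_def
proof (intro conjI allI impI)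
  show "bounded_multilinear_form T (Suc k) A" using G by (simp add: has_frechet_diff_def)
  fix \<epsilon> :: real assume "\<epsilon> > 0"
  then obtain d where d: "d > 0" "\<And>h vs. h \<in> L2_space T \<Longrightarrow> L2_norm T h < d \<Longrightarrow> length vs = k \<Longrightarrow>
      set vs \<subseteq> L2_space T \<Longrightarrow>
        \<bar>G (\<lambda>t. f t + h t) vs - G f vs - A (h # vs)\<bar> \<le> \<epsilon> * L2_norm T h * (\<Prod>v\<leftarrow>vs. L2_norm T v)"
    using G unfolding has_frechet_diff_def eventually_L2_nhds0 by meson
  show "\<forall>\<^sub>F h in L2_nhds0 T. \<forall>vs. length vs = k \<and> set vs \<subseteq> L2_space T \<longrightarrow>
        \<bar>G' (\<lambda>t. f t + h t) vs - G' f vs - A (h # vs)\<bar> \<le> \<epsilon> * L2_norm T h * (\<Prod>v\<leftarrow>vs. L2_norm T v)"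
    unfolding eventually_L2_nhds0
  proof (intro exI[of _ d] conjI ballI impI allI d(1))
    fix h vs assume *: "h \<in> L2_space T" "L2_norm T h < d" "length vs = k \<and> set vs \<subseteq> L2_space T"
    then have "G (\<lambda>t. f t + h t) vs = G' (\<lambda>t. f t + h t) vs" "G f vs = G' f vs"
      using assms(1) L2_space_add[OF f] f by auto
    then show "\<bar>G' (\<lambda>t. f t + h t) vs - G' f vs - A (h # vs)\<bar> \<le> \<epsilon> * L2_norm T h * (\<Prod>v\<leftarrow>vs. L2_norm T v)"
      using d(2)[of h vs] * by simp
  qed
qed

text \<open>Both candidates are homogeneous in the increment, so the estimate for a small multiple
  of \<open>h\<close>, divided by the multiple, bounds their difference by an arbitrary
  \<open>\<epsilon>\<close> times a constant.\<close>

lemma has_frechet_diff_unique: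
  assumes A: "has_frechet_diff T k G f A" and A': "has_frechet_diff T k G f A'"
    and h: "h \<in> L2_space T" and vs: "length vs = k" "set vs \<subseteq> L2_space T"
  shows "A (h # vs) = A' (h # vs)"
proof -
  define c where "c = L2_norm T h * (\<Prod>v\<leftarrow>vs. L2_norm T v)"
  have homog: "D ((\<lambda>t. s * h t) # vs) = s * D (h # vs)" if "has_frechet_diff T k G f D" for D s
  proof -
    have "\<forall>us ws f g a b.
        length us + 1 + length ws = Suc k \<and> set us \<subseteq> L2_space T \<and> set ws \<subseteq> L2_space T \<and>
        f \<in> L2_space T \<and> g \<in> L2_space T \<longrightarrow>
        D (us @ (\<lambda>t. a * f t + b * g t) # ws) = a * D (us @ f # ws) + b * D (us @ g # ws)"
      using that unfolding has_frechet_diff_def bounded_multilinear_form_def by blast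
    from this[rule_format, of "[]" vs h h s 0] show ?thesis using h vs by simp
  qed
  have le: "\<bar>A (h # vs) - A' (h # vs)\<bar> \<le> \<epsilon> * (2 * c)" if "\<epsilon> > 0" for \<epsilon>
  proof -
    have "\<forall>\<^sub>F h in L2_nhds0 T. \<bar>G (\<lambda>t. f t + h t) vs - G f vs - A (h # vs)\<bar> \<le> \<epsilon> * L2_norm T h * (\<Prod>v\<leftarrow>vs. L2_norm T v) \<and>
       \<bar>G (\<lambda>t. f t + h t) vs - G f vs - A' (h # vs)\<bar> \<le> \<epsilon> * L2_norm T h * (\<Prod>v\<leftarrow>vs. L2_norm T v)"
      using A A' \<open>\<epsilon> > 0\<close> vs unfolding has_frechet_diff_def
      by (intro eventually_conj) (auto elim!: eventually_mono)
    then obtain d where d: "d > 0" "\<And>h. h \<in> L2_space T \<Longrightarrow> L2_norm T h < d \<Longrightarrow>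
      \<bar>G (\<lambda>t. f t + h t) vs - G f vs - A (h # vs)\<bar> \<le> \<epsilon> * L2_norm T h * (\<Prod>v\<leftarrow>vs. L2_norm T v) \<and>
       \<bar>G (\<lambda>t. f t + h t) vs - G f vs - A' (h # vs)\<bar> \<le> \<epsilon> * L2_norm T h * (\<Prod>v\<leftarrow>vs. L2_norm T v)"
      unfolding eventually_L2_nhds0 by blast
    \<comment> \<open>The added 1 covers controls of norm zero, which need not be the zero
      function.\<close>
    define s where "s = d / (L2_norm T h + 1)"
    have hn: "L2_norm T h + 1 > 0" using L2_norm_nonneg[of T h] by linarith
    then have s: "s > 0" using d(1) by (simp add: s_def)
    have "s * L2_norm T h < d" using d(1) hn by (simp add: s_def field_simps)
    then have "L2_norm T (\<lambda>t. s * h t) < d" using s by (simp add: L2_norm_scale)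
    from d(2)[OF L2_space_scale[OF h] this]
    have "\<bar>A ((\<lambda>t. s * h t) # vs) - A' ((\<lambda>t. s * h t) # vs)\<bar> \<le> 2 * (\<epsilon> * L2_norm T (\<lambda>t. s * h t) * (\<Prod>v\<leftarrow>vs. L2_norm T v))"
      by linarith
    then have "s * \<bar>A (h # vs) - A' (h # vs)\<bar> \<le> s * (\<epsilon> * (2 * c))"
      using s by (simp add: homog[OF A] homog[OF A'] L2_norm_scale c_def abs_mult right_diff_distrib[symmetric] mult_ac)
    then show ?thesis using s by simp
  qed
  have "((\<lambda>\<epsilon>. \<epsilon> * (2 * c)) \<longlongrightarrow> 0 * (2 * c)) (at_right 0)"
    by (intro tendsto_intros)
  moreover have "\<forall>\<^sub>F \<epsilon> in at_right 0. \<bar>A (h # vs) - A' (h # vs)\<bar> \<le> \<epsilon> * (2 * c)"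
    using eventually_at_right_less[of "0::real"] by eventually_elim (rule le)
  ultimately have "\<bar>A (h # vs) - A' (h # vs)\<bar> \<le> 0 * (2 * c)"
    by (rule tendsto_lowerbound) simp
  then show ?thesis by simp
qed

section \<open>Entire functionals and their Frechet differentials\<close>

text \<open>\<open>B n\<close> is an \<open>n\<close>-linear form that reads only the first
  \<open>n\<close> entries of an infinite argument sequence; sequences make changing one slot a
  plain function update. The functional of interest is the sum of \<open>B n\<close> on constant
  sequences, a power series of infinite radius of convergence.\<close>

locale entire_forms =
  fixes T :: real and B :: "nat \<Rightarrow> (nat \<Rightarrow> real \<Rightarrow> real) \<Rightarrow> real" and b :: "nat \<Rightarrow> real"
  assumes linear_slot: "\<lbrakk>\<And>j. v j \<in> L2_space T; f \<in> L2_space T; g \<in> L2_space T; i < n\<rbrakk> \<Longrightarrow>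
        B n (v(i := (\<lambda>t. x * f t + y * g t))) = x * B n (v(i := f)) + y * B n (v(i := g))"
    and local: "(\<And>j. j < n \<Longrightarrow> v j = w j) \<Longrightarrow> B n v = B n w"
    and bound: "(\<And>j. v j \<in> L2_space T) \<Longrightarrow> \<bar>B n v\<bar> \<le> b n * (\<Prod>j<n. L2_norm T (v j))"
    and nonneg: "0 \<le> b n"
    and entire: "summable (\<lambda>n. b n * r ^ n)"

locale symmetric_entire_forms = entire_forms +
  assumes swap: "\<lbrakk>i < n; j < n\<rbrakk> \<Longrightarrow> B n (v(i := v j, j := v i)) = B n v"
begin

text \<open>
  The list is stored in reverse, so that prepending an increment to it does not move the other entries.
  Slots filled with \<open>g = f + h\<close> are converted to \<open>f\<close> one at a time.
\<close>

definition slots :: "(real \<Rightarrow> real) \<Rightarrow> (real \<Rightarrow> real) \<Rightarrow> (real \<Rightarrow> real) \<Rightarrow> (real \<Rightarrow> real) list \<Rightarrow> nat \<Rightarrow> nat \<Rightarrow> nat \<Rightarrow> real \<Rightarrow> real" where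
  "slots f g h vs a c i = (if i < length vs then rev vs ! i else if i < length vs + c then h
     else if i < length vs + c + a then g else f)"

lemma slots_in_L2:
  assumes "set vs \<subseteq> L2_space T" "f \<in> L2_space T" "g \<in> L2_space T" "h \<in> L2_space T"
  shows "slots f g h vs a c i \<in> L2_space T"
proof -
  have "rev vs ! i \<in> L2_space T" if "i < length vs"
    using that assms(1) nth_mem[of i "rev vs"] by auto
  then show ?thesis using assms by (auto simp: slots_def)
qed

text \<open>Linearity splits the last slot holding \<open>g = f + h\<close>. The part with
  \<open>f\<close> already has the wanted shape; in the part with \<open>h\<close>, a swap brings
  \<open>h\<close> to the end of the block of \<open>h\<close> slots.\<close>

lemma slots_step:
  assumes vs: "set vs \<subseteq> L2_space T" and f: "f \<in> L2_space T" and h: "h \<in> L2_space T"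
    and n: "length vs + c + a < n"
  defines "g \<equiv> (\<lambda>t. f t + h t)"
  shows "B n (slots f g h vs (Suc a) c) = B n (slots f g h vs a c) + B n (slots f g h vs a (Suc c))"
proof -
  define w where "w = slots f g h vs a c"
  let ?q = "length vs + c + a" and ?p = "length vs + c"
  have g: "g \<in> L2_space T" unfolding g_def by (rule L2_space_add[OF f h])
  have w: "w j \<in> L2_space T" for j unfolding w_def by (rule slots_in_L2[OF vs f g h])
  have "slots f g h vs (Suc a) c = w(?q := (\<lambda>t. 1 * f t + 1 * h t))"
    by (auto simp: w_def slots_def g_def fun_eq_iff)
  then have 1: "B n (slots f g h vs (Suc a) c) = B n (w(?q := f)) + B n (w(?q := h))"
    using linear_slot[of w f h ?q n 1 1] w f h n by simp
  have "w(?q := f) = w" by (auto simp: w_def slots_def fun_eq_iff)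
  moreover have "(w(?q := h))(?p := (w(?q := h)) ?q, ?q := (w(?q := h)) ?p) = slots f g h vs a (Suc c)"
    by (auto simp: w_def slots_def fun_eq_iff)
  then have "B n (w(?q := h)) = B n (slots f g h vs a (Suc c))"
    using swap[of ?p n ?q "w(?q := h)"] n by simp
  ultimately show ?thesis using 1 by (simp add: w_def)
qed

lemma slots_bound:
  assumes vs: "set vs \<subseteq> L2_space T" and fgh: "f \<in> L2_space T" "g \<in> L2_space T" "h \<in> L2_space T"
    and R: "L2_norm T f \<le> R" "L2_norm T g \<le> R"
  shows "\<bar>B (length vs + c + m) (slots f g h vs a c)\<bar> \<le>
    b (length vs + c + m) * ((\<Prod>v\<leftarrow>vs. L2_norm T v) * L2_norm T h ^ c * R ^ m)"
proof -
  let ?s = "slots f g h vs a c"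
  have 1: "(\<Prod>j<length vs. L2_norm T (?s j)) = (\<Prod>v\<leftarrow>vs. L2_norm T v)"
    unfolding prod_list_map_rev_nth[symmetric] by (intro prod.cong) (auto simp: slots_def)
  have 2: "(\<Prod>j<c. L2_norm T (?s (length vs + j))) = L2_norm T h ^ c"
    by (simp add: slots_def)
  have "(\<Prod>j<m. L2_norm T (?s (length vs + c + j))) \<le> (\<Prod>j<m. R)"
    by (intro prod_mono) (use R in \<open>auto simp: slots_def L2_norm_nonneg\<close>)
  then have 3: "(\<Prod>j<m. L2_norm T (?s (length vs + c + j))) \<le> R ^ m" by simp
  have pl: "0 \<le> (\<Prod>v\<leftarrow>vs. L2_norm T v)" by (intro prod_list_nonneg) (auto simp: L2_norm_nonneg)
  have "(\<Prod>j<length vs + c + m. L2_norm T (?s j)) \<le> (\<Prod>v\<leftarrow>vs. L2_norm T v) * L2_norm T h ^ c * R ^ m"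
    unfolding prod_lessThan_add 1 2 using 3 pl by (intro mult_left_mono) (auto simp: L2_norm_nonneg)
  then have "b (length vs + c + m) * (\<Prod>j<length vs + c + m. L2_norm T (?s j)) \<le>
     b (length vs + c + m) * ((\<Prod>v\<leftarrow>vs. L2_norm T v) * L2_norm T h ^ c * R ^ m)"
    by (intro mult_left_mono nonneg)
  then show ?thesis
    using bound[of ?s "length vs + c + m"] slots_in_L2[OF vs fgh] by force
qed

text \<open>The second order Taylor remainder of one homogeneous term. Telescoping over
  \<open>slots_step\<close> twice leaves only forms with two increments, each bounded by the same
  \<open>X\<close>; counting them crudely gives the factor \<open>m ^ 2\<close>.\<close>

lemma slots_remainder:
  fixes m :: nat and S :: "nat \<Rightarrow> nat \<Rightarrow> real"
  assumes vs: "set vs \<subseteq> L2_space T" and f: "f \<in> L2_space T" and h: "h \<in> L2_space T"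
    and R: "L2_norm T f + L2_norm T h \<le> R" "1 \<le> R"
  defines "g \<equiv> (\<lambda>t. f t + h t)"
  defines "S \<equiv> (\<lambda>(a::nat) (c::nat). B (length vs + m) (slots f g h vs a c))"
  shows "\<bar>S m 0 - S 0 0 - m * S 0 1\<bar> \<le>
    b (length vs + m) * real m ^ 2 * R ^ m * (\<Prod>v\<leftarrow>vs. L2_norm T v) * (L2_norm T h)\<^sup>2"
proof -
  have g: "g \<in> L2_space T" unfolding g_def by (rule L2_space_add[OF f h])
  have fR: "L2_norm T f \<le> R" "L2_norm T g \<le> R"
    using R L2_norm_triangle[OF f h] L2_norm_nonneg[of T h] by (auto simp: g_def)
  \<comment> \<open>Since \<open>R\<close> is at least 1, the sharp power \<open>R ^ (m - 2)\<close>
    can be enlarged to \<open>R ^ m\<close>, which removes the case distinction for small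
    \<open>m\<close>.\<close>
  define X where "X = b (length vs + m) * R ^ m * (\<Prod>v\<leftarrow>vs. L2_norm T v) * (L2_norm T h)\<^sup>2"
  have pl: "0 \<le> (\<Prod>v\<leftarrow>vs. L2_norm T v)" by (intro prod_list_nonneg) (auto simp: L2_norm_nonneg)
  have X: "X \<ge> 0" unfolding X_def using R by (intro mult_nonneg_nonneg nonneg pl) auto
  have step: "S (Suc a) c = S a c + S a (Suc c)" if "c + a < m" for a c
    unfolding S_def g_def by (rule slots_step[OF vs f h]) (use that in auto)
  have S2: "\<bar>S a 2\<bar> \<le> X" if "a + 2 \<le> m" for a
  proof -
    have m: "length vs + 2 + (m - 2) = length vs + m" using that by auto
    have "\<bar>S a 2\<bar> \<le> b (length vs + m) * ((\<Prod>v\<leftarrow>vs. L2_norm T v) * (L2_norm T h)\<^sup>2 * R ^ (m - 2))"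
      using slots_bound[OF vs f g h fR, of 2 "m - 2" a] unfolding m S_def .
    also have "\<dots> \<le> b (length vs + m) * ((\<Prod>v\<leftarrow>vs. L2_norm T v) * (L2_norm T h)\<^sup>2 * R ^ m)"
      using R pl by (intro mult_left_mono nonneg mult_nonneg_nonneg power_increasing) auto
    finally show ?thesis by (simp add: X_def mult_ac)
  qed
  have S1: "\<bar>S a 1 - S 0 1\<bar> \<le> a * X" if "a + 1 \<le> m" for a
    using that
  proof (induction a)
    case (Suc a)
    then have "\<bar>S a 1 - S 0 1\<bar> \<le> a * X" "S (Suc a) 1 = S a 1 + S a 2" "\<bar>S a 2\<bar> \<le> X"
      using step[of 1 a] S2[of a] by (auto simp: numeral_2_eq_2)
    then show ?case by (simp add: algebra_simps)
  qed simp
  have S0: "\<bar>S a 0 - S 0 0 - a * S 0 1\<bar> \<le> a ^ 2 * X" if "a \<le> m" for a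
    using that
  proof (induction a)
    case (Suc a)
    then have *: "\<bar>S a 0 - S 0 0 - a * S 0 1\<bar> \<le> a ^ 2 * X" "S (Suc a) 0 = S a 0 + S a 1" "\<bar>S a 1 - S 0 1\<bar> \<le> a * X"
      using step[of 0 a] S1[of a] by auto
    have "S (Suc a) 0 - S 0 0 - Suc a * S 0 1 = (S a 0 - S 0 0 - a * S 0 1) + (S a 1 - S 0 1)"
      using *(2) by (simp add: algebra_simps)
    then have "\<bar>S (Suc a) 0 - S 0 0 - Suc a * S 0 1\<bar> \<le> a ^ 2 * X + a * X"
      using *(1,3) by linarith
    also have "\<dots> \<le> (Suc a) ^ 2 * X"
      using X by (simp add: power2_eq_square algebra_simps)
    finally show ?case by simp
  qed simp
  show ?thesis using S0[of m] by (simp add: X_def mult_ac)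
qed

text \<open>The falling factorial that arises when a power of degree \<open>m + k\<close> is
  differentiated \<open>k\<close> times.\<close>

definition weight :: "nat \<Rightarrow> nat \<Rightarrow> real" where
  "weight k m = fact (m + k) / fact m"

lemma weight_nonneg: "0 \<le> weight k m"
  by (simp add: weight_def)

text \<open>The weight is at most \<open>fact k * 2 ^ (k + m)\<close> and \<open>m ^ 2\<close> is at
  most \<open>4 ^ m\<close>, so the extra factors only enlarge the radius from \<open>R\<close> to
  \<open>8 * R\<close>, at which the series still converges.\<close>

lemma summable_weight:
  assumes R: "1 \<le> R"
  shows "summable (\<lambda>m. weight k m * (b (k + m) * real m ^ 2 * R ^ m))"
    and "summable (\<lambda>m. weight k m * (b (k + m) * R ^ m))"
proof -
  have "summable (\<lambda>n. b n * (8 * R) ^ n)" by (rule entire)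
  then have "summable (\<lambda>m. b (k + m) * (8 * R) ^ (k + m))"
    by (subst (asm) summable_iff_shift[of _ k, symmetric]) (simp add: add.commute)
  then have dom: "summable (\<lambda>m. fact k * (b (k + m) * (8 * R) ^ (k + m)))" by (rule summable_mult)
  have w: "weight k m \<le> fact k * 2 ^ (k + m)" for m
  proof -
    have "weight k m = fact k * real ((k + m) choose k)"
      by (simp add: weight_def binomial_fact add.commute)
    also have "\<dots> \<le> fact k * real (2 ^ (k + m))"
      by (intro mult_left_mono of_nat_mono binomial_le_pow2) auto
    finally show ?thesis by simp
  qed
  have key: "weight k m * (b (k + m) * x * R ^ m) \<le> fact k * (b (k + m) * (8 * R) ^ (k + m))"
    if "0 \<le> x" "x \<le> 4 ^ m" for x m
  proof -
    have "weight k m * (b (k + m) * x * R ^ m) \<le> (fact k * 2 ^ (k + m)) * (b (k + m) * 4 ^ (k + m) * R ^ (k + m))"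
    proof (intro mult_mono mult_nonneg_nonneg w nonneg order_refl)
      have "(4::real) ^ m \<le> 4 ^ (k + m)" by (intro power_increasing) auto
      then show "x \<le> 4 ^ (k + m)" using that by linarith
    qed (use R that in \<open>auto intro: power_increasing\<close>)
    also have "\<dots> = fact k * (b (k + m) * ((2 * 4 * R) ^ (k + m)))"
      by (simp only: power_mult_distrib mult_ac)
    finally show ?thesis by simp
  qed
  have sq: "real m ^ 2 \<le> 4 ^ m" for m
  proof -
    have "real m \<le> 2 ^ m" using of_nat_less_two_power[of m, where 'a = real] by simp
    then have "real m ^ 2 \<le> (2 ^ m) ^ 2" by (intro power_mono) auto
    also have "\<dots> = 4 ^ m" by (simp add: power_mult[symmetric] mult.commute[of m] power_mult)
    finally show ?thesis .
  qed
  show "summable (\<lambda>m. weight k m * (b (k + m) * real m ^ 2 * R ^ m))"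
    by (rule summable_comparison_test'[OF dom, of 0])
       (use key sq R in \<open>auto simp: abs_mult weight_nonneg nonneg\<close>)
  have "(1::real) \<le> 4 ^ m" for m by simp
  from key[OF _ this]
  show "summable (\<lambda>m. weight k m * (b (k + m) * R ^ m))"
    by (intro summable_comparison_test'[OF dom, of 0])
       (use R in \<open>auto simp: abs_mult weight_nonneg nonneg\<close>)
qed

text \<open>The power series differentiated \<open>k\<close> times term by term, with the increments
  in the first \<open>k\<close> slots and \<open>f\<close> in the other \<open>m\<close>. Both
  counts in \<open>slots\<close> are 0, so its second and third arguments are dummies.\<close>

definition diff_form :: "nat \<Rightarrow> (real \<Rightarrow> real) \<Rightarrow> (real \<Rightarrow> real) list \<Rightarrow> real" where
  "diff_form k f vs = (\<Sum>m. weight k m * B (k + m) (slots f f f vs 0 0))"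

lemma summable_diff_form:
  assumes vs: "set vs \<subseteq> L2_space T" and f: "f \<in> L2_space T"
  shows "summable (\<lambda>m. weight (length vs) m * B (length vs + m) (slots f f f vs 0 0))"
    and "\<bar>diff_form (length vs) f vs\<bar> \<le>
      (\<Sum>m. weight (length vs) m * (b (length vs + m) * (L2_norm T f + 1) ^ m)) * (\<Prod>v\<leftarrow>vs. L2_norm T v)"
proof -
  let ?k = "length vs" and ?R = "L2_norm T f + 1" and ?p = "\<Prod>v\<leftarrow>vs. L2_norm T v"
  have R: "1 \<le> ?R" by (simp add: L2_norm_nonneg)
  have sm: "summable (\<lambda>m. weight ?k m * (b (?k + m) * ?R ^ m) * ?p)"
    by (intro summable_mult2 summable_weight R)
  have le: "norm (weight ?k m * B (?k + m) (slots f f f vs 0 0)) \<le> weight ?k m * (b (?k + m) * ?R ^ m) * ?p" for m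
    using mult_left_mono[OF slots_bound[OF vs f f f, of ?R 0 m 0] weight_nonneg[of ?k m]]
    by (simp add: abs_mult weight_nonneg mult_ac)
  show "summable (\<lambda>m. weight ?k m * B (?k + m) (slots f f f vs 0 0))"
    by (rule summable_comparison_test'[OF sm, of 0]) (use le in auto)
  have "norm (diff_form ?k f vs) \<le> (\<Sum>m. weight ?k m * (b (?k + m) * ?R ^ m) * ?p)"
    unfolding diff_form_def by (rule norm_suminf_le[OF le sm])
  also have "\<dots> = (\<Sum>m. weight ?k m * (b (?k + m) * ?R ^ m)) * ?p"
    by (rule suminf_mult2[symmetric]) (rule summable_weight[OF R])
  finally show "\<bar>diff_form ?k f vs\<bar> \<le> (\<Sum>m. weight ?k m * (b (?k + m) * ?R ^ m)) * ?p" by simp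
qed


lemma diff_form_multilinear:
  assumes f: "f \<in> L2_space T"
  shows "bounded_multilinear_form T k (diff_form k f)"
  unfolding bounded_multilinear_form_def
proof (intro conjI allI impI)
  fix us ws :: "(real \<Rightarrow> real) list" and x y :: "real \<Rightarrow> real" and p q :: real
  assume *: "length us + 1 + length ws = k \<and> set us \<subseteq> L2_space T \<and> set ws \<subseteq> L2_space T \<and> x \<in> L2_space T \<and> y \<in> L2_space T"
  define v where "v = slots f f f (us @ f # ws) 0 0"
  \<comment> \<open>By the reversed storage the slot of \<open>z\<close> depends only on the entries
    after it.\<close>
  have eq: "slots f f f (us @ z # ws) 0 0 = v(length ws := z)" for z
    by (auto simp: v_def slots_def fun_eq_iff nth_append nth_Cons split: nat.splits)
  have v: "v j \<in> L2_space T" for j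
    unfolding v_def by (rule slots_in_L2) (use * f in auto)
  have sm: "summable (\<lambda>m. weight k m * B (k + m) (v(length ws := z)))" if "z \<in> L2_space T" for z
  proof -
    have "k = length (us @ z # ws)" "set (us @ z # ws) \<subseteq> L2_space T" using * that by auto
    then show ?thesis using summable_diff_form(1)[OF _ f, of "us @ z # ws"] by (simp only: eq)
  qed
  have "weight k m * B (k + m) (v(length ws := (\<lambda>t. p * x t + q * y t))) =
      p * (weight k m * B (k + m) (v(length ws := x))) + q * (weight k m * B (k + m) (v(length ws := y)))" for m
    using linear_slot[of v x y "length ws" "k + m" p q] v * by (simp add: algebra_simps)
  then show "diff_form k f (us @ (\<lambda>t. p * x t + q * y t) # ws) = p * diff_form k f (us @ x # ws) + q * diff_form k f (us @ y # ws)"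
    unfolding diff_form_def eq using sm *
    by (simp add: suminf_add[symmetric] suminf_mult[symmetric] summable_mult)
next
  show "\<exists>C. \<forall>vs. length vs = k \<and> set vs \<subseteq> L2_space T \<longrightarrow> \<bar>diff_form k f vs\<bar> \<le> C * (\<Prod>v\<leftarrow>vs. L2_norm T v)"
  proof (intro exI allI impI)
    fix vs assume "length vs = k \<and> set vs \<subseteq> L2_space T"
    then show "\<bar>diff_form k f vs\<bar> \<le> (\<Sum>m. weight k m * (b (k + m) * (L2_norm T f + 1) ^ m)) * (\<Prod>v\<leftarrow>vs. L2_norm T v)"
      using summable_diff_form(2)[OF _ f, of vs] by auto
  qed
qed

text \<open>The remainders of the homogeneous terms are summed. The \<open>m\<close>-th term of the
  next differential belongs to the \<open>(m + 1)\<close>-th term of the present series, because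
  \<open>weight (Suc k) m = weight k (Suc m) * Suc m\<close>.\<close>

lemma diff_form_remainder:
  assumes vs: "set vs \<subseteq> L2_space T" and f: "f \<in> L2_space T" and h: "h \<in> L2_space T"
    and R: "L2_norm T f + L2_norm T h \<le> R" "1 \<le> R"
  shows "\<bar>diff_form (length vs) (\<lambda>t. f t + h t) vs - diff_form (length vs) f vs - diff_form (Suc (length vs)) f (h # vs)\<bar>
    \<le> (\<Sum>m. weight (length vs) m * (b (length vs + m) * real m ^ 2 * R ^ m)) * ((\<Prod>v\<leftarrow>vs. L2_norm T v) * (L2_norm T h)\<^sup>2)"
proof -
  let ?k = "length vs"
  define g where "g = (\<lambda>t. f t + h t)"
  define S where "S m a c = B (?k + m) (slots f g h vs a c)" for m a c
  let ?c = "(\<Prod>v\<leftarrow>vs. L2_norm T v) * (L2_norm T h)\<^sup>2"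
  have g: "g \<in> L2_space T" unfolding g_def by (rule L2_space_add[OF f h])
  have "B (?k + m) (slots g g g vs 0 0) = S m m 0" for m
    unfolding S_def by (rule local) (auto simp: slots_def)
  then have 1: "(\<lambda>m. weight ?k m * S m m 0) sums diff_form ?k g vs"
    using summable_sums[OF summable_diff_form(1)[OF vs g]] by (simp add: diff_form_def)
  have "slots f f f vs 0 0 = slots f g h vs 0 0" by (auto simp: slots_def fun_eq_iff)
  then have 2: "(\<lambda>m. weight ?k m * S m 0 0) sums diff_form ?k f vs"
    using summable_sums[OF summable_diff_form(1)[OF vs f]] by (simp add: diff_form_def S_def)
  \<comment> \<open>Prepending \<open>h\<close> to the list puts it in the first slot behind those
    of \<open>vs\<close>, just where a block of one increment begins.\<close>
  have eq: "slots f f f (h # vs) 0 0 = slots f g h vs 0 1"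
    by (auto simp: slots_def fun_eq_iff nth_append less_Suc_eq)
  have "(\<lambda>m. weight (Suc ?k) m * S (Suc m) 0 1) sums diff_form (Suc ?k) f (h # vs)"
    using summable_sums[OF summable_diff_form(1)[of "h # vs" f]] vs h f by (simp add: diff_form_def S_def eq)
  moreover have "weight (Suc ?k) m = weight ?k (Suc m) * Suc m" for m
    unfolding weight_def fact_Suc[of m] by (simp del: fact_Suc of_nat_Suc)
  ultimately have "(\<lambda>m. weight ?k (Suc m) * (Suc m * S (Suc m) 0 1)) sums diff_form (Suc ?k) f (h # vs)"
    by (simp add: mult.assoc)
  \<comment> \<open>The index shift is free because the term for \<open>m = 0\<close> carries the
    factor 0.\<close>
  then have 3: "(\<lambda>m. weight ?k m * (m * S m 0 1)) sums diff_form (Suc ?k) f (h # vs)"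
    by (subst (asm) sums_Suc_iff) simp
  have D: "diff_form ?k g vs - diff_form ?k f vs - diff_form (Suc ?k) f (h # vs) =
      (\<Sum>m. weight ?k m * (S m m 0 - S m 0 0 - m * S m 0 1))"
    using sums_unique[OF sums_diff[OF sums_diff[OF 1 2] 3]] by (simp add: right_diff_distrib)
  have "norm (\<Sum>m. weight ?k m * (S m m 0 - S m 0 0 - m * S m 0 1)) \<le>
     (\<Sum>m. weight ?k m * (b (?k + m) * real m ^ 2 * R ^ m) * ?c)"
  proof (rule norm_suminf_le)
    show "summable (\<lambda>m. weight ?k m * (b (?k + m) * real m ^ 2 * R ^ m) * ?c)"
      by (intro summable_mult2 summable_weight R)
    fix m
    show "norm (weight ?k m * (S m m 0 - S m 0 0 - m * S m 0 1)) \<le> weight ?k m * (b (?k + m) * real m ^ 2 * R ^ m) * ?c"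
      using mult_left_mono[OF slots_remainder[OF vs f h R, of m] weight_nonneg[of ?k m]]
      by (simp add: abs_mult weight_nonneg S_def g_def mult_ac)
  qed
  also have "\<dots> = (\<Sum>m. weight ?k m * (b (?k + m) * real m ^ 2 * R ^ m)) * ?c"
    by (rule suminf_mult2[symmetric]) (rule summable_weight[OF R(2)])
  finally show ?thesis unfolding D[symmetric] g_def by simp
qed

lemma diff_form_has_frechet_diff:
  assumes f: "f \<in> L2_space T"
  shows "has_frechet_diff T k (diff_form k) f (diff_form (Suc k) f)"
  unfolding has_frechet_diff_def
proof (intro conjI allI impI)
  show "bounded_multilinear_form T (Suc k) (diff_form (Suc k) f)" by (rule diff_form_multilinear[OF f])
  fix \<epsilon> :: real assume "\<epsilon> > 0"
  let ?R = "L2_norm T f + 1"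
  define C where "C = (\<Sum>m. weight k m * (b (k + m) * real m ^ 2 * ?R ^ m))"
  have R: "1 \<le> ?R" by (simp add: L2_norm_nonneg)
  have C: "C \<ge> 0" unfolding C_def
    by (intro suminf_nonneg summable_weight R mult_nonneg_nonneg weight_nonneg nonneg) (use R in auto)
  show "\<forall>\<^sub>F h in L2_nhds0 T. \<forall>vs. length vs = k \<and> set vs \<subseteq> L2_space T \<longrightarrow>
        \<bar>diff_form k (\<lambda>t. f t + h t) vs - diff_form k f vs - diff_form (Suc k) f (h # vs)\<bar>
          \<le> \<epsilon> * L2_norm T h * (\<Prod>v\<leftarrow>vs. L2_norm T v)"
    unfolding eventually_L2_nhds0
  \<comment> \<open>The bound 1 keeps the norms below the fixed radius \<open>?R\<close> that
    defines \<open>C\<close>; the other bound turns the quadratic remainder into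
    \<open>\<epsilon>\<close> times the norm.\<close>
  proof (intro exI[of _ "min 1 (\<epsilon> / (C + 1))"] conjI ballI impI allI)
    show "min 1 (\<epsilon> / (C + 1)) > 0" using \<open>\<epsilon> > 0\<close> C by simp
    fix h vs assume h: "h \<in> L2_space T" "L2_norm T h < min 1 (\<epsilon> / (C + 1))" and vs: "length vs = k \<and> set vs \<subseteq> L2_space T"
    let ?H = "L2_norm T h" and ?p = "\<Prod>v\<leftarrow>vs. L2_norm T v"
    have H: "0 \<le> ?H" "L2_norm T f + ?H \<le> ?R" using h by (auto simp: L2_norm_nonneg)
    have pl: "0 \<le> ?p" by (intro prod_list_nonneg) (auto simp: L2_norm_nonneg)
    have "?H * (C + 1) < \<epsilon>" using h C by (simp add: pos_less_divide_eq)
    then have CH: "C * ?H \<le> \<epsilon>" using H by (simp add: algebra_simps)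
    have "\<bar>diff_form k (\<lambda>t. f t + h t) vs - diff_form k f vs - diff_form (Suc k) f (h # vs)\<bar> \<le> C * (?p * ?H\<^sup>2)"
      using diff_form_remainder[OF _ f h(1) H(2) R, of vs] vs by (auto simp: C_def)
    also have "\<dots> = (C * ?H) * (?H * ?p)" by (simp add: power2_eq_square)
    also have "\<dots> \<le> \<epsilon> * (?H * ?p)" using CH H(1) pl by (intro mult_right_mono mult_nonneg_nonneg)
    finally show "\<bar>diff_form k (\<lambda>t. f t + h t) vs - diff_form k f vs - diff_form (Suc k) f (h # vs)\<bar> \<le> \<epsilon> * ?H * ?p"
      by (simp add: mult_ac)
  qed
qed

text \<open>By induction the chosen differential of order \<open>k\<close> agrees with the explicit
  one at every control, so the explicit form of the next order is a valid choice; uniqueness then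
  forces the value of the actual choice.\<close>

lemma frechet_diff_eq_diff_form:
  assumes J: "\<And>f. f \<in> L2_space T \<Longrightarrow> J f = (\<Sum>n. B n (\<lambda>_. f))"
    and f: "f \<in> L2_space T" and vs: "length vs = k" "set vs \<subseteq> L2_space T"
  shows "frechet_diff T J k f vs = diff_form k f vs"
  using f vs
proof (induction k arbitrary: f vs)
  case 0
  have "B n (slots f f f [] 0 0) = B n (\<lambda>_. f)" for n by (rule local) (simp add: slots_def)
  then show ?case using 0 J by (simp add: diff_form_def weight_def)
next
  case (Suc k)
  have D: "has_frechet_diff T k (frechet_diff T J k) f (diff_form (Suc k) f)"
    by (rule has_frechet_diff_cong[OF _ Suc.prems(1) diff_form_has_frechet_diff[OF Suc.prems(1)]])
       (use Suc.IH in auto)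
  obtain h ws where hws: "vs = h # ws" using Suc.prems by (cases vs) auto
  have "has_frechet_diff T k (frechet_diff T J k) f (frechet_diff T J (Suc k) f)"
    unfolding frechet_diff.simps by (rule someI[of _ "diff_form (Suc k) f"]) (rule D)
  from has_frechet_diff_unique[OF this D, of h ws] Suc.prems hws show ?case by auto
qed

lemma frechet_differentiable_all:
  assumes J: "\<And>f. f \<in> L2_space T \<Longrightarrow> J f = (\<Sum>n. B n (\<lambda>_. f))"
    and f: "f \<in> L2_space T"
  shows "frechet_differentiable T J k f"
  using f
proof (induction k arbitrary: f)
  case (Suc k)
  have "has_frechet_diff T k (frechet_diff T J k) f (diff_form (Suc k) f)"
    by (rule has_frechet_diff_cong[OF _ Suc.prems diff_form_has_frechet_diff[OF Suc.prems]])
       (use frechet_diff_eq_diff_form[OF J] in auto)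
  moreover have "\<forall>\<^sub>F h in L2_nhds0 T. frechet_differentiable T J k (\<lambda>t. f t + h t)"
    unfolding eventually_L2_nhds0 using Suc.IH L2_space_add[OF Suc.prems] by (intro exI[of _ 1]) auto
  ultimately show ?case by auto
qed simp

text \<open>At the zero control every summand with \<open>m > 0\<close> has a zero argument, so only
  the form of order \<open>k\<close> itself survives.\<close>

lemma diff_diag_zero:
  assumes J: "\<And>f. f \<in> L2_space T \<Longrightarrow> J f = (\<Sum>n. B n (\<lambda>_. f))"
    and h: "h \<in> L2_space T"
  shows "diff_diag T J k (\<lambda>t. 0) h = fact k * B k (\<lambda>_. h)"
proof -
  let ?z = "\<lambda>t::real. 0::real"
  let ?s = "slots ?z ?z ?z (replicate k h) 0 0"
  have z: "?z \<in> L2_space T" by (rule L2_space_zero)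
  have zero: "B (k + m) ?s = 0" if "m > 0" for m
  proof -
    have "?s j \<in> L2_space T" for j by (rule slots_in_L2) (use h z in auto)
    \<comment> \<open>Zero is written as a linear combination with coefficients 0, so that linearity
      in one slot yields the value 0.\<close>
    then have "B (k + m) (?s(k := (\<lambda>t. 0 * ?z t + 0 * ?z t))) = 0"
      using that z by (subst linear_slot) auto
    moreover have "?s(k := (\<lambda>t. 0 * ?z t + 0 * ?z t)) = ?s" by (auto simp: slots_def fun_eq_iff)
    ultimately show ?thesis by simp
  qed
  have "diff_diag T J k ?z h = diff_form k ?z (replicate k h)"
    unfolding diff_diag_def by (rule frechet_diff_eq_diff_form[OF J z]) (use h in auto)
  also have "\<dots> = (\<Sum>m\<in>{0}. weight k m * B (k + m) ?s)"
    unfolding diff_form_def by (rule suminf_finite) (use zero in auto)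
  also have "\<dots> = fact k * B k ?s" by (simp add: weight_def)
  also have "B k ?s = B k (\<lambda>_. h)"
    by (rule local) (auto simp: slots_def)
  finally show ?thesis .
qed

text \<open>The error is the tail of the series beyond order \<open>n\<close>. For norms up to 1 it
  is at most a constant times the power \<open>Suc n\<close>, the constant being finite by
  convergence of the majorant at radius 1.\<close>

lemma taylor_expansion_zero:
  assumes J: "\<And>f. f \<in> L2_space T \<Longrightarrow> J f = (\<Sum>n. B n (\<lambda>_. f))"
    and K: "K \<subseteq> {1..n}" and van: "\<And>k h. k \<in> {1..n} - K \<Longrightarrow> h \<in> L2_space T \<Longrightarrow> B k (\<lambda>_. h) = 0"
  shows "taylor_expansion T J (\<lambda>t. 0) K n"
  unfolding taylor_expansion_def
proof (intro conjI landau_o.smallI)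
  show "frechet_differentiable T J n (\<lambda>t. 0)"
    by (rule frechet_differentiable_all[OF J L2_space_zero])
  fix c :: real assume "c > 0"
  define C where "C = (\<Sum>m. b (m + Suc n))"
  have sb: "summable b" using entire[of 1] by simp
  have C: "C \<ge> 0" unfolding C_def
    by (intro suminf_nonneg nonneg) (rule summable_ignore_initial_segment[OF sb])
  have key: "\<bar>J h - J (\<lambda>t. 0) - (\<Sum>k\<in>K. diff_diag T J k (\<lambda>t. 0) h / fact k)\<bar> \<le> C * L2_norm T h ^ Suc n"
    if h: "h \<in> L2_space T" and H: "L2_norm T h \<le> 1" for h
  proof -
    let ?H = "L2_norm T h"
    have bd: "\<bar>B m (\<lambda>_. h)\<bar> \<le> b m * ?H ^ m" for m
      using bound[of "\<lambda>_. h" m] h by simp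
    have sm: "summable (\<lambda>m. B m (\<lambda>_. h))"
      by (rule summable_comparison_test'[OF entire[of ?H], of 0]) (use bd in auto)
    have J0: "J (\<lambda>t. 0) = B 0 (\<lambda>_. h)"
    proof -
      have "B m (\<lambda>_ _. 0) = 0" if "m > 0" for m
        using linear_slot[of "\<lambda>_ _. 0" "\<lambda>_. 0" "\<lambda>_. 0" 0 m 0 0] that
        by (simp add: L2_space_zero fun_upd_idem)
      then have "J (\<lambda>t. 0) = (\<Sum>m\<in>{0}. B m (\<lambda>_ _. 0))"
        unfolding J[OF L2_space_zero] by (intro suminf_finite) auto
      also have "\<dots> = B 0 (\<lambda>_. h)" using local[of 0 "\<lambda>_ _. 0" "\<lambda>_. h"] by simp
      finally show ?thesis .
    qed
    have "(\<Sum>k\<in>K. diff_diag T J k (\<lambda>t. 0) h / fact k) = (\<Sum>k\<in>K. B k (\<lambda>_. h))"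
      by (simp add: diff_diag_zero[OF J h])
    also have "\<dots> = (\<Sum>k\<in>{1..n}. B k (\<lambda>_. h))"
      by (rule sum.mono_neutral_left) (use K van h in auto)
    finally have "J h - J (\<lambda>t. 0) - (\<Sum>k\<in>K. diff_diag T J k (\<lambda>t. 0) h / fact k) =
        J h - (\<Sum>k<Suc n. B k (\<lambda>_. h))"
      by (simp add: J0 sum.lessThan_Suc_shift lessThan_Suc_atMost atMost_atLeast0 sum.shift_bounds_cl_Suc_ivl
          sum.atLeast_Suc_atMost[of 0 n] del: sum.lessThan_Suc sum.cl_ivl_Suc)
    also have "\<dots> = (\<Sum>m. B (m + Suc n) (\<lambda>_. h))"
      unfolding J[OF h] by (rule suminf_minus_initial_segment[OF sm, symmetric])
    also have "\<bar>\<dots>\<bar> \<le> (\<Sum>m. b (m + Suc n) * ?H ^ Suc n)"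
      unfolding real_norm_def[symmetric]
    proof (rule norm_suminf_le)
      show "summable (\<lambda>m. b (m + Suc n) * ?H ^ Suc n)"
        by (rule summable_mult2) (rule summable_ignore_initial_segment[OF sb])
      fix m
      have "b (m + Suc n) * ?H ^ (m + Suc n) \<le> b (m + Suc n) * ?H ^ Suc n"
        by (intro mult_left_mono nonneg power_decreasing) (use H in \<open>auto simp: L2_norm_nonneg\<close>)
      then show "norm (B (m + Suc n) (\<lambda>_. h)) \<le> b (m + Suc n) * ?H ^ Suc n"
        using bd[of "m + Suc n"] by simp
    qed
    also have "\<dots> = C * ?H ^ Suc n"
      unfolding C_def by (rule suminf_mult2[symmetric]) (rule summable_ignore_initial_segment[OF sb])
    finally show ?thesis .
  qed
  show "\<forall>\<^sub>F h in L2_nhds0 T. norm (J (\<lambda>t. 0 + h t) - J (\<lambda>t. 0) - (\<Sum>k\<in>K. diff_diag T J k (\<lambda>t. 0) h / fact k))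
      \<le> c * norm (L2_norm T h ^ n)"
    unfolding eventually_L2_nhds0
  proof (intro exI[of _ "min 1 (c / (C + 1))"] conjI ballI impI)
    show "min 1 (c / (C + 1)) > 0" using \<open>c > 0\<close> C by simp
    fix h assume h: "h \<in> L2_space T" "L2_norm T h < min 1 (c / (C + 1))"
    let ?H = "L2_norm T h"
    have "?H * (C + 1) < c" using h C by (simp add: pos_less_divide_eq)
    then have "C * ?H \<le> c" using L2_norm_nonneg[of T h] by (simp add: algebra_simps)
    then have "(C * ?H) * ?H ^ n \<le> c * ?H ^ n" by (intro mult_right_mono) (auto simp: L2_norm_nonneg)
    then show "norm (J (\<lambda>t. 0 + h t) - J (\<lambda>t. 0) - (\<Sum>k\<in>K. diff_diag T J k (\<lambda>t. 0) h / fact k))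
      \<le> c * norm (L2_norm T h ^ n)"
      using key[OF h(1)] h(2) by (simp add: L2_norm_nonneg mult_ac)
  qed
qed

end

section \<open>Symmetrization of the forms\<close>

context entire_forms
begin

text \<open>Slots of a Dyson term are bound to ordered times, so swapping arguments changes the
  form. The average over permutations keeps the diagonal and the norm bound.\<close>

definition symmetrized :: "nat \<Rightarrow> (nat \<Rightarrow> real \<Rightarrow> real) \<Rightarrow> real" where
  "symmetrized n v = (\<Sum>p | p permutes {..<n}. B n (v \<circ> p)) / fact n"

lemma card_permutes: "card {p. p permutes {..<n::nat}} = fact n"
  by (rule card_permutations) auto

lemma symmetrized_diag: "symmetrized n (\<lambda>_. h) = B n (\<lambda>_. h)"
  by (simp add: symmetrized_def o_def card_permutes)

lemma symmetric_entire_forms_symmetrized: "symmetric_entire_forms T symmetrized b"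
proof
  fix v :: "nat \<Rightarrow> real \<Rightarrow> real" and f g :: "real \<Rightarrow> real" and i n :: nat and x y :: real
  assume v: "\<And>j. v j \<in> L2_space T" and f: "f \<in> L2_space T" and g: "g \<in> L2_space T" and i: "i < n"
  have upd: "v(i := z) \<circ> p = (v \<circ> p)(inv p i := z)" if "p permutes {..<n}" for p and z :: "real \<Rightarrow> real"
    using permutes_inverses[OF that] by (auto simp: fun_eq_iff)
  have "B n (v(i := (\<lambda>t. x * f t + y * g t)) \<circ> p) = x * B n (v(i := f) \<circ> p) + y * B n (v(i := g) \<circ> p)"
    if "p permutes {..<n}" for p
    unfolding upd[OF that]
    by (rule linear_slot) (use v f g i permutes_in_image[OF permutes_inv[OF that], of i] in auto)
  then show "symmetrized n (v(i := (\<lambda>t. x * f t + y * g t))) = x * symmetrized n (v(i := f)) + y * symmetrized n (v(i := g))"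
    by (simp add: symmetrized_def sum.distrib sum_distrib_left[symmetric] add_divide_distrib)
next
  fix v w :: "nat \<Rightarrow> real \<Rightarrow> real" and n
  assume "\<And>j. j < n \<Longrightarrow> v j = w j"
  then have "B n (v \<circ> p) = B n (w \<circ> p)" if "p permutes {..<n}" for p
    by (intro local) (use permutes_in_image[OF that] in auto)
  then show "symmetrized n v = symmetrized n w" by (simp add: symmetrized_def)
next
  fix v :: "nat \<Rightarrow> real \<Rightarrow> real" and n
  assume v: "\<And>j. v j \<in> L2_space T"
  have "\<bar>B n (v \<circ> p)\<bar> \<le> b n * (\<Prod>j<n. L2_norm T (v j))" if "p permutes {..<n}" for p
  proof -
    have "(\<Prod>j<n. L2_norm T (v (p j))) = (\<Prod>j<n. L2_norm T (v j))"
      using prod.permute[OF that, of "\<lambda>j. L2_norm T (v j)"] by (simp add: o_def)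
    then show ?thesis using bound[of "v \<circ> p" n] v by simp
  qed
  then have "(\<Sum>p | p permutes {..<n}. \<bar>B n (v \<circ> p)\<bar>) \<le> (\<Sum>p | p permutes {..<n}. b n * (\<Prod>j<n. L2_norm T (v j)))"
    by (intro sum_mono) auto
  then have "\<bar>\<Sum>p | p permutes {..<n}. B n (v \<circ> p)\<bar> \<le> fact n * (b n * (\<Prod>j<n. L2_norm T (v j)))"
    using order_trans[OF sum_abs[of "\<lambda>p. B n (v \<circ> p)" "{p. p permutes {..<n}}"]] by (simp add: card_permutes)
  then show "\<bar>symmetrized n v\<bar> \<le> b n * (\<Prod>j<n. L2_norm T (v j))"
    by (simp add: symmetrized_def field_simps)
next
  fix v :: "nat \<Rightarrow> real \<Rightarrow> real" and i j n :: nat assume ij: "i < n" "j < n"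
  then have t: "Transposition.transpose i j permutes {..<n}" by (intro permutes_swap_id) auto
  have v: "v(i := v j, j := v i) = v \<circ> Transposition.transpose i j"
    by (auto simp: fun_eq_iff Transposition.transpose_def)
  show "symmetrized n (v(i := v j, j := v i)) = symmetrized n v"
    unfolding symmetrized_def v
    using setum_permutations_compose_left[OF t, of "\<lambda>p. B n (v \<circ> p)"] by (simp add: o_assoc)
qed (use nonneg entire in auto)

text \<open>Both conclusions see the forms only on the diagonal, where symmetrizing changes nothing;
  hence no symmetry has to be assumed.\<close>

theorem
  assumes J: "\<And>f. f \<in> L2_space T \<Longrightarrow> J f = (\<Sum>n. B n (\<lambda>_. f))"
  shows diff_diag_zero_control: "h \<in> L2_space T \<Longrightarrow> diff_diag T J k (\<lambda>t. 0) h = fact k * B k (\<lambda>_. h)"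
    and taylor_expansion_zero_control:
      "K \<subseteq> {1..n} \<Longrightarrow> (\<And>k h. k \<in> {1..n} - K \<Longrightarrow> h \<in> L2_space T \<Longrightarrow> B k (\<lambda>_. h) = 0) \<Longrightarrow>
        taylor_expansion T J (\<lambda>t. 0) K n"
proof -
  interpret S: symmetric_entire_forms T symmetrized b
    by (rule symmetric_entire_forms_symmetrized)
  have J': "J f = (\<Sum>n. symmetrized n (\<lambda>_. f))" if "f \<in> L2_space T" for f
    using J[OF that] by (simp add: symmetrized_diag)
  show "h \<in> L2_space T \<Longrightarrow> diff_diag T J k (\<lambda>t. 0) h = fact k * B k (\<lambda>_. h)"
    using S.diff_diag_zero[OF J'] by (simp add: symmetrized_diag)
  show "K \<subseteq> {1..n} \<Longrightarrow> (\<And>k h. k \<in> {1..n} - K \<Longrightarrow> h \<in> L2_space T \<Longrightarrow> B k (\<lambda>_. h) = 0) \<Longrightarrow>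
        taylor_expansion T J (\<lambda>t. 0) K n"
    using S.taylor_expansion_zero[OF J'] by (simp add: symmetrized_diag)
qed

end

section \<open>Dyson series\<close>

lemma bounded_bilinear_matrix_mult:
  "bounded_bilinear ((**) :: complex^'n::finite^'m::finite \<Rightarrow> complex^'p::finite^'n \<Rightarrow> complex^'p^'m)"
proof -
  have "bilinear ((**) :: complex^'n^'m \<Rightarrow> complex^'p^'n \<Rightarrow> complex^'p^'m)"
    unfolding bilinear_def
    by (auto intro!: linearI simp: vec_eq_iff matrix_matrix_mult_def sum.distrib algebra_simps scaleR_sum_right)
  then show ?thesis by (simp add: bilinear_conv_bounded_bilinear)
qed

lemma bounded_linear_dagger: "bounded_linear (dagger :: complex^'n::finite^'n \<Rightarrow> complex^'n^'n)"
  by (intro linear_conv_bounded_linear[THEN iffD1] linearI) (auto simp: dagger_def vec_eq_iff)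

lemma dagger_matrix_mult: "dagger (A ** B) = dagger B ** dagger A"
  by (simp add: dagger_def matrix_matrix_mult_def vec_eq_iff mult.commute)

lemma dagger_mat: "dagger (mat c) = mat (cnj c)"
  by (simp add: dagger_def mat_def vec_eq_iff)

lemma mat_mult_component: "(mat c ** A) $ i $ j = c * A $ i $ j" for A :: "complex^'m::finite^'n::finite"
proof -
  have "(mat c ** A) $ i $ j = (\<Sum>k\<in>UNIV. if i = k then c * A $ k $ j else 0)"
    unfolding matrix_matrix_mult_def mat_def vec_lambda_beta by (intro sum.cong) auto
  also have "\<dots> = c * A $ i $ j" by simp
  finally show ?thesis .
qed

lemma mat_commute: "A ** mat c = mat c ** A" for A :: "complex^'n::finite^'n"
proof -
  have "(A ** mat c) $ i $ j = c * A $ i $ j" for i j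
  proof -
    have "(A ** mat c) $ i $ j = (\<Sum>k\<in>UNIV. if k = j then c * A $ i $ k else 0)"
      unfolding matrix_matrix_mult_def mat_def vec_lambda_beta by (intro sum.cong) auto
    also have "\<dots> = c * A $ i $ j" by simp
    finally show ?thesis .
  qed
  then show ?thesis by (simp add: vec_eq_iff mat_mult_component)
qed

lemma mat_mult_mat: "mat c ** mat d = (mat (c * d) :: complex^'n::finite^'n)"
  by (simp add: vec_eq_iff mat_mult_component) (simp add: mat_def)

lemma L2_integrable:
  assumes f: "f \<in> L2_space T"
  shows "integrable (lebesgue_on {0..T}) f"
proof -
  have "integrable (lebesgue_on {0..T}) (\<lambda>t. f t * 1)"
    by (rule Cauchy_Schwarz_integral(1)[OF L2_spaceD[OF f]]) auto
  then show ?thesis by simp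
qed

lemma L2_integral_le_subinterval:
  assumes f: "f \<in> L2_space T" and g: "continuous_on {0..s} g" and s: "s \<in> {0..T}"
  shows "(LINT t|lebesgue_on {0..s}. \<bar>f t\<bar> * g t) \<le> L2_norm T f * sqrt (LINT t|lebesgue_on {0..s}. (g t)\<^sup>2)"
proof -
  have f2: "integrable (lebesgue_on {0..s}) (\<lambda>t. (f t)\<^sup>2)" "integrable (lebesgue_on {0..s}) f"
    by (rule integrable_subinterval[OF L2_spaceD(2)[OF f]] integrable_subinterval[OF L2_integrable[OF f]]; use s in auto)+
  have gm: "g \<in> borel_measurable (lebesgue_on {0..s})"
    by (rule continuous_imp_measurable_on_sets_lebesgue[OF g]) auto
  have g2: "integrable (lebesgue_on {0..s}) (\<lambda>t. (g t)\<^sup>2)"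
    by (intro continuous_imp_integrable_real continuous_intros g)
  have "\<bar>LINT t|lebesgue_on {0..s}. \<bar>f t\<bar> * g t\<bar> \<le>
      sqrt (LINT t|lebesgue_on {0..s}. \<bar>f t\<bar>\<^sup>2) * sqrt (LINT t|lebesgue_on {0..s}. (g t)\<^sup>2)"
    using f2 gm g2 by (intro Cauchy_Schwarz_integral) auto
  also have "\<dots> \<le> L2_norm T f * sqrt (LINT t|lebesgue_on {0..s}. (g t)\<^sup>2)"
  proof (intro mult_right_mono)
    have "(LINT t|lebesgue_on {0..s}. \<bar>f t\<bar>\<^sup>2) \<le> (LINT t|lebesgue_on {0..T}. (f t)\<^sup>2)"
      by (rule integral_mono_lebesgue_on_AE[OF L2_spaceD(2)[OF f]]) (use s in auto)
    then show "sqrt (LINT t|lebesgue_on {0..s}. \<bar>f t\<bar>\<^sup>2) \<le> L2_norm T f"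
      by (simp add: L2_norm_def)
  qed auto
  finally show ?thesis by linarith
qed

text \<open>Slot 0 belongs to the latest time; the recursion peels it off and shifts the rest.
  Giving each time its own control polarizes the Dyson term into a multilinear form.\<close>

primrec dyson :: "(real \<Rightarrow> complex^'n^'n) \<Rightarrow> nat \<Rightarrow> (nat \<Rightarrow> real \<Rightarrow> real) \<Rightarrow> real \<Rightarrow> complex^'n^'n::finite" where
  "dyson K 0 v s = mat 1"
| "dyson K (Suc n) v s = (LINT t|lebesgue_on {0..s}. v 0 t *\<^sub>R (K t ** dyson K n (\<lambda>i. v (Suc i)) t))"

locale dyson_kernel =
  fixes T :: real and K :: "real \<Rightarrow> complex^'n::finite^'n"
  assumes continuous_kernel: "continuous_on {0..T} K" and T_nonneg: "0 \<le> T"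
begin

lemma kernel_integrable:
  assumes u: "u \<in> L2_space T" and X: "continuous_on {0..T} X"
  shows "integrable (lebesgue_on {0..T}) (\<lambda>t. u t *\<^sub>R (K t ** X t))"
proof -
  have "continuous_on {0..T} (\<lambda>t. K t ** X t)"
    by (rule bounded_bilinear.continuous_on[OF bounded_bilinear_matrix_mult continuous_kernel X])
  from integrable_bounded_bilinear_continuous[OF bounded_bilinear.flip[OF bounded_bilinear_scaleR] this L2_integrable[OF u]]
  show ?thesis .
qed

lemma dyson_continuous:
  assumes "\<And>j. v j \<in> L2_space T"
  shows "continuous_on {0..T} (dyson K n v)"
  using assms
proof (induction n arbitrary: v)
  case (Suc n)
  have "integrable (lebesgue_on {0..T}) (\<lambda>t. v 0 t *\<^sub>R (K t ** dyson K n (\<lambda>i. v (Suc i)) t))"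
    by (intro kernel_integrable Suc)
  from is_primitive_continuous_on[OF is_primitive_integral[OF this, of 0]]
  show ?case by simp
qed simp

lemma dyson_integrable:
  assumes v: "\<And>j. v j \<in> L2_space T" and u: "u \<in> L2_space T" and s: "s \<in> {0..T}"
  shows "integrable (lebesgue_on {0..s}) (\<lambda>t. u t *\<^sub>R (K t ** dyson K n v t))"
  by (rule integrable_subinterval[OF kernel_integrable[OF u dyson_continuous[OF v]]]) (use s in auto)

lemma dyson_local:
  "(\<And>j. j < n \<Longrightarrow> v j = w j) \<Longrightarrow> dyson K n v s = dyson K n w s"
proof (induction n arbitrary: v w s)
  case (Suc n)
  have "dyson K n (\<lambda>i. v (Suc i)) t = dyson K n (\<lambda>i. w (Suc i)) t" for t
    by (intro Suc.IH Suc.prems) auto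
  then show ?case using Suc.prems[of 0] by simp
qed simp

lemma dyson_linear:
  assumes "\<And>j. v j \<in> L2_space T" "f \<in> L2_space T" "g \<in> L2_space T" "i < n" "s \<in> {0..T}"
  shows "dyson K n (v(i := (\<lambda>t. x * f t + y * g t))) s =
    x *\<^sub>R dyson K n (v(i := f)) s + y *\<^sub>R dyson K n (v(i := g)) s"
  using assms
proof (induction n arbitrary: v i s)
  case (Suc n)
  let ?v' = "\<lambda>j. v (Suc j)"
  have v': "\<And>j. ?v' j \<in> L2_space T" using Suc.prems by simp
  show ?case
  proof (cases i)
    case 0
    have "dyson K (Suc n) (v(i := z)) s = (LINT t|lebesgue_on {0..s}. z t *\<^sub>R (K t ** dyson K n ?v' t))" for z
      using 0 by simp
    moreover have "(\<lambda>t. (x * f t + y * g t) *\<^sub>R (K t ** dyson K n ?v' t)) =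
        (\<lambda>t. x *\<^sub>R (f t *\<^sub>R (K t ** dyson K n ?v' t)) + y *\<^sub>R (g t *\<^sub>R (K t ** dyson K n ?v' t)))"
      by (auto simp: scaleR_add_left)
    moreover have "integrable (lebesgue_on {0..s}) (\<lambda>t. z t *\<^sub>R (K t ** dyson K n ?v' t))" if "z \<in> L2_space T" for z
      by (rule dyson_integrable) (use v' that Suc.prems in auto)
    ultimately show ?thesis
      using Suc.prems(2,3) by (simp del: scaleR_scaleR)
  next
    case (Suc j)
    have upd: "(\<lambda>i'. (v(i := z)) (Suc i')) = ?v'(j := z)" for z using Suc by (auto simp: fun_eq_iff)
    have D: "dyson K (Suc n) (v(i := z)) s = (LINT t|lebesgue_on {0..s}. v 0 t *\<^sub>R (K t ** dyson K n (?v'(j := z)) t))" for z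
    proof -
      have "(v(i := z)) 0 = v 0" using Suc by simp
      then show ?thesis by (simp only: dyson.simps upd)
    qed
    have int: "integrable (lebesgue_on {0..s}) (\<lambda>t. v 0 t *\<^sub>R (K t ** dyson K n (?v'(j := z)) t))" if "z \<in> L2_space T" for z
      by (rule dyson_integrable) (use Suc.prems that in auto)
    have "(LINT t|lebesgue_on {0..s}. v 0 t *\<^sub>R (K t ** dyson K n (?v'(j := (\<lambda>t. x * f t + y * g t))) t)) =
       (LINT t|lebesgue_on {0..s}. x *\<^sub>R (v 0 t *\<^sub>R (K t ** dyson K n (?v'(j := f)) t)) + y *\<^sub>R (v 0 t *\<^sub>R (K t ** dyson K n (?v'(j := g)) t)))"
    proof (rule Bochner_Integration.integral_cong[OF refl])
      fix t assume "t \<in> space (lebesgue_on {0..s})"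
      then have t: "t \<in> {0..T}" using Suc.prems(5) by auto
      have "dyson K n (?v'(j := (\<lambda>t. x * f t + y * g t))) t = x *\<^sub>R dyson K n (?v'(j := f)) t + y *\<^sub>R dyson K n (?v'(j := g)) t"
        by (rule Suc.IH[OF v' Suc.prems(2,3) _ t]) (use Suc Suc.prems(4) in auto)
      then show "v 0 t *\<^sub>R (K t ** dyson K n (?v'(j := (\<lambda>t. x * f t + y * g t))) t) =
        x *\<^sub>R (v 0 t *\<^sub>R (K t ** dyson K n (?v'(j := f)) t)) + y *\<^sub>R (v 0 t *\<^sub>R (K t ** dyson K n (?v'(j := g)) t))"
        by (simp add: bounded_bilinear.add_right[OF bounded_bilinear_matrix_mult]
            bounded_bilinear.scaleR_right[OF bounded_bilinear_matrix_mult] scaleR_add_right mult.commute)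
    qed
    then show ?thesis unfolding D using int[OF Suc.prems(2)] int[OF Suc.prems(3)] by (simp del: scaleR_scaleR)
  qed
qed simp

text \<open>A single constant that absorbs both the supremum of the kernel norm and the constant in
  the norm estimate for matrix products.\<close>

definition kernel_bound :: real where
  "kernel_bound = (SOME C. C > 0 \<and> (\<forall>t X. t \<in> {0..T} \<longrightarrow> norm (K t ** X) \<le> C * norm (X :: complex^'n^'n)))"

lemma kernel_bound:
  shows "kernel_bound > 0"
    and norm_kernel_le: "t \<in> {0..T} \<Longrightarrow> norm (K t ** (X :: complex^'n^'n)) \<le> kernel_bound * norm X"
proof -
  obtain c where c: "c > 0" "\<And>(A :: complex^'n^'n) (B :: complex^'n^'n). norm (A ** B) \<le> norm A * norm B * c"
    using bounded_bilinear.pos_bounded[OF bounded_bilinear_matrix_mult] by blast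
  have "bounded (K ` {0..T})"
    by (rule compact_imp_bounded[OF compact_continuous_image[OF continuous_kernel compact_Icc]])
  then obtain M where M: "M > 0" "\<And>t. t \<in> {0..T} \<Longrightarrow> norm (K t) \<le> M" unfolding bounded_pos by auto
  have "norm (K t ** X) \<le> (M * c) * norm X" if "t \<in> {0..T}" for t and X :: "complex^'n^'n"
  proof -
    have "norm (K t ** X) \<le> norm (K t) * norm X * c" by (rule c)
    also have "\<dots> \<le> M * norm X * c" using M(2)[OF that] c by (intro mult_right_mono) auto
    finally show ?thesis by (simp add: mult_ac)
  qed
  then have "M * c > 0 \<and> (\<forall>t X. t \<in> {0..T} \<longrightarrow> norm (K t ** X) \<le> M * c * norm (X :: complex^'n^'n))"
    using M(1) c(1) by simp
  then have "kernel_bound > 0 \<and> (\<forall>t X. t \<in> {0..T} \<longrightarrow> norm (K t ** X) \<le> kernel_bound * norm (X :: complex^'n^'n))"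
    unfolding kernel_bound_def
    by (rule someI[of "\<lambda>C. C > 0 \<and> (\<forall>t X. t \<in> {0..T} \<longrightarrow> norm (K t ** X) \<le> C * norm (X :: complex^'n^'n))"])
  then show "kernel_bound > 0" "t \<in> {0..T} \<Longrightarrow> norm (K t ** (X :: complex^'n^'n)) \<le> kernel_bound * norm X"
    by auto
qed

text \<open>The dependence on \<open>s\<close> carries the induction: by Cauchy-Schwarz, integrating
  a control against \<open>sqrt (t ^ n / fact n)\<close> costs its norm times the root of the
  integral of \<open>t ^ n / fact n\<close>, which is the next factor of the same shape.\<close>

lemma norm_dyson_le_time:
  assumes "\<And>j. v j \<in> L2_space T" "s \<in> {0..T}"
  shows "norm (dyson K n v s) \<le> norm (mat 1 :: complex^'n^'n) * kernel_bound ^ n * (\<Prod>j<n. L2_norm T (v j)) * sqrt (s ^ n / fact n)"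
  using assms
proof (induction n arbitrary: v s)
  case (Suc n)
  let ?v' = "\<lambda>j. v (Suc j)"
  let ?N = "norm (mat 1 :: complex^'n^'n)"
  define A where "A = kernel_bound * (?N * kernel_bound ^ n * (\<Prod>j<n. L2_norm T (?v' j)))"
  have A: "A \<ge> 0" unfolding A_def using kernel_bound(1) by (intro mult_nonneg_nonneg prod_nonneg) (auto simp: L2_norm_nonneg)
  have v': "\<And>j. ?v' j \<in> L2_space T" using Suc.prems by simp
  have cont: "continuous_on {0..s} (\<lambda>t. sqrt (t ^ n / fact n))" by (intro continuous_intros) auto
  have int: "integrable (lebesgue_on {0..s}) (\<lambda>t. \<bar>v 0 t\<bar> * sqrt (t ^ n / fact n))"
  proof -
    have "integrable (lebesgue_on {0..s}) (\<lambda>t. \<bar>v 0 t\<bar>)"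
      by (intro integrable_abs integrable_subinterval[OF L2_integrable[OF Suc.prems(1)]]) (use Suc.prems in auto)
    from integrable_bounded_bilinear_continuous[OF bounded_bilinear_mult cont this] show ?thesis
      by (simp add: mult.commute)
  qed
  have "norm (dyson K (Suc n) v s) \<le> (LINT t|lebesgue_on {0..s}. norm (v 0 t *\<^sub>R (K t ** dyson K n ?v' t)))"
    unfolding dyson.simps by (rule integral_norm_bound)
  also have "\<dots> \<le> (LINT t|lebesgue_on {0..s}. A * (\<bar>v 0 t\<bar> * sqrt (t ^ n / fact n)))"
  proof (rule integral_mono)
    show "integrable (lebesgue_on {0..s}) (\<lambda>t. norm (v 0 t *\<^sub>R (K t ** dyson K n ?v' t)))"
      by (intro integrable_norm dyson_integrable v' Suc.prems)
    show "integrable (lebesgue_on {0..s}) (\<lambda>t. A * (\<bar>v 0 t\<bar> * sqrt (t ^ n / fact n)))"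
      by (intro integrable_mult_right int)
    fix t assume "t \<in> space (lebesgue_on {0..s})"
    then have t: "t \<in> {0..T}" using Suc.prems(2) by auto
    have "norm (K t ** dyson K n ?v' t) \<le> kernel_bound * norm (dyson K n ?v' t)" by (rule norm_kernel_le[OF t])
    also have "\<dots> \<le> kernel_bound * (?N * kernel_bound ^ n * (\<Prod>j<n. L2_norm T (?v' j)) * sqrt (t ^ n / fact n))"
      using Suc.IH[OF v' t] kernel_bound(1) by (intro mult_left_mono) auto
    also have "\<dots> = A * sqrt (t ^ n / fact n)" by (simp add: A_def)
    finally have "\<bar>v 0 t\<bar> * norm (K t ** dyson K n ?v' t) \<le> \<bar>v 0 t\<bar> * (A * sqrt (t ^ n / fact n))"
      by (rule mult_left_mono) simp
    then show "norm (v 0 t *\<^sub>R (K t ** dyson K n ?v' t)) \<le> A * (\<bar>v 0 t\<bar> * sqrt (t ^ n / fact n))"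
      by (simp add: mult_ac)
  qed
  also have "\<dots> = A * (LINT t|lebesgue_on {0..s}. \<bar>v 0 t\<bar> * sqrt (t ^ n / fact n))"
    by (rule Bochner_Integration.integral_mult_right) (rule int)
  also have "\<dots> \<le> A * (L2_norm T (v 0) * sqrt (LINT t|lebesgue_on {0..s}. (sqrt (t ^ n / fact n))\<^sup>2))"
    by (intro mult_left_mono A L2_integral_le_subinterval Suc.prems cont)
  also have "(LINT t|lebesgue_on {0..s}. (sqrt (t ^ n / fact n))\<^sup>2) = (LINT t|lebesgue_on {0..s}. t ^ n / fact n)"
    by (intro Bochner_Integration.integral_cong) auto
  also have "\<dots> = s ^ Suc n / fact (Suc n)"
  proof -
    have "is_primitive 0 s (\<lambda>t. t ^ Suc n / fact (Suc n)) (\<lambda>t. t ^ n / fact n)"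
    proof (rule is_primitive_C1)
      show "((\<lambda>t. t ^ Suc n / fact (Suc n)) has_vector_derivative t ^ n / fact n) (at t within {0..s})" for t
        unfolding has_real_derivative_iff_has_vector_derivative[symmetric]
        by (rule derivative_eq_intros refl | simp)+
      show "continuous_on {0..s} (\<lambda>t. t ^ n / fact n)" by (intro continuous_intros) auto
    qed
    from is_primitive_integral_eq[OF this] Suc.prems(2) show ?thesis by simp
  qed
  also have "A * (L2_norm T (v 0) * sqrt (s ^ Suc n / fact (Suc n))) =
      ?N * kernel_bound ^ Suc n * (\<Prod>j<Suc n. L2_norm T (v j)) * sqrt (s ^ Suc n / fact (Suc n))"
    by (simp add: A_def prod.lessThan_Suc_shift mult_ac del: prod.lessThan_Suc)
  finally show ?case .
qed simp

definition dyson_bound :: "nat \<Rightarrow> real" where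
  "dyson_bound n = norm (mat 1 :: complex^'n^'n) * kernel_bound ^ n * sqrt (T ^ n / fact n)"

lemma norm_dyson_le:
  assumes v: "\<And>j. v j \<in> L2_space T" and s: "s \<in> {0..T}"
  shows "norm (dyson K n v s) \<le> dyson_bound n * (\<Prod>j<n. L2_norm T (v j))"
proof -
  have "norm (dyson K n v s) \<le> norm (mat 1 :: complex^'n^'n) * kernel_bound ^ n * (\<Prod>j<n. L2_norm T (v j)) * sqrt (s ^ n / fact n)"
    by (rule norm_dyson_le_time[OF v s])
  also have "\<dots> \<le> norm (mat 1 :: complex^'n^'n) * kernel_bound ^ n * (\<Prod>j<n. L2_norm T (v j)) * sqrt (T ^ n / fact n)"
    using s kernel_bound(1) by (intro mult_left_mono real_sqrt_le_mono divide_right_mono power_mono mult_nonneg_nonneg prod_nonneg)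
      (auto simp: L2_norm_nonneg)
  finally show "norm (dyson K n v s) \<le> dyson_bound n * (\<Prod>j<n. L2_norm T (v j))"
    by (simp add: dyson_bound_def mult_ac)
qed

lemma dyson_bound_nonneg: "0 \<le> dyson_bound n"
  unfolding dyson_bound_def using kernel_bound(1) T_nonneg by (intro mult_nonneg_nonneg) auto

text \<open>The root of the factorial is still strong enough:
  \<open>(x ^ n)\<^sup>2 / fact n\<close> is one term of the series for
  \<open>exp (x\<^sup>2)\<close>, so \<open>x ^ n / sqrt (fact n)\<close> is bounded in
  \<open>n\<close>.\<close>

lemma summable_dyson_bound: "summable (\<lambda>n. dyson_bound n * r ^ n)"
proof -
  let ?N = "norm (mat 1 :: complex^'n^'n)"
  \<comment> \<open>The factor 2 leaves a geometric factor \<open>(1 / 2) ^ n\<close> once the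
    remaining quotient has been bounded.\<close>
  define x where "x = 2 * kernel_bound * \<bar>r\<bar> * sqrt T"
  have x: "x \<ge> 0" unfolding x_def using kernel_bound(1) T_nonneg by auto
  have xe: "x ^ n / sqrt (fact n) \<le> exp (x\<^sup>2 / 2)" for n
  proof -
    have "(x\<^sup>2) ^ n / fact n \<le> exp (x\<^sup>2)"
      using sum_le_suminf[OF summable_exp_generic[of "x\<^sup>2"], of "{n}"] by (simp add: exp_def divide_inverse_commute)
    then have "sqrt ((x\<^sup>2) ^ n / fact n) \<le> sqrt (exp (x\<^sup>2))" by simp
    moreover have "sqrt ((x\<^sup>2) ^ n / fact n) = x ^ n / sqrt (fact n)"
    proof -
      have "(x\<^sup>2) ^ n = (x ^ n)\<^sup>2" by (simp add: power_mult[symmetric] mult.commute)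
      then show ?thesis using x by (simp add: real_sqrt_divide)
    qed
    moreover have "sqrt (exp (x\<^sup>2)) = exp (x\<^sup>2 / 2)"
      by (rule real_sqrt_unique) (auto simp: exp_double[symmetric])
    ultimately show ?thesis by simp
  qed
  have "summable (\<lambda>n. (?N * exp (x\<^sup>2 / 2)) * (1 / 2) ^ n)"
    by (intro summable_mult summable_geometric) auto
  then show ?thesis
  proof (rule summable_comparison_test'[where N = 0])
    fix n
    have "norm (dyson_bound n * r ^ n) = ?N * (kernel_bound * \<bar>r\<bar> * sqrt T) ^ n / sqrt (fact n)"
      using kernel_bound(1) T_nonneg
      by (simp add: dyson_bound_def abs_mult power_mult_distrib real_sqrt_divide real_sqrt_power power_abs)
    also have "kernel_bound * \<bar>r\<bar> * sqrt T = x * (1 / 2)" by (simp add: x_def)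
    also have "?N * (x * (1 / 2)) ^ n / sqrt (fact n) = ?N * (x ^ n / sqrt (fact n)) * (1 / 2) ^ n"
      by (simp add: power_mult_distrib field_simps)
    also have "\<dots> \<le> (?N * exp (x\<^sup>2 / 2)) * (1 / 2) ^ n"
      using xe[of n] by (intro mult_right_mono mult_left_mono) auto
    finally show "norm (dyson_bound n * r ^ n) \<le> (?N * exp (x\<^sup>2 / 2)) * (1 / 2) ^ n" .
  qed
qed

lemma dyson_sums:
  assumes f: "f \<in> L2_space T" and t: "t \<in> {0..T}"
  shows "summable (\<lambda>n. norm (dyson K n (\<lambda>_. f) t))"
  by (rule summable_comparison_test'[OF summable_dyson_bound[of "L2_norm T f"], of 0])
     (use norm_dyson_le[of "\<lambda>_. f" t] f t in auto)

text \<open>The norm bounds allow summation under the integral; the recursion then shifts the index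
  by one, which turns the series into the integral equation for \<open>W\<close>.\<close>

theorem is_primitive_dyson_series:
  assumes f: "f \<in> L2_space T"
  defines "W \<equiv> (\<lambda>t. \<Sum>n. dyson K n (\<lambda>_. f) t)"
  shows "is_primitive 0 T W (\<lambda>t. f t *\<^sub>R (K t ** W t))" and "W 0 = mat 1"
proof -
  let ?D = "\<lambda>n. dyson K n (\<lambda>_. f)"
  let ?F = "L2_norm T f"
  let ?b = "\<lambda>n. dyson_bound n * ?F ^ n"
  have Db: "norm (?D n t) \<le> ?b n" if "t \<in> {0..T}" for n t
    using norm_dyson_le[of "\<lambda>_. f" t n] f that by simp
  have key: "integrable (lebesgue_on {0..s}) (\<lambda>t. f t *\<^sub>R (K t ** W t))"
    "W s = mat 1 + (LINT t|lebesgue_on {0..s}. f t *\<^sub>R (K t ** W t))" if s: "s \<in> {0..T}" for s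
  proof -
    let ?M = "lebesgue_on {0..s}"
    let ?g = "\<lambda>n t. f t *\<^sub>R (K t ** ?D n t)"
    have int: "integrable ?M (?g n)" for n by (rule dyson_integrable[OF f f s])
    have fi: "integrable ?M f" by (rule integrable_subinterval[OF L2_integrable[OF f]]) (use s in auto)
    have gb: "norm (?g n t) \<le> (kernel_bound * ?b n) * \<bar>f t\<bar>" if "t \<in> {0..T}" for n t
    proof -
      have "norm (K t ** ?D n t) \<le> kernel_bound * norm (?D n t)" by (rule norm_kernel_le[OF that])
      also have "\<dots> \<le> kernel_bound * ?b n" using Db[OF that] kernel_bound(1) by (intro mult_left_mono) auto
      finally have "\<bar>f t\<bar> * norm (K t ** ?D n t) \<le> \<bar>f t\<bar> * (kernel_bound * ?b n)" by (rule mult_left_mono) simp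
      then show ?thesis by (simp add: mult_ac)
    qed
    have 1: "AE t in ?M. summable (\<lambda>n. norm (?g n t))"
    proof (rule AE_I2)
      fix t assume "t \<in> space ?M"
      then have t: "t \<in> {0..T}" using s by auto
      show "summable (\<lambda>n. norm (?g n t))"
        by (rule summable_comparison_test'[OF summable_mult2[OF summable_mult[OF summable_dyson_bound]], of 0])
           (use gb[OF t] in auto)
    qed
    have 2: "summable (\<lambda>n. LINT t|?M. norm (?g n t))"
    proof (rule summable_comparison_test'[OF summable_mult2[OF summable_mult[OF summable_dyson_bound]], of 0])
      fix n
      have "(LINT t|?M. norm (?g n t)) \<le> (LINT t|?M. (kernel_bound * ?b n) * \<bar>f t\<bar>)"
        by (intro integral_mono integrable_norm int integrable_mult_right integrable_abs fi gb) (use s in auto)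
      also have "\<dots> = (kernel_bound * ?b n) * (LINT t|?M. \<bar>f t\<bar>)"
        by (intro Bochner_Integration.integral_mult_right integrable_abs fi)
      finally show "norm (LINT t|?M. norm (?g n t)) \<le> (kernel_bound * (dyson_bound n * ?F ^ n)) * (LINT t|?M. \<bar>f t\<bar>)"
        by simp
    qed
    have lim: "(\<lambda>n. ?g n t) sums (f t *\<^sub>R (K t ** W t))" if "t \<in> {0..T}" for t
    proof -
      have "(\<lambda>n. ?D n t) sums W t"
        unfolding W_def by (rule summable_sums[OF summable_norm_cancel[OF dyson_sums[OF f that]]])
      then show ?thesis
        by (intro bounded_linear.sums[OF bounded_linear_scaleR_right]
            bounded_linear.sums[OF bounded_bilinear.bounded_linear_right[OF bounded_bilinear_matrix_mult]])
    qed
    have cong: "(\<Sum>n. ?g n t) = f t *\<^sub>R (K t ** W t)" if "t \<in> space ?M" for t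
      using lim[of t] that s by (auto simp: sums_iff)
    have "integrable ?M (\<lambda>t. \<Sum>n. ?g n t)"
      by (rule integrable_suminf[OF int 1 2])
    then show "integrable ?M (\<lambda>t. f t *\<^sub>R (K t ** W t))"
      using Bochner_Integration.integrable_cong[of ?M ?M "\<lambda>t. \<Sum>n. ?g n t" "\<lambda>t. f t *\<^sub>R (K t ** W t)"] cong by blast
    have "(\<lambda>n. LINT t|?M. ?g n t) sums (LINT t|?M. (\<Sum>n. ?g n t))"
      by (rule sums_integral[OF int 1 2])
    also have "(LINT t|?M. (\<Sum>n. ?g n t)) = (LINT t|?M. f t *\<^sub>R (K t ** W t))"
      by (intro Bochner_Integration.integral_cong refl cong)
    finally have "(\<lambda>n. ?D (Suc n) s) sums (LINT t|?M. f t *\<^sub>R (K t ** W t))" by simp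
    then have "(\<lambda>n. ?D n s) sums ((LINT t|?M. f t *\<^sub>R (K t ** W t)) + ?D 0 s)"
      by (subst (asm) sums_Suc_iff)
    then show "W s = mat 1 + (LINT t|?M. f t *\<^sub>R (K t ** W t))"
      unfolding W_def by (simp add: sums_iff add.commute)
  qed
  have T: "T \<in> {0..T}" using T_nonneg by simp
  have prim: "is_primitive 0 T (\<lambda>s. mat 1 + (LINT t|lebesgue_on {0..s}. f t *\<^sub>R (K t ** W t))) (\<lambda>t. f t *\<^sub>R (K t ** W t))"
    by (rule is_primitive_integral[OF key(1)[OF T]])
  define X where "X = (LINT t|lebesgue_on {0..0}. f t *\<^sub>R (K t ** W t))"
  \<comment> \<open>Evaluating the primitive at its own left end shows that the integral over a
    single point vanishes.\<close>
  have "mat 1 + X = mat 1 + X + X"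
    unfolding X_def by (rule is_primitiveD[OF prim]) (use T_nonneg in simp)
  then have "X = 0" by simp
  then show "W 0 = mat 1" using key(2)[of 0] T_nonneg unfolding X_def[symmetric] by simp
  show "is_primitive 0 T W (\<lambda>t. f t *\<^sub>R (K t ** W t))"
    unfolding is_primitive_def
  proof (intro conjI ballI)
    show "integrable (lebesgue_on {0..T}) (\<lambda>t. f t *\<^sub>R (K t ** W t))" by (rule key(1)[OF T])
    fix t assume "t \<in> {0..T}"
    then show "W t = W 0 + (LINT t|lebesgue_on {0..t}. f t *\<^sub>R (K t ** W t))"
      unfolding \<open>W 0 = mat 1\<close> by (rule key(2))
  qed
qed

end

section \<open>Propagators\<close>

text \<open>Scalars appear as matrices \<open>mat c\<close> because the equation is written with
  \<open>mat \<i>\<close>; this moves them to the front of a product.\<close>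

lemma mat_pull: "A ** (mat c ** B) = mat c ** (A ** B)" for A B :: "complex^'n::finite^'n"
proof -
  have "A ** (mat c ** B) = (A ** mat c) ** B" by (rule matrix_mul_assoc)
  also have "\<dots> = mat c ** (A ** B)" unfolding mat_commute by (rule matrix_mul_assoc[symmetric])
  finally show ?thesis .
qed

lemma mat_ii_cancel: "mat (- \<i>) ** (mat \<i> ** A) = A" "mat \<i> ** (mat (- \<i>) ** A) = A" for A :: "complex^'n::finite^'n"
  by (simp_all add: matrix_mul_assoc mat_mult_mat)

text \<open>For Hermitian generators the two terms of the product rule cancel. Equal solutions give
  unitarity, two different ones give uniqueness.\<close>

lemma propagators_dagger_mult:
  fixes H0 V :: "complex^'n::finite^'n"
  assumes herm: "dagger H0 = H0" "dagger V = V"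
    and U1: "is_propagator T H0 V f U1" and U2: "is_propagator T H0 V f U2" and t: "t \<in> {0..T}"
  shows "dagger (U1 t) ** U2 t = mat 1"
proof -
  let ?p = "\<lambda>A B :: complex^'n^'n. dagger A ** B"
  have p: "bounded_bilinear ?p"
    by (rule bounded_bilinear.comp1[OF bounded_bilinear_matrix_mult bounded_linear_dagger])
  have "dagger (U1 t) ** U2 t = dagger (U1 0) ** U2 0"
  proof (rule absolutely_continuous_zero_derivative_const[OF _ _ t])
    show "absolutely_continuous_on_Icc 0 T (\<lambda>t. dagger (U1 t) ** U2 t)"
      by (rule absolutely_continuous_bounded_bilinear[OF p]) (use U1 U2 in \<open>auto simp: is_propagator_def\<close>)
    have "AE t in lebesgue_on {0..T}. \<exists>D. (U1 has_vector_derivative D) (at t within {0..T}) \<and>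
        mat \<i> ** D = (H0 + f t *\<^sub>R V) ** U1 t" using U1 by (simp add: is_propagator_def)
    moreover have "AE t in lebesgue_on {0..T}. \<exists>D. (U2 has_vector_derivative D) (at t within {0..T}) \<and>
        mat \<i> ** D = (H0 + f t *\<^sub>R V) ** U2 t" using U2 by (simp add: is_propagator_def)
    ultimately show "AE t in lebesgue_on {0..T}. ((\<lambda>t. dagger (U1 t) ** U2 t) has_vector_derivative 0) (at t within {0..T})"
    proof eventually_elim
      case (elim t)
      then obtain D1 D2 where D: "(U1 has_vector_derivative D1) (at t within {0..T})"
          "mat \<i> ** D1 = (H0 + f t *\<^sub>R V) ** U1 t"
          "(U2 has_vector_derivative D2) (at t within {0..T})"
          "mat \<i> ** D2 = (H0 + f t *\<^sub>R V) ** U2 t" by blast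
      define H where "H = H0 + f t *\<^sub>R V"
      have H: "dagger H = H"
        unfolding H_def using herm
        by (simp add: linear_add linear_cmul bounded_linear.linear[OF bounded_linear_dagger])
      have D1: "D1 = mat (- \<i>) ** (H ** U1 t)" and D2: "D2 = mat (- \<i>) ** (H ** U2 t)"
        using D(2,4) mat_ii_cancel(1)[of D1] mat_ii_cancel(1)[of D2] by (simp_all add: H_def)
      let ?X = "dagger (U1 t) ** (H ** U2 t)"
      have "dagger D1 ** U2 t = mat \<i> ** ?X"
        unfolding D1 dagger_matrix_mult dagger_mat H
        by (simp add: matrix_mul_assoc[symmetric] mat_pull)
      moreover have "dagger (U1 t) ** D2 = mat (- \<i>) ** ?X"
        unfolding D2 by (rule mat_pull)
      moreover have "mat (- \<i>) ** ?X + mat \<i> ** ?X = 0"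
        by (simp add: vec_eq_iff mat_mult_component)
      ultimately have "dagger (U1 t) ** D2 + dagger D1 ** U2 t = 0" by simp
      with bounded_bilinear.has_vector_derivative[OF p D(1,3)] show ?case by simp
    qed
  qed
  also have "\<dots> = mat 1" using U1 U2 by (simp add: is_propagator_def dagger_mat)
  finally show ?thesis .
qed

lemma propagator_unique:
  fixes H0 V :: "complex^'n::finite^'n"
  assumes herm: "dagger H0 = H0" "dagger V = V"
    and U1: "is_propagator T H0 V f U1" and U2: "is_propagator T H0 V f U2" and t: "t \<in> {0..T}"
  shows "U1 t = U2 t"
proof -
  have "dagger (U1 t) ** U1 t = mat 1" by (rule propagators_dagger_mult[OF herm U1 U1 t])
  then have "U1 t ** dagger (U1 t) = mat 1" by (simp add: matrix_left_right_inverse)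
  then have "U2 t = U1 t ** (dagger (U1 t) ** U2 t)" by (simp add: matrix_mul_assoc)
  also have "\<dots> = U1 t" using propagators_dagger_mult[OF herm U1 U2 t] by simp
  finally show ?thesis by simp
qed

lemma propagator_eqI:
  fixes H0 V :: "complex^'n::finite^'n"
  assumes herm: "dagger H0 = H0" "dagger V = V"
    and U: "is_propagator T H0 V f U" "\<And>t. t \<notin> {0..T} \<Longrightarrow> U t = 0"
  shows "propagator T H0 V f = U"
  unfolding propagator_def
proof (rule the_equality)
  show "is_propagator T H0 V f U \<and> (\<forall>t. t \<notin> {0..T} \<longrightarrow> U t = 0)" using U by blast
next
  fix U' assume U': "is_propagator T H0 V f U' \<and> (\<forall>t. t \<notin> {0..T} \<longrightarrow> U' t = 0)"
  show "U' = U"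
  proof
    fix t show "U' t = U t"
      using propagator_unique[OF herm conjunct1[OF U'] U(1), of t] U' U(2)[of t] by (cases "t \<in> {0..T}") auto
  qed
qed

section \<open>Diagonal matrices and their exponentials\<close>

definition diag :: "('n \<Rightarrow> complex) \<Rightarrow> complex^'n^'n::finite" where
  "diag d = (\<chi> i j. if i = j then d i else 0)"

lemma diag_mult_component: "(diag d ** A) $ i $ j = d i * A $ i $ j"
  "(A ** diag d) $ i $ j = A $ i $ j * d j" for A :: "complex^'n::finite^'n"
proof -
  have "(diag d ** A) $ i $ j = (\<Sum>k\<in>UNIV. if i = k then d i * A $ k $ j else 0)"
    unfolding matrix_matrix_mult_def diag_def vec_lambda_beta by (intro sum.cong) auto
  also have "\<dots> = d i * A $ i $ j" by simp
  finally show "(diag d ** A) $ i $ j = d i * A $ i $ j" .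
  have "(A ** diag d) $ i $ j = (\<Sum>k\<in>UNIV. if k = j then A $ i $ k * d j else 0)"
    unfolding matrix_matrix_mult_def diag_def vec_lambda_beta by (intro sum.cong) auto
  also have "\<dots> = A $ i $ j * d j" by simp
  finally show "(A ** diag d) $ i $ j = A $ i $ j * d j" .
qed

lemma diag_component: "diag d $ i $ j = (if i = j then d i else 0)"
  by (simp add: diag_def)

lemma mat_diag: "mat c ** diag d = diag (\<lambda>i. c * d i)"
  by (simp add: vec_eq_iff mat_mult_component diag_component)

lemma diag_diag: "diag c ** diag d = diag (\<lambda>i. c i * d i)"
  by (simp add: vec_eq_iff diag_mult_component diag_component)

lemma diag_one: "diag (\<lambda>i. 1) = mat 1"
  by (simp add: vec_eq_iff diag_component mat_def)

lemma dagger_diag: "dagger (diag d) = diag (\<lambda>i. cnj (d i))"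
  by (simp add: vec_eq_iff dagger_def diag_component)

lemma mat_exp_diag: "mat_exp (diag d) = diag (\<lambda>i. exp (d i))"
proof -
  have pow: "(((**) (diag d)) ^^ n) (mat 1) = diag (\<lambda>i. d i ^ n)" for n
    by (induction n) (auto simp: diag_one diag_diag)
  have "(\<lambda>n. diag (\<lambda>i. d i ^ n) /\<^sub>R fact n) sums diag (\<lambda>i. exp (d i))"
    unfolding sums_def
  proof (intro vec_tendstoI)
    fix i j
    have "(\<lambda>n. (diag (\<lambda>i. d i ^ n) /\<^sub>R fact n) $ i $ j) sums (diag (\<lambda>i. exp (d i)) $ i $ j)"
      using exp_converges[of "d i"] by (auto simp: diag_component)
    then show "(\<lambda>N. (\<Sum>n<N. diag (\<lambda>i. d i ^ n) /\<^sub>R fact n) $ i $ j) \<longlonglongrightarrow> diag (\<lambda>i. exp (d i)) $ i $ j"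
      by (simp add: sums_def)
  qed
  then show ?thesis unfolding mat_exp_def pow by (rule sums_unique[symmetric])
qed

lemma interaction_diag:
  "interaction (diag d) V t = diag (\<lambda>i. exp (\<i> * of_real t * d i)) ** V ** diag (\<lambda>i. exp (- \<i> * of_real t * d i))"
  by (simp add: interaction_def mat_diag mat_exp_diag)

lemma has_vector_derivative_diag:
  assumes "\<And>i. ((\<lambda>t. d t i) has_vector_derivative d' i) F"
  shows "((\<lambda>t. diag (d t)) has_vector_derivative diag d') F"
proof -
  \<comment> \<open>\<open>?L i\<close> puts a number into the \<open>i\<close>-th diagonal place;
    \<open>diag\<close> is the sum of these bounded linear maps.\<close>
  let ?L = "\<lambda>i z. diag (\<lambda>j. if j = i then z else 0)"
  have L: "bounded_linear (?L i)" for i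
    by (intro linear_conv_bounded_linear[THEN iffD1] linearI) (auto simp: vec_eq_iff diag_component)
  have sum: "diag e = (\<Sum>i\<in>UNIV. ?L i (e i))" for e :: "'a \<Rightarrow> complex"
  proof -
    have "diag e $ a $ c = (\<Sum>i\<in>UNIV. ?L i (e i)) $ a $ c" for a c
    proof -
      have "(\<Sum>i\<in>UNIV. ?L i (e i)) $ a $ c = (\<Sum>i\<in>UNIV. ?L i (e i) $ a $ c)" by simp
      also have "\<dots> = (\<Sum>i\<in>UNIV. if i = a then diag e $ a $ c else 0)"
        by (intro sum.cong) (auto simp: diag_component)
      also have "\<dots> = diag e $ a $ c" by simp
      finally show ?thesis by simp
    qed
    then show ?thesis unfolding vec_eq_iff by blast
  qed
  have "((\<lambda>t. \<Sum>i\<in>UNIV. ?L i (d t i)) has_vector_derivative (\<Sum>i\<in>UNIV. ?L i (d' i))) F"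
    by (intro has_vector_derivative_sum bounded_linear.has_vector_derivative[OF L] assms)
  then show ?thesis unfolding sum[symmetric] .
qed

section \<open>The interaction picture for a diagonal free Hamiltonian\<close>

lemma absolutely_continuous_on_Icc_cong:
  assumes "absolutely_continuous_on_Icc a b F" "\<And>t. t \<in> {a..b} \<Longrightarrow> G t = F t"
  shows "absolutely_continuous_on_Icc a b G"
  by (rule absolutely_continuous_on_Icc_dist_le[OF assms(1) assms(1), where C = 1]) (use assms(2) in auto)

locale diagonal_system =
  fixes T :: real and h :: "'n::finite \<Rightarrow> real" and V :: "complex^'n^'n"
  assumes T_nn: "0 \<le> T" and hermitian: "dagger V = V"
begin

abbreviation H0 :: "complex^'n^'n" where "H0 \<equiv> diag (\<lambda>i. of_real (h i))"

text \<open>Kernel of the interaction picture equation \<open>W' = f K W\<close>; the factor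
  \<open>- \<i>\<close> of the Schroedinger equation is included.\<close>

definition K :: "real \<Rightarrow> complex^'n^'n" where "K t = mat (- \<i>) ** interaction H0 V t"

text \<open>The free evolution \<open>exp (- \<i> t H0)\<close>, which is explicit because
  \<open>H0\<close> is diagonal.\<close>

definition E :: "real \<Rightarrow> complex^'n^'n" where "E t = diag (\<lambda>i. exp (- \<i> * of_real t * of_real (h i)))"

lemma K_component: "K t $ l $ k = - \<i> * (exp (\<i> * of_real (t * (h l - h k))) * V $ l $ k)"
proof -
  have "exp (\<i> * of_real t * of_real (h l)) * exp (- \<i> * of_real t * of_real (h k)) = exp (\<i> * of_real (t * (h l - h k)))"
    unfolding exp_add[symmetric] by (simp add: algebra_simps)
  then show ?thesis
    by (simp add: K_def interaction_diag mat_mult_component diag_mult_component mult.commute mult.left_commute)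
qed

lemma continuous_K: "continuous_on S K"
proof -
  have "K = (\<lambda>t. \<chi> l k. - \<i> * (exp (\<i> * of_real (t * (h l - h k))) * V $ l $ k))"
    by (simp add: fun_eq_iff vec_eq_iff K_component)
  then show ?thesis by (simp only:) (intro continuous_intros)
qed

sublocale dyson_kernel T K
  by unfold_locales (rule continuous_K, rule T_nn)

definition W :: "(real \<Rightarrow> real) \<Rightarrow> real \<Rightarrow> complex^'n^'n" where
  "W f t = (\<Sum>n. dyson K n (\<lambda>_. f) t)"

text \<open>The value 0 off the interval matches the normalization inside
  \<open>propagator\<close>.\<close>

definition U :: "(real \<Rightarrow> real) \<Rightarrow> real \<Rightarrow> complex^'n^'n" where
  "U f t = (if t \<in> {0..T} then E t ** W f t else 0)"

lemma dagger_E: "dagger (E t) ** E t = mat 1"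
  by (simp add: E_def dagger_diag diag_diag exp_cnj exp_minus_inverse flip: exp_add diag_one)

lemma is_propagator_U:
  assumes f: "f \<in> L2_space T"
  shows "is_propagator T H0 V f (U f)"
  unfolding is_propagator_def
proof (intro conjI)
  have W: "is_primitive 0 T (W f) (\<lambda>t. f t *\<^sub>R (K t ** W f t))" "W f 0 = mat 1"
    using is_primitive_dyson_series[OF f] by (simp_all add: W_def[abs_def])
  have E': "(E has_vector_derivative mat (- \<i>) ** (H0 ** E t)) (at t within {0..T})" for t
  proof -
    have "((\<lambda>t. exp (- \<i> * of_real t * of_real (h i))) has_vector_derivative
        (- \<i> * of_real (h i)) * exp (- \<i> * of_real t * of_real (h i))) (at t within {0..T})" for i
      by (rule has_vector_derivative_real_field) (auto intro!: derivative_eq_intros)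
    from has_vector_derivative_diag[OF this] show ?thesis
      unfolding E_def[abs_def] diag_diag mat_diag by (simp add: mult.assoc)
  qed
  have E: "is_primitive 0 T E (\<lambda>t. mat (- \<i>) ** (H0 ** E t))"
  proof (rule is_primitive_C1[OF E'])
    have "continuous_on {0..T} E"
      unfolding continuous_on_eq_continuous_within using has_vector_derivative_continuous[OF E'] by blast
    then show "continuous_on {0..T} (\<lambda>t. mat (- \<i>) ** (H0 ** E t))"
      by (intro bounded_bilinear.continuous_on[OF bounded_bilinear_matrix_mult] continuous_on_const)
  qed
  note EW = is_primitive_bounded_bilinear[OF bounded_bilinear_matrix_mult E W(1)]
  show "absolutely_continuous_on_Icc 0 T (U f)"
    by (rule absolutely_continuous_on_Icc_cong[OF is_primitive_absolutely_continuous[OF EW]]) (simp add: U_def)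
  show "U f 0 = mat 1" using W(2) T_nn by (simp add: U_def E_def diag_one)
  have sp: "AE t in lebesgue_on {0..T}. t \<in> {0..T}" by (rule AE_I2) simp
  show "AE t in lebesgue_on {0..T}. \<exists>D. (U f has_vector_derivative D) (at t within {0..T}) \<and>
        mat \<i> ** D = (H0 + f t *\<^sub>R V) ** U f t"
    using is_primitive_AE_derivative[OF EW] sp
  proof eventually_elim
    case (elim t)
    let ?D = "E t ** (f t *\<^sub>R (K t ** W f t)) + mat (- \<i>) ** (H0 ** E t) ** W f t"
    let ?E = "diag (\<lambda>i. exp (\<i> * of_real t * of_real (h i)))"
    \<comment> \<open>This undoes the conjugation inside \<open>K\<close>, leaving
      \<open>E t ** K t\<close> equal to \<open>mat (- \<i>) ** (V ** E t)\<close>.\<close>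
    have EE: "E t ** ?E = mat 1"
      by (simp add: E_def diag_diag diag_one flip: exp_add)
    have K: "K t = mat (- \<i>) ** (?E ** V ** E t)"
      by (simp add: K_def interaction_diag E_def)
    have "(U f has_vector_derivative ?D) (at t within {0..T})"
      using has_vector_derivative_transform[OF elim(2), of "U f" "\<lambda>t. E t ** W f t"] elim(1) by (simp add: U_def)
    moreover have "mat \<i> ** ?D = (H0 + f t *\<^sub>R V) ** U f t"
    proof -
      have "E t ** (K t ** W f t) = mat (- \<i>) ** ((E t ** ?E) ** V ** E t ** W f t)"
        unfolding K by (simp add: matrix_mul_assoc[symmetric] mat_pull)
      then have "E t ** (K t ** W f t) = mat (- \<i>) ** (V ** E t ** W f t)"
        unfolding EE by simp
      then have "mat \<i> ** ?D = f t *\<^sub>R (V ** E t ** W f t) + H0 ** E t ** W f t"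
        by (simp add: bounded_bilinear.add_right[OF bounded_bilinear_matrix_mult]
            bounded_bilinear.scaleR_right[OF bounded_bilinear_matrix_mult] matrix_mul_assoc[symmetric] mat_ii_cancel)
      also have "\<dots> = (H0 + f t *\<^sub>R V) ** U f t"
        using elim(2) by (simp add: U_def bounded_bilinear.add_left[OF bounded_bilinear_matrix_mult]
            bounded_bilinear.scaleR_left[OF bounded_bilinear_matrix_mult] matrix_mul_assoc)
      finally show ?thesis .
    qed
    ultimately show ?case by blast
  qed
qed

lemma dagger_H0: "dagger H0 = H0"
  by (simp add: dagger_diag)

lemma propagator_eq_U: "f \<in> L2_space T \<Longrightarrow> propagator T H0 V f = U f"
  by (rule propagator_eqI[OF dagger_H0 hermitian is_propagator_U]) (auto simp: U_def)

lemma unitary_W: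
  assumes f: "f \<in> L2_space T"
  shows "dagger (W f T) ** W f T = mat 1"
proof -
  have "dagger (U f T) ** U f T = mat 1"
    using T_nn by (intro propagators_dagger_mult[OF dagger_H0 hermitian is_propagator_U[OF f] is_propagator_U[OF f]]) simp
  moreover have "dagger (U f T) ** U f T = dagger (W f T) ** (dagger (E T) ** E T) ** W f T"
    using T_nn by (simp add: U_def dagger_matrix_mult matrix_mul_assoc)
  ultimately show ?thesis by (simp add: dagger_E)
qed

text \<open>The free evolution multiplies each row of \<open>W\<close> by a phase, which the squared
  moduli do not see.\<close>

lemma objective_diag:
  fixes r o' :: "'n \<Rightarrow> real"
  assumes f: "f \<in> L2_space T"
  shows "objective T H0 V (diag (\<lambda>i. of_real (r i))) (diag (\<lambda>i. of_real (o' i))) f =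
    (\<Sum>l\<in>UNIV. \<Sum>k\<in>UNIV. o' l * r k * (cmod (W f T $ l $ k))\<^sup>2)"
proof -
  let ?U = "U f T"
  have U: "cmod (?U $ l $ k) = cmod (W f T $ l $ k)" for l k
    using T_nn by (simp add: U_def E_def diag_mult_component norm_mult)
  have "(?U ** diag (\<lambda>i. of_real (r i)) ** dagger ?U ** diag (\<lambda>i. of_real (o' i))) $ l $ l =
      of_real (\<Sum>k\<in>UNIV. o' l * r k * (cmod (?U $ l $ k))\<^sup>2)" for l
  proof -
    have "(?U ** diag (\<lambda>i. of_real (r i)) ** dagger ?U) $ l $ l = (\<Sum>k\<in>UNIV. ?U $ l $ k * of_real (r k) * cnj (?U $ l $ k))"
      by (subst matrix_matrix_mult_def) (simp add: diag_mult_component dagger_def)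
    then show ?thesis
      by (simp add: diag_mult_component(2) sum_distrib_left complex_norm_square mult_ac del: of_real_power)
  qed
  then show ?thesis
    unfolding objective_def Let_def propagator_eq_U[OF f] trace_def by (simp add: U)
qed

end

section \<open>Expansion of matrix elements\<close>

lemma entire_forms_add:
  assumes "entire_forms T B b" "entire_forms T C c"
  shows "entire_forms T (\<lambda>n v. B n v + C n v) (\<lambda>n. b n + c n)"
proof -
  interpret B: entire_forms T B b by fact
  interpret C: entire_forms T C c by fact
  show ?thesis
  proof
    fix v :: "nat \<Rightarrow> real \<Rightarrow> real" and f g :: "real \<Rightarrow> real" and i n :: nat and x y :: real
    assume "\<And>j. v j \<in> L2_space T" "f \<in> L2_space T" "g \<in> L2_space T" "i < n"
    then show "B n (v(i := \<lambda>t. x * f t + y * g t)) + C n (v(i := \<lambda>t. x * f t + y * g t)) =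
        x * (B n (v(i := f)) + C n (v(i := f))) + y * (B n (v(i := g)) + C n (v(i := g)))"
      by (simp add: B.linear_slot C.linear_slot distrib_left)
  next
    fix v w :: "nat \<Rightarrow> real \<Rightarrow> real" and n
    assume "\<And>j. j < n \<Longrightarrow> v j = w j"
    then show "B n v + C n v = B n w + C n w" using B.local[of n v w] C.local[of n v w] by simp
  next
    fix v :: "nat \<Rightarrow> real \<Rightarrow> real" and n
    assume v: "\<And>j. v j \<in> L2_space T"
    show "\<bar>B n v + C n v\<bar> \<le> (b n + c n) * (\<Prod>j<n. L2_norm T (v j))"
      using B.bound[of v n, OF v] C.bound[of v n, OF v] by (simp add: distrib_right)
  next
    show "0 \<le> b n + c n" for n using B.nonneg C.nonneg by simp
    show "summable (\<lambda>n. (b n + c n) * r ^ n)" for r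
      using summable_add[OF B.entire[of r] C.entire[of r]] by (simp add: distrib_right)
  qed
qed

lemma entire_forms_scale:
  assumes "entire_forms T B b"
  shows "entire_forms T (\<lambda>n v. k * B n v) (\<lambda>n. \<bar>k\<bar> * b n)"
proof -
  interpret B: entire_forms T B b by fact
  show ?thesis
  proof
    fix v :: "nat \<Rightarrow> real \<Rightarrow> real" and f g :: "real \<Rightarrow> real" and i n :: nat and x y :: real
    assume "\<And>j. v j \<in> L2_space T" "f \<in> L2_space T" "g \<in> L2_space T" "i < n"
    then show "k * B n (v(i := \<lambda>t. x * f t + y * g t)) = x * (k * B n (v(i := f))) + y * (k * B n (v(i := g)))"
      by (simp add: B.linear_slot algebra_simps)
  next
    fix v w :: "nat \<Rightarrow> real \<Rightarrow> real" and n
    assume "\<And>j. j < n \<Longrightarrow> v j = w j"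
    then show "k * B n v = k * B n w" using B.local[of n v w] by simp
  next
    fix v :: "nat \<Rightarrow> real \<Rightarrow> real" and n
    assume v: "\<And>j. v j \<in> L2_space T"
    show "\<bar>k * B n v\<bar> \<le> \<bar>k\<bar> * b n * (\<Prod>j<n. L2_norm T (v j))"
      using mult_left_mono[OF B.bound[of v n, OF v], of "\<bar>k\<bar>"] by (simp add: abs_mult mult.assoc)
  next
    show "0 \<le> \<bar>k\<bar> * b n" for n using B.nonneg by simp
    show "summable (\<lambda>n. \<bar>k\<bar> * b n * r ^ n)" for r
      using summable_mult[OF B.entire[of r], of "\<bar>k\<bar>"] by (simp add: mult.assoc)
  qed
qed

lemma entire_forms_const:
  "entire_forms T (\<lambda>n v. if n = 0 then k else 0) (\<lambda>n. if n = 0 then \<bar>k\<bar> else 0)"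
proof
  show "summable (\<lambda>n. (if n = 0 then \<bar>k\<bar> else 0) * r ^ n)" for r
    by (rule summable_finite[of "{0}"]) auto
qed auto

section \<open>Squared moduli of matrix elements as power series in the control\<close>

context dyson_kernel
begin

text \<open>The order \<open>n\<close> part of the squared modulus of an entry, as a Cauchy product
  of the Dyson series with its conjugate. The second factor takes the slots from \<open>p\<close>
  on, so that each of the \<open>n\<close> arguments is used once.\<close>

definition pair_form :: "'n \<Rightarrow> 'n \<Rightarrow> nat \<Rightarrow> (nat \<Rightarrow> real \<Rightarrow> real) \<Rightarrow> real" where
  "pair_form l k n v = (\<Sum>p\<le>n. Re (dyson K p v T $ l $ k * cnj (dyson K (n - p) (\<lambda>i. v (p + i)) T $ l $ k)))"

lemma norm_dyson_component_le:
  assumes "\<And>j. v j \<in> L2_space T" "s \<in> {0..T}"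
  shows "cmod (dyson K n v s $ l $ k) \<le> dyson_bound n * (\<Prod>j<n. L2_norm T (v j))"
  using Finite_Cartesian_Product.norm_nth_le[of "dyson K n v s $ l" k] Finite_Cartesian_Product.norm_nth_le[of "dyson K n v s" l] norm_dyson_le[of v s n, OF assms]
  by linarith

lemma entire_forms_pair_form:
  "entire_forms T (pair_form l k) (\<lambda>n. \<Sum>p\<le>n. dyson_bound p * dyson_bound (n - p))"
proof
  have T: "T \<in> {0..T}" using T_nonneg by simp
  { fix v :: "nat \<Rightarrow> real \<Rightarrow> real" and f g :: "real \<Rightarrow> real" and i n :: nat and x y :: real
    assume v: "\<And>j. v j \<in> L2_space T" and f: "f \<in> L2_space T" and g: "g \<in> L2_space T" and i: "i < n"
    let ?P = "\<lambda>p z. dyson K p (v(i := z)) T $ l $ k" and ?Q = "\<lambda>p z. dyson K (n - p) (\<lambda>j. (v(i := z)) (p + j)) T $ l $ k"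
    let ?z = "\<lambda>t. x * f t + y * g t"
    have "Re (?P p ?z * cnj (?Q p ?z)) = x * Re (?P p f * cnj (?Q p f)) + y * Re (?P p g * cnj (?Q p g))"
      if p: "p \<le> n" for p
    \<comment> \<open>A slot belongs to exactly one of the two factors, so the product is linear in
      it; conjugation is harmless because the coefficients are real.\<close>
    proof (cases "i < p")
      case True
      have Q: "(\<lambda>j. (v(i := z)) (p + j)) = (\<lambda>j. v (p + j))" for z
        using True by (auto simp: fun_eq_iff)
      have "?P p ?z = x *\<^sub>R ?P p f + y *\<^sub>R ?P p g"
        using dyson_linear[of v f g i p T x y] v f g True T by simp
      then show ?thesis unfolding Q by (simp add: algebra_simps)
    next
      case False
      have P: "?P p z = dyson K p v T $ l $ k" for z
        using dyson_local[of p "v(i := z)" v T] False by simp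
      have "(\<lambda>j. (v(i := z)) (p + j)) = (\<lambda>j. v (p + j))(i - p := z)" for z
        using False by (auto simp: fun_eq_iff)
      then have "?Q p ?z = x *\<^sub>R ?Q p f + y *\<^sub>R ?Q p g"
        using dyson_linear[of "\<lambda>j. v (p + j)" f g "i - p" "n - p" T x y] v f g i False T by simp
      then show ?thesis unfolding P by (simp add: algebra_simps)
    qed
    then show "pair_form l k n (v(i := ?z)) = x * pair_form l k n (v(i := f)) + y * pair_form l k n (v(i := g))"
      unfolding pair_form_def sum_distrib_left sum.distrib[symmetric] by (intro sum.cong) auto }
  { fix v w :: "nat \<Rightarrow> real \<Rightarrow> real" and n
    assume eq: "\<And>j. j < n \<Longrightarrow> v j = w j"
    have "dyson K p v T = dyson K p w T" "dyson K (n - p) (\<lambda>i. v (p + i)) T = dyson K (n - p) (\<lambda>i. w (p + i)) T" if "p \<le> n" for p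
      by (rule dyson_local; use eq that in auto)+
    then show "pair_form l k n v = pair_form l k n w"
      unfolding pair_form_def by (intro sum.cong) auto }
  { fix v :: "nat \<Rightarrow> real \<Rightarrow> real" and n
    assume v: "\<And>j. v j \<in> L2_space T"
    have "\<bar>Re (dyson K p v T $ l $ k * cnj (dyson K (n - p) (\<lambda>i. v (p + i)) T $ l $ k))\<bar> \<le>
        dyson_bound p * dyson_bound (n - p) * (\<Prod>j<n. L2_norm T (v j))" if p: "p \<le> n" for p
    proof -
      have "\<bar>Re (dyson K p v T $ l $ k * cnj (dyson K (n - p) (\<lambda>i. v (p + i)) T $ l $ k))\<bar> \<le>
          cmod (dyson K p v T $ l $ k) * cmod (dyson K (n - p) (\<lambda>i. v (p + i)) T $ l $ k)"
        using abs_Re_le_cmod[of "dyson K p v T $ l $ k * cnj (dyson K (n - p) (\<lambda>i. v (p + i)) T $ l $ k)"]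
        by (simp add: norm_mult)
      also have "\<dots> \<le> (dyson_bound p * (\<Prod>j<p. L2_norm T (v j))) * (dyson_bound (n - p) * (\<Prod>j<n - p. L2_norm T (v (p + j))))"
        by (intro mult_mono norm_dyson_component_le v T mult_nonneg_nonneg dyson_bound_nonneg prod_nonneg) (auto simp: L2_norm_nonneg)
      also have "\<dots> = dyson_bound p * dyson_bound (n - p) * (\<Prod>j<n. L2_norm T (v j))"
        using prod_lessThan_add[of "\<lambda>j. L2_norm T (v j)" p "n - p"] p by (simp add: mult_ac)
      finally show ?thesis .
    qed
    then show "\<bar>pair_form l k n v\<bar> \<le> (\<Sum>p\<le>n. dyson_bound p * dyson_bound (n - p)) * (\<Prod>j<n. L2_norm T (v j))"
      unfolding pair_form_def sum_distrib_right by (intro order_trans[OF sum_abs] sum_mono) auto }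
  show "0 \<le> (\<Sum>p\<le>n. dyson_bound p * dyson_bound (n - p))" for n
    by (intro sum_nonneg mult_nonneg_nonneg dyson_bound_nonneg)
  show "summable (\<lambda>n. (\<Sum>p\<le>n. dyson_bound p * dyson_bound (n - p)) * r ^ n)" for r
  proof -
    have s: "summable (\<lambda>n. norm (dyson_bound n * r ^ n))"
      using summable_dyson_bound[of "\<bar>r\<bar>"] by (simp add: abs_mult dyson_bound_nonneg power_abs)
    have "(\<lambda>n. \<Sum>p\<le>n. (dyson_bound p * r ^ p) * (dyson_bound (n - p) * r ^ (n - p))) =
        (\<lambda>n. (\<Sum>p\<le>n. dyson_bound p * dyson_bound (n - p)) * r ^ n)"
    proof (rule ext)
      fix n
      have "(dyson_bound p * r ^ p) * (dyson_bound (n - p) * r ^ (n - p)) = dyson_bound p * dyson_bound (n - p) * r ^ n"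
        if "p \<le> n" for p
      proof -
        have "r ^ n = r ^ p * r ^ (n - p)" using that by (simp flip: power_add)
        then show ?thesis by simp
      qed
      then show "(\<Sum>p\<le>n. (dyson_bound p * r ^ p) * (dyson_bound (n - p) * r ^ (n - p))) =
        (\<Sum>p\<le>n. dyson_bound p * dyson_bound (n - p)) * r ^ n"
        unfolding sum_distrib_right by (intro sum.cong) auto
    qed
    with summable_Cauchy_product[OF s s] show ?thesis by simp
  qed
qed

lemma pair_form_sums:
  assumes f: "f \<in> L2_space T"
  shows "(\<lambda>n. pair_form l k n (\<lambda>_. f)) sums (cmod ((\<Sum>n. dyson K n (\<lambda>_. f) T) $ l $ k))\<^sup>2"
proof -
  have T: "T \<in> {0..T}" using T_nonneg by simp
  let ?x = "\<lambda>n. dyson K n (\<lambda>_. f) T $ l $ k"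
  define X where "X = (\<Sum>n. dyson K n (\<lambda>_. f) T) $ l $ k"
  have L: "bounded_linear (\<lambda>M::complex^'n^'n. M $ l $ k)"
    by (rule bounded_linear_compose[OF bounded_linear_vec_nth bounded_linear_vec_nth])
  have nx: "summable (\<lambda>n. norm (?x n))"
  proof (rule summable_comparison_test'[OF dyson_sums[OF f T], of 0])
    fix n show "norm (norm (?x n)) \<le> norm (dyson K n (\<lambda>_. f) T)"
      using Finite_Cartesian_Product.norm_nth_le[of "dyson K n (\<lambda>_. f) T $ l" k] Finite_Cartesian_Product.norm_nth_le[of "dyson K n (\<lambda>_. f) T" l] by simp
  qed
  have x: "?x sums X"
    unfolding X_def by (rule bounded_linear.sums[OF L summable_sums[OF summable_norm_cancel[OF dyson_sums[OF f T]]]])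
  then have cx: "(\<lambda>n. cnj (?x n)) sums cnj X" by (simp only: sums_cnj)
  have "(\<lambda>n. \<Sum>p\<le>n. ?x p * cnj (?x (n - p))) sums ((\<Sum>n. ?x n) * (\<Sum>n. cnj (?x n)))"
    by (rule Cauchy_product_sums) (use nx in auto)
  then have "(\<lambda>n. \<Sum>p\<le>n. ?x p * cnj (?x (n - p))) sums (X * cnj X)"
    using x cx by (simp add: sums_iff)
  then have "(\<lambda>n. Re (\<Sum>p\<le>n. ?x p * cnj (?x (n - p)))) sums Re (X * cnj X)" by (rule sums_Re)
  moreover have "Re (X * cnj X) = (cmod X)\<^sup>2"
    by (simp add: complex_norm_square[symmetric] flip: of_real_power)
  ultimately show ?thesis by (simp add: pair_form_def X_def)
qed

end

section \<open>Iterated integrals as entries of Dyson terms\<close>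

context diagonal_system
begin

text \<open>The outermost integration variable supplies the leftmost matrix factor, so the induction
  carries an arbitrary matrix \<open>M\<close> on the left. The factor \<open>\<i> ^ n\<close>
  cancels the \<open>- \<i>\<close> contained in each \<open>K\<close>.\<close>

lemma A_coeff_eq_dyson:
  assumes f: "f \<in> L2_space T"
  shows "A_coeff T H0 V n l k f = \<i> ^ n * dyson K n (\<lambda>_. f) T $ l $ k"
proof -
  let ?I = "interaction H0 V"
  have I: "?I t = mat \<i> ** K t" for t by (simp add: K_def mat_ii_cancel)
  have "simplex_integral n s (\<lambda>ts. of_real (\<Prod>t\<leftarrow>ts. f t) * (M ** foldr (**) (map ?I ts) (mat 1)) $ l $ k) =
      (M ** (mat (\<i> ^ n) ** dyson K n (\<lambda>_. f) s)) $ l $ k" if "s \<in> {0..T}" for s M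
    using that
  proof (induction n arbitrary: s M)
    case 0
    then show ?case by simp
  next
    case (Suc n)
    let ?L = "\<lambda>X. (M ** (mat (\<i> ^ Suc n) ** X)) $ l $ k"
    have L: "bounded_linear ?L"
      by (intro bounded_linear_compose[OF bounded_linear_vec_nth] bounded_linear_compose[OF bounded_bilinear.bounded_linear_right[OF bounded_bilinear_matrix_mult]]
          bounded_bilinear.bounded_linear_right[OF bounded_bilinear_matrix_mult])
    have "simplex_integral n t (\<lambda>ts. of_real (\<Prod>t\<leftarrow>t # ts. f t) * (M ** foldr (**) (map ?I (t # ts)) (mat 1)) $ l $ k) =
        ?L (f t *\<^sub>R (K t ** dyson K n (\<lambda>_. f) t))" if t: "t \<in> {0..s}" for t
    proof -
      have eq: "of_real (\<Prod>t\<leftarrow>t # ts. f t) * (M ** foldr (**) (map ?I (t # ts)) (mat 1)) $ l $ k =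
         of_real (\<Prod>t\<leftarrow>ts. f t) * ((f t *\<^sub>R (M ** ?I t)) ** foldr (**) (map ?I ts) (mat 1)) $ l $ k" for ts
      proof -
        have "((f t *\<^sub>R (M ** ?I t)) ** X) $ l $ k = of_real (f t) * (M ** (?I t ** X)) $ l $ k" for X
          by (simp add: bounded_bilinear.scaleR_left[OF bounded_bilinear_matrix_mult] matrix_mul_assoc)
             (simp add: scaleR_conv_of_real)
        then show ?thesis by simp
      qed
      have "simplex_integral n t (\<lambda>ts. of_real (\<Prod>t\<leftarrow>t # ts. f t) * (M ** foldr (**) (map ?I (t # ts)) (mat 1)) $ l $ k) =
          simplex_integral n t (\<lambda>ts. of_real (\<Prod>t\<leftarrow>ts. f t) * ((f t *\<^sub>R (M ** ?I t)) ** foldr (**) (map ?I ts) (mat 1)) $ l $ k)"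
        by (intro arg_cong[of _ _ "simplex_integral n t"] ext eq)
      also have "\<dots> = ((f t *\<^sub>R (M ** ?I t)) ** (mat (\<i> ^ n) ** dyson K n (\<lambda>_. f) t)) $ l $ k"
        using t Suc.prems by (intro Suc.IH) auto
      also have "(f t *\<^sub>R (M ** ?I t)) ** (mat (\<i> ^ n) ** dyson K n (\<lambda>_. f) t) = M ** (mat (\<i> ^ Suc n) ** (f t *\<^sub>R (K t ** dyson K n (\<lambda>_. f) t)))"
      proof -
        have "(M ** ?I t) ** (mat (\<i> ^ n) ** Y) = M ** (mat (\<i> ^ Suc n) ** (K t ** Y))" for Y :: "complex^'n^'n"
        proof -
          have 1: "M ** ?I t = mat \<i> ** (M ** K t)" unfolding I by (rule mat_pull)
          have "(M ** ?I t) ** (mat (\<i> ^ n) ** Y) = mat (\<i> ^ n) ** ((M ** ?I t) ** Y)" by (rule mat_pull)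
          also have "\<dots> = (mat (\<i> ^ n) ** mat \<i>) ** (M ** (K t ** Y))"
            unfolding 1 by (simp add: matrix_mul_assoc)
          also have "\<dots> = mat (\<i> ^ Suc n) ** (M ** (K t ** Y))"
            by (simp add: mat_mult_mat mult.commute)
          also have "\<dots> = M ** (mat (\<i> ^ Suc n) ** (K t ** Y))" by (rule mat_pull[symmetric])
          finally show ?thesis .
        qed
        then show ?thesis
          by (simp add: bounded_bilinear.scaleR_left[OF bounded_bilinear_matrix_mult] bounded_bilinear.scaleR_right[OF bounded_bilinear_matrix_mult])
      qed
      finally show ?thesis .
    qed
    then have "simplex_integral (Suc n) s (\<lambda>ts. of_real (\<Prod>t\<leftarrow>ts. f t) * (M ** foldr (**) (map ?I ts) (mat 1)) $ l $ k) =
      (LINT t|lebesgue_on {0..s}. ?L (f t *\<^sub>R (K t ** dyson K n (\<lambda>_. f) t)))"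
      unfolding simplex_integral.simps by (intro Bochner_Integration.integral_cong) auto
    also have "\<dots> = ?L (LINT t|lebesgue_on {0..s}. f t *\<^sub>R (K t ** dyson K n (\<lambda>_. f) t))"
      by (rule integral_bounded_linear[OF L dyson_integrable[OF f f Suc.prems]])
    finally show ?case by simp
  qed
  from this[of T "mat 1"] show ?thesis
    using T_nn by (simp add: A_coeff_def mat_mult_component)
qed

end

section \<open>The harmonic three-level ladder\<close>

lemma is_primitive_cong:
  assumes "is_primitive a b F f" "\<And>t. t \<in> {a..b} \<Longrightarrow> F t = G t" "\<And>t. t \<in> {a..b} \<Longrightarrow> f t = g t"
  shows "is_primitive a b G g"
  unfolding is_primitive_def
proof (intro conjI ballI)
  have "integrable (lebesgue_on {a..b}) f \<longleftrightarrow> integrable (lebesgue_on {a..b}) g"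
    by (rule Bochner_Integration.integrable_cong) (use assms(3) in auto)
  then show "integrable (lebesgue_on {a..b}) g" using is_primitive_integrable[OF assms(1)] by blast
  fix t assume t: "t \<in> {a..b}"
  have "G t = F t" using assms(2) t by simp
  also have "\<dots> = F a + (LINT s|lebesgue_on {a..t}. f s)" by (rule is_primitiveD[OF assms(1) t])
  also have "(LINT s|lebesgue_on {a..t}. f s) = (LINT s|lebesgue_on {a..t}. g s)"
    by (intro Bochner_Integration.integral_cong) (use assms(3) t in auto)
  also have "F a = G a" using assms(2) t by simp
  finally show "G t = G a + (LINT s|lebesgue_on {a..t}. g s)" .
qed

text \<open>This is how the closed formulas for the Dyson terms are checked: same integrand and same
  initial value.\<close>

lemma is_primitive_unique:
  assumes F: "is_primitive a b F f" and G: "is_primitive a b G g" and "F a = G a"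
    and "\<And>t. t \<in> {a..b} \<Longrightarrow> f t = g t" and t: "t \<in> {a..b}"
  shows "F t = G t"
proof -
  have "(LINT s|lebesgue_on {a..t}. f s) = (LINT s|lebesgue_on {a..t}. g s)"
    by (intro Bochner_Integration.integral_cong) (use assms(4) t in auto)
  then show ?thesis using is_primitiveD[OF F t] is_primitiveD[OF G t] assms(3) by metis
qed

lemma is_primitive_bounded_linear:
  assumes L: "bounded_linear L" and F: "is_primitive a b F f"
  shows "is_primitive a b (\<lambda>t. L (F t)) (\<lambda>t. L (f t))"
  unfolding is_primitive_def
proof (intro conjI ballI)
  have f: "integrable (lebesgue_on {a..b}) f" by (rule is_primitive_integrable[OF F])
  then show "integrable (lebesgue_on {a..b}) (\<lambda>t. L (f t))" by (rule integrable_bounded_linear[OF L])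
  fix t assume t: "t \<in> {a..b}"
  have "integrable (lebesgue_on {a..t}) f" by (rule integrable_subinterval[OF f]) (use t in auto)
  then show "L (F t) = L (F a) + (LINT s|lebesgue_on {a..t}. L (f s))"
    by (subst is_primitiveD[OF F t]) (simp add: integral_bounded_linear[OF L] linear_add[OF bounded_linear.linear[OF L]])
qed

lemma is_primitive_add:
  assumes F: "is_primitive a b F f" and G: "is_primitive a b G g"
  shows "is_primitive a b (\<lambda>t. F t + G t) (\<lambda>t. f t + g t)"
  unfolding is_primitive_def
proof (intro conjI ballI)
  have f: "integrable (lebesgue_on {a..b}) f" "integrable (lebesgue_on {a..b}) g"
    using F G by (auto intro: is_primitive_integrable)
  then show "integrable (lebesgue_on {a..b}) (\<lambda>t. f t + g t)" by simp
  fix t assume t: "t \<in> {a..b}"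
  have "integrable (lebesgue_on {a..t}) f" "integrable (lebesgue_on {a..t}) g"
    by (rule integrable_subinterval[OF f(1)] integrable_subinterval[OF f(2)]; use t in auto)+
  then show "F t + G t = F a + G a + (LINT s|lebesgue_on {a..t}. f s + g s)"
    by (subst is_primitiveD[OF F t], subst is_primitiveD[OF G t]) simp
qed

lemma is_primitive_cmult:
  fixes F :: "real \<Rightarrow> complex"
  shows "is_primitive a b F f \<Longrightarrow> is_primitive a b (\<lambda>t. c * F t) (\<lambda>t. c * f t)"
  by (rule is_primitive_bounded_linear[OF bounded_linear_mult_right])

lemma is_primitive_mult:
  fixes F :: "real \<Rightarrow> complex"
  shows "is_primitive a b F f \<Longrightarrow> is_primitive a b G g \<Longrightarrow>
    is_primitive a b (\<lambda>t. F t * G t) (\<lambda>t. F t * g t + f t * G t)"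
  by (rule is_primitive_bounded_bilinear[OF bounded_bilinear_mult])

locale ladder_system = diagonal_system T h V for T and h :: "3 \<Rightarrow> real" and V +
  fixes \<omega> :: real and v12 v23 :: complex
  assumes gaps: "h 2 - h 1 = \<omega>" "h 3 - h 2 = \<omega>"
    and V_eq: "V = vector [vector [0, v12, 0], vector [cnj v12, 0, v23], vector [0, cnj v23, 0]]"
begin

definition w :: "real \<Rightarrow> complex" where "w t = exp (\<i> * of_real (\<omega> * t))"

lemma continuous_w: "continuous_on S w"
  unfolding w_def by (intro continuous_intros)

lemma V_entries:
  "V $ 1 $ 1 = 0" "V $ 1 $ 2 = v12" "V $ 1 $ 3 = 0"
  "V $ 2 $ 1 = cnj v12" "V $ 2 $ 2 = 0" "V $ 2 $ 3 = v23"
  "V $ 3 $ 1 = 0" "V $ 3 $ 2 = cnj v23" "V $ 3 $ 3 = 0"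
  by (simp_all add: V_eq vector_3)

text \<open>Equal gaps are what gives both transitions the same phase, so that one function
  \<open>w\<close> suffices.\<close>

lemma K_entries:
  "K t $ 1 $ 1 = 0" "K t $ 1 $ 2 = - \<i> * v12 * cnj (w t)" "K t $ 1 $ 3 = 0"
  "K t $ 2 $ 1 = - \<i> * cnj v12 * w t" "K t $ 2 $ 2 = 0" "K t $ 2 $ 3 = - \<i> * v23 * cnj (w t)"
  "K t $ 3 $ 1 = 0" "K t $ 3 $ 2 = - \<i> * cnj v23 * w t" "K t $ 3 $ 3 = 0"
proof -
  have g: "h 1 - h 2 = - \<omega>" "h 2 - h 1 = \<omega>" "h 2 - h 3 = - \<omega>" "h 3 - h 2 = \<omega>"
    using gaps by linarith+
  show "K t $ 1 $ 1 = 0" "K t $ 1 $ 2 = - \<i> * v12 * cnj (w t)" "K t $ 1 $ 3 = 0"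
    "K t $ 2 $ 1 = - \<i> * cnj v12 * w t" "K t $ 2 $ 2 = 0" "K t $ 2 $ 3 = - \<i> * v23 * cnj (w t)"
    "K t $ 3 $ 1 = 0" "K t $ 3 $ 2 = - \<i> * cnj v23 * w t" "K t $ 3 $ 3 = 0"
    unfolding K_component V_entries g w_def by (simp_all add: exp_cnj mult_ac)
qed

lemma K_mult_entries:
  "(K t ** M) $ 1 $ k = - \<i> * v12 * cnj (w t) * M $ 2 $ k"
  "(K t ** M) $ 2 $ k = - \<i> * cnj v12 * w t * M $ 1 $ k - \<i> * v23 * cnj (w t) * M $ 3 $ k"
  "(K t ** M) $ 3 $ k = - \<i> * cnj v23 * w t * M $ 2 $ k"
  unfolding matrix_matrix_mult_def vec_lambda_beta sum_3 K_entries by simp_all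

text \<open>Only the third column is followed, because the initial state is the projection onto the
  third level.\<close>

definition x :: "(real \<Rightarrow> real) \<Rightarrow> nat \<Rightarrow> 3 \<Rightarrow> real \<Rightarrow> complex" where
  "x f n l t = dyson K n (\<lambda>_. f) t $ l $ 3"

lemma x_0: "x f 0 1 t = 0" "x f 0 2 t = 0" "x f 0 3 t = 1"
  by (simp_all add: x_def mat_def)

context
  fixes f assumes f: "f \<in> L2_space T"
begin

text \<open>The prime in \<open>g'\<close> is no derivative: as \<open>f\<close> is real,
  \<open>g'\<close> is the complex conjugate of \<open>g\<close>.\<close>

definition g :: "real \<Rightarrow> complex" where "g t = of_real (f t) * cnj (w t)"
definition g' :: "real \<Rightarrow> complex" where "g' t = of_real (f t) * w t"

lemma is_primitive_x:
  "is_primitive 0 T (x f (Suc n) l) (\<lambda>t. of_real (f t) * (K t ** dyson K n (\<lambda>_. f) t) $ l $ 3)"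
proof -
  have L: "bounded_linear (\<lambda>M::complex^3^3. M $ l $ 3)"
    by (rule bounded_linear_compose[OF bounded_linear_vec_nth bounded_linear_vec_nth])
  have "is_primitive 0 T (\<lambda>t. 0 + (LINT s|lebesgue_on {0..t}. f s *\<^sub>R (K s ** dyson K n (\<lambda>_. f) s)))
      (\<lambda>t. f t *\<^sub>R (K t ** dyson K n (\<lambda>_. f) t))"
    by (rule is_primitive_integral[OF kernel_integrable[OF f dyson_continuous]]) (rule f)
  from is_primitive_bounded_linear[OF L this]
  show ?thesis
  proof (rule is_primitive_cong)
    fix t
    have "(f t *\<^sub>R (K t ** dyson K n (\<lambda>_. f) t)) $ l $ 3 = f t *\<^sub>R ((K t ** dyson K n (\<lambda>_. f) t) $ l $ 3)"
      by simp
    then show "(f t *\<^sub>R (K t ** dyson K n (\<lambda>_. f) t)) $ l $ 3 = of_real (f t) * (K t ** dyson K n (\<lambda>_. f) t) $ l $ 3"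
      by (simp only: scaleR_conv_of_real)
  qed (simp add: x_def)
qed

lemma x_prim:
  "is_primitive 0 T (x f (Suc n) 1) (\<lambda>t. - \<i> * v12 * (g t * x f n 2 t))"
  "is_primitive 0 T (x f (Suc n) 2) (\<lambda>t. - \<i> * cnj v12 * (g' t * x f n 1 t) - \<i> * v23 * (g t * x f n 3 t))"
  "is_primitive 0 T (x f (Suc n) 3) (\<lambda>t. - \<i> * cnj v23 * (g' t * x f n 2 t))"
  by (rule is_primitive_cong[OF is_primitive_x], simp,
      simp only: K_mult_entries x_def g_def g'_def, simp add: algebra_simps)+

lemma x_Suc_0: "x f (Suc n) l 0 = 0"
proof -
  have "(LINT s|lebesgue_on {0..0}. f s *\<^sub>R (K s ** dyson K n (\<lambda>_. f) s)) = 0"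
    by (rule LINT_single[OF kernel_integrable[OF f dyson_continuous] T_nn]) (rule f)
  then show ?thesis unfolding x_def dyson.simps by simp
qed

lemma is_primitive_zero: "is_primitive a b (\<lambda>t. 0 :: complex) (\<lambda>t. 0)"
  by (rule is_primitive_C1) auto

text \<open>Each factor of the kernel moves to a neighbouring level; from level 3, an odd number of
  moves ends at level 2 and an even number at level 1 or 3.\<close>

lemma x_parity:
  "t \<in> {0..T} \<Longrightarrow> (even n \<longrightarrow> x f n 2 t = 0) \<and> (odd n \<longrightarrow> x f n 1 t = 0 \<and> x f n 3 t = 0)"
proof (induction n arbitrary: t)
  case 0
  then show ?case by (simp add: x_0)
next
  case (Suc n)
  have *: "F t = 0" if "is_primitive 0 T F u" "F 0 = 0" "\<And>s. s \<in> {0..T} \<Longrightarrow> u s = 0" for F u :: "real \<Rightarrow> complex"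
    using is_primitive_unique[OF that(1) is_primitive_zero that(2,3) Suc.prems] by simp
  show ?case
  proof (intro conjI impI)
    assume "even (Suc n)"
    then show "x f (Suc n) 2 t = 0"
      by (intro *[OF x_prim(2) x_Suc_0]) (use Suc.IH in auto)
  next
    assume "odd (Suc n)"
    then show "x f (Suc n) 1 t = 0"
      by (intro *[OF x_prim(1) x_Suc_0]) (use Suc.IH in auto)
  next
    assume "odd (Suc n)"
    then show "x f (Suc n) 3 t = 0"
      by (intro *[OF x_prim(3) x_Suc_0]) (use Suc.IH in auto)
  qed
qed

definition a :: "real \<Rightarrow> complex" where "a t = (LINT s|lebesgue_on {0..t}. g s)"

text \<open>With \<open>a\<close> and these integrals of the conjugate of \<open>g\<close> against
  powers of \<open>a\<close>, all Dyson terms needed up to order four become polynomial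
  expressions.\<close>

definition c :: "nat \<Rightarrow> real \<Rightarrow> complex" where "c n t = (LINT s|lebesgue_on {0..t}. g' s * a s ^ n)"

lemma integrable_g: "integrable (lebesgue_on {0..T}) g" "integrable (lebesgue_on {0..T}) g'"
proof -
  have fi: "integrable (lebesgue_on {0..T}) (\<lambda>t. complex_of_real (f t))"
    using L2_integrable[OF f] by (rule integrable_of_real)
  have "continuous_on {0..T} (\<lambda>t. cnj (w t))" by (intro continuous_intros continuous_w)
  from integrable_bounded_bilinear_continuous[OF bounded_bilinear_mult this fi]
  show "integrable (lebesgue_on {0..T}) g" unfolding g_def by (simp add: mult.commute)
  from integrable_bounded_bilinear_continuous[OF bounded_bilinear_mult continuous_w fi]
  show "integrable (lebesgue_on {0..T}) g'" unfolding g'_def by (simp add: mult.commute)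
qed

lemma prim_integral_zero:
  "integrable (lebesgue_on {0..T}) u \<Longrightarrow> is_primitive 0 T (\<lambda>t. LINT s|lebesgue_on {0..t}. u s) u"
  for u :: "real \<Rightarrow> complex"
  using is_primitive_integral[of 0 T u 0] by simp

lemma prim_a: "is_primitive 0 T a g"
  unfolding a_def by (rule prim_integral_zero[OF integrable_g(1)])

lemma prim_c: "is_primitive 0 T (c n) (\<lambda>t. g' t * a t ^ n)"
  unfolding c_def
proof (rule prim_integral_zero)
  have "continuous_on {0..T} (\<lambda>t. a t ^ n)"
    by (intro continuous_intros is_primitive_continuous_on[OF prim_a])
  from integrable_bounded_bilinear_continuous[OF bounded_bilinear_mult this integrable_g(2)]
  show "integrable (lebesgue_on {0..T}) (\<lambda>t. g' t * a t ^ n)" by (simp add: mult.commute)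
qed

lemma a_0: "a 0 = 0" and c_0: "c n 0 = 0"
  unfolding a_def c_def
  using LINT_single[OF integrable_g(1) T_nn] LINT_single[OF is_primitive_integrable[OF prim_c] T_nn, of n]
  unfolding a_def by auto

lemma x_1_2: "t \<in> {0..T} \<Longrightarrow> x f 1 2 t = - \<i> * v23 * a t"
  using is_primitive_unique[OF x_prim(2)[of 0] is_primitive_cmult[OF prim_a, of "- \<i> * v23"]]
  by (simp add: x_Suc_0 a_0 x_0)

text \<open>Both steps down the ladder carry the same \<open>g\<close>, and \<open>g * a\<close> is
  half the derivative of the square of \<open>a\<close>.\<close>

lemma x_2_1:
  assumes t: "t \<in> {0..T}"
  shows "x f 2 1 t = - (v12 * v23 / 2) * (a t * a t)"
proof -
  have "x f (Suc 1) 1 t = - (v12 * v23 / 2) * (a t * a t)"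
    by (rule is_primitive_unique[OF x_prim(1)[of 1] is_primitive_cmult[OF is_primitive_mult[OF prim_a prim_a]]])
       (use t in \<open>simp_all add: x_Suc_0 a_0 x_1_2[unfolded One_nat_def] algebra_simps\<close>)
  then show ?thesis by (simp add: numeral_2_eq_2)
qed

lemma x_2_3:
  assumes t: "t \<in> {0..T}"
  shows "x f 2 3 t = - (v23 * cnj v23) * c 1 t"
proof -
  have "x f (Suc 1) 3 t = - (v23 * cnj v23) * c 1 t"
    by (rule is_primitive_unique[OF x_prim(3)[of 1] is_primitive_cmult[OF prim_c[of 1]]])
       (use t in \<open>simp_all add: x_Suc_0 c_0 x_1_2[unfolded One_nat_def] algebra_simps\<close>)
  then show ?thesis by (simp add: numeral_2_eq_2)
qed

text \<open>The integral of \<open>g * c 1\<close> is eliminated by partial integration: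
  \<open>a * c 1\<close> has derivative \<open>g * c 1 + g' * a ^ 2\<close>.\<close>

lemma x_3_2:
  assumes t: "t \<in> {0..T}"
  shows "x f 3 2 t = \<i> * v23 * ((v12 * cnj v12 / 2 - v23 * cnj v23) * c 2 t + v23 * cnj v23 * (a t * c 1 t))"
proof -
  have "x f (Suc 2) 2 t = \<i> * v23 * ((v12 * cnj v12 / 2 - v23 * cnj v23) * c 2 t + v23 * cnj v23 * (a t * c 1 t))"
    by (rule is_primitive_unique[OF x_prim(2)[of 2] is_primitive_cmult[OF is_primitive_add[OF is_primitive_cmult[OF prim_c[of 2]]
          is_primitive_cmult[OF is_primitive_mult[OF prim_a prim_c[of 1]]]]]])
       (use t in \<open>simp_all add: x_Suc_0[of 2, simplified] a_0 c_0 x_2_1 x_2_3 algebra_simps power2_eq_square\<close>)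
  then show ?thesis by (simp add: numeral_3_eq_3 numeral_2_eq_2)
qed

text \<open>Two partial integrations: \<open>g * c 2\<close> integrates to
  \<open>a * c 2 - c 3\<close>, and \<open>g * a * c 1\<close> to half of
  \<open>a ^ 2 * c 1 - c 3\<close>.\<close>

lemma x_4_1:
  assumes t: "t \<in> {0..T}"
  shows "x f 4 1 t = v12 * v23 * ((v12 * cnj v12 / 2 - v23 * cnj v23) * (a t * c 2 t - c 3 t)
    + v23 * cnj v23 * ((a t * a t) * c 1 t / 2 - c 3 t / 2))"
proof -
  \<comment> \<open>Differences are written as sums with negative coefficients, to match the rules
    for sums and constant multiples of primitives.\<close>
  let ?F = "\<lambda>t. v12 * v23 * ((v12 * cnj v12 / 2 - v23 * cnj v23) * (a t * c 2 t + (- 1) * c 3 t)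
    + v23 * cnj v23 * ((1 / 2) * ((a t * a t) * c 1 t) + (- 1 / 2) * c 3 t))"
  have "x f (Suc 3) 1 t = ?F t"
    by (rule is_primitive_unique[OF x_prim(1)[of 3] is_primitive_cmult[OF is_primitive_add[
          OF is_primitive_cmult[OF is_primitive_add[OF is_primitive_mult[OF prim_a prim_c[of 2]] is_primitive_cmult[OF prim_c[of 3]]]]
          is_primitive_cmult[OF is_primitive_add[OF is_primitive_cmult[OF is_primitive_mult[OF is_primitive_mult[OF prim_a prim_a] prim_c[of 1]]]
             is_primitive_cmult[OF prim_c[of 3]]]]]]])
       (use t in \<open>simp_all add: x_Suc_0[of 3, simplified] a_0 c_0 x_3_2 algebra_simps power2_eq_square power3_eq_cube\<close>)
  then show ?thesis by (simp add: numeral_eq_Suc)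
qed

end

definition form :: "real \<Rightarrow> real \<Rightarrow> real \<Rightarrow> nat \<Rightarrow> (nat \<Rightarrow> real \<Rightarrow> real) \<Rightarrow> real" where
  "form lam1 lam2 lam3 n v = (if n = 0 then lam3 else 0) +
     ((lam1 - lam3) * pair_form 1 3 n v + (lam2 - lam3) * pair_form 2 3 n v)"

lemma entire_forms_form: "\<exists>b. entire_forms T (form lam1 lam2 lam3) b"
proof -
  have "form lam1 lam2 lam3 = (\<lambda>n v. (if n = 0 then lam3 else 0) +
     ((lam1 - lam3) * pair_form 1 3 n v + (lam2 - lam3) * pair_form 2 3 n v))"
    by (simp add: fun_eq_iff form_def)
  then show ?thesis
    using entire_forms_add[OF entire_forms_const[of T lam3] entire_forms_add[OF
        entire_forms_scale[OF entire_forms_pair_form[of 1 3], of "lam1 - lam3"]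
        entire_forms_scale[OF entire_forms_pair_form[of 2 3], of "lam2 - lam3"]]] by auto
qed

lemma objective_sums:
  assumes f: "f \<in> L2_space T"
  shows "objective T H0 V (diag (\<lambda>i. of_real (if i = 3 then 1 else 0)))
      (diag (\<lambda>i. of_real (if i = 1 then lam1 else if i = 2 then lam2 else lam3))) f =
    (\<Sum>n. form lam1 lam2 lam3 n (\<lambda>_. f))"
proof -
  let ?y = "\<lambda>l. (cmod (W f T $ l $ 3))\<^sup>2"
  have "(dagger (W f T) ** W f T) $ 3 $ 3 = 1"
    using unitary_W[OF f] by (simp add: mat_def)
  moreover have "(dagger (W f T) ** W f T) $ 3 $ 3 = of_real (\<Sum>l\<in>UNIV. ?y l)"
    unfolding matrix_matrix_mult_def vec_lambda_beta dagger_def of_real_sum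
    by (intro sum.cong refl) (simp add: complex_norm_square mult.commute del: of_real_power)
  ultimately have "(\<Sum>l\<in>UNIV. ?y l) = 1" by (metis of_real_eq_1_iff)
  then have one: "?y 1 + ?y 2 + ?y 3 = 1" by (simp add: sum_3)
  have sums: "(\<lambda>n. pair_form l 3 n (\<lambda>_. f)) sums ?y l" for l
    using pair_form_sums[OF f] by (simp add: W_def)
  have const: "(\<lambda>n. if n = 0 then lam3 else 0) sums lam3"
    using sums_single[of 0 "\<lambda>_. lam3"] by simp
  have "(\<lambda>n. form lam1 lam2 lam3 n (\<lambda>_. f)) sums (lam3 + ((lam1 - lam3) * ?y 1 + (lam2 - lam3) * ?y 2))"
    unfolding form_def by (intro sums_add const sums_mult sums)
  moreover have "objective T H0 V (diag (\<lambda>i. of_real (if i = 3 then 1 else 0)))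
      (diag (\<lambda>i. of_real (if i = 1 then lam1 else if i = 2 then lam2 else lam3))) f = lam1 * ?y 1 + lam2 * ?y 2 + lam3 * ?y 3"
    unfolding objective_diag[OF f] sum_3 by simp
  moreover have "lam1 * ?y 1 + lam2 * ?y 2 + lam3 * ?y 3 = lam3 * (?y 1 + ?y 2 + ?y 3) + ((lam1 - lam3) * ?y 1 + (lam2 - lam3) * ?y 2)"
    by (simp add: algebra_simps)
  ultimately show ?thesis unfolding one by (simp add: sums_iff)
qed

section \<open>The homogeneous parts of the objective up to order eight\<close>

lemma pair_form_diag:
  "pair_form l 3 n (\<lambda>_. f) = (\<Sum>p\<le>n. Re (x f p l T * cnj (x f (n - p) l T)))"
  by (simp add: pair_form_def x_def)

lemma A_coeff_eq_x: "f \<in> L2_space T \<Longrightarrow> A_coeff T H0 V n l 3 f = \<i> ^ n * x f n l T"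
  by (simp add: A_coeff_eq_dyson x_def)

context
  fixes f assumes f: "f \<in> L2_space T"
begin

lemma x_even: "even n \<Longrightarrow> x f n 2 T = 0"
  using x_parity[OF f, of T n] T_nn by simp

lemma x_odd: "odd n \<Longrightarrow> x f n 1 T = 0"
  using x_parity[OF f, of T n] T_nn by simp

lemma x_2_1_eq_0:
  assumes "v23 \<noteq> 0" "x f 1 2 T = 0"
  shows "x f 2 1 T = 0"
proof -
  have "a f T = 0" using assms x_1_2[OF f, of T] T_nn by simp
  then show ?thesis using x_2_1[OF f, of T] T_nn by simp
qed

text \<open>If \<open>n\<close> is odd, then \<open>p\<close> and \<open>n - p\<close> have opposite
  parity, so one factor of every product vanishes on either level.\<close>

lemma form_odd:
  assumes "odd n"
  shows "form lam1 lam2 lam3 n (\<lambda>_. f) = 0"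
proof -
  have "Re (x f p 1 T * cnj (x f (n - p) 1 T)) = 0" "Re (x f p 2 T * cnj (x f (n - p) 2 T)) = 0" if "p \<le> n" for p
    using that assms x_even[of p] x_even[of "n - p"] x_odd[of p] x_odd[of "n - p"]
    by (cases "even p"; simp)+
  then have "pair_form l 3 n (\<lambda>_. f) = 0" if "l = 1 \<or> l = 2" for l
    unfolding pair_form_diag using that by (intro sum.neutral) auto
  then show ?thesis using assms by (auto simp: form_def)
qed

text \<open>When every other pair of orders contains a vanishing term, only the middle of the Cauchy
  product remains, and it is a squared modulus. This is the source of definite signs.\<close>

lemma pair_form_even:
  assumes n: "n = 2 * m" and zero: "\<And>p. p \<le> n \<Longrightarrow> p \<noteq> m \<Longrightarrow> x f p l T = 0 \<or> x f (n - p) l T = 0"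
  shows "pair_form l 3 n (\<lambda>_. f) = (cmod (x f m l T))\<^sup>2"
proof -
  have "pair_form l 3 n (\<lambda>_. f) = (\<Sum>p\<in>{m}. Re (x f p l T * cnj (x f (n - p) l T)))"
    unfolding pair_form_diag
  proof (rule sum.mono_neutral_right)
    show "\<forall>p\<in>{..n} - {m}. Re (x f p l T * cnj (x f (n - p) l T)) = 0"
      using zero by fastforce
  qed (use n in auto)
  also have "\<dots> = Re (x f m l T * cnj (x f m l T))" using n by simp
  also have "\<dots> = (cmod (x f m l T))\<^sup>2"
    by (simp add: complex_norm_square[symmetric] del: complex_mult_cnj times_complex.sel flip: of_real_power)
  finally show ?thesis .
qed

lemma form_2: "form lam1 lam2 lam3 2 (\<lambda>_. f) = (lam2 - lam3) * (cmod (x f 1 2 T))\<^sup>2"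
proof -
  have "pair_form 1 3 2 (\<lambda>_. f) = (cmod (x f 1 1 T))\<^sup>2"
  proof (rule pair_form_even)
    fix p :: nat assume "p \<le> 2" "p \<noteq> 1"
    then have "p = 0 \<or> p = 2" by auto
    then show "x f p 1 T = 0 \<or> x f (2 - p) 1 T = 0"
      by (elim disjE) (simp_all add: x_0)
  qed simp
  moreover have "pair_form 2 3 2 (\<lambda>_. f) = (cmod (x f 1 2 T))\<^sup>2"
  proof (rule pair_form_even)
    fix p :: nat assume "p \<le> 2" "p \<noteq> 1"
    then have "p = 0 \<or> p = 2" by auto
    then show "x f p 2 T = 0 \<or> x f (2 - p) 2 T = 0"
      by (elim disjE) (simp_all add: x_0)
  qed simp
  ultimately show ?thesis using x_odd[of 1] by (simp add: form_def)
qed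

context
  assumes v23: "v23 \<noteq> 0" and x_1: "x f 1 2 T = 0"
begin

lemma form_4: "form lam1 lam2 lam3 4 (\<lambda>_. f) = 0"
proof -
  have "pair_form 1 3 4 (\<lambda>_. f) = (cmod (x f 2 1 T))\<^sup>2"
  proof (rule pair_form_even)
    fix p :: nat assume "p \<le> 4" "p \<noteq> 2"
    then have "p = 0 \<or> p = 1 \<or> p = 3 \<or> p = 4" by auto
    then show "x f p 1 T = 0 \<or> x f (4 - p) 1 T = 0"
      by (elim disjE) (simp_all add: x_0 x_odd)
  qed simp
  moreover have "pair_form 2 3 4 (\<lambda>_. f) = (cmod (x f 2 2 T))\<^sup>2"
  proof (rule pair_form_even)
    fix p :: nat assume "p \<le> 4" "p \<noteq> 2"
    then have "p = 0 \<or> p = 1 \<or> p = 3 \<or> p = 4" by auto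
    then show "x f p 2 T = 0 \<or> x f (4 - p) 2 T = 0"
      by (elim disjE) (simp_all add: x_1[unfolded One_nat_def] x_even)
  qed simp
  ultimately show ?thesis using x_2_1_eq_0[OF v23 x_1] x_even[of 2] by (simp add: form_def)
qed

text \<open>For level 1 the pairs 0 + 6 and 2 + 4 contain a vanishing term, for level 2 the pair 1 +
  5 does; parity removes the other pairs, except 3 + 3 on level 2.\<close>

lemma form_6: "form lam1 lam2 lam3 6 (\<lambda>_. f) = (lam2 - lam3) * (cmod (x f 3 2 T))\<^sup>2"
proof -
  have "pair_form 1 3 6 (\<lambda>_. f) = (cmod (x f 3 1 T))\<^sup>2"
  proof (rule pair_form_even)
    fix p :: nat assume "p \<le> 6" "p \<noteq> 3"
    then have "p = 0 \<or> p = 1 \<or> p = 2 \<or> p = 4 \<or> p = 5 \<or> p = 6" by auto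
    then show "x f p 1 T = 0 \<or> x f (6 - p) 1 T = 0"
      by (elim disjE) (simp_all add: x_0 x_odd x_2_1_eq_0[OF v23 x_1])
  qed simp
  moreover have "pair_form 2 3 6 (\<lambda>_. f) = (cmod (x f 3 2 T))\<^sup>2"
  proof (rule pair_form_even)
    fix p :: nat assume "p \<le> 6" "p \<noteq> 3"
    then have "p = 0 \<or> p = 1 \<or> p = 2 \<or> p = 4 \<or> p = 5 \<or> p = 6" by auto
    then show "x f p 2 T = 0 \<or> x f (6 - p) 2 T = 0"
      by (elim disjE) (simp_all add: x_1[unfolded One_nat_def] x_even)
  qed simp
  ultimately show ?thesis using x_odd[of 3] by (simp add: form_def)
qed

text \<open>With orders 1 and 3 gone, level 2 contributes nothing. What is left comes from level 1
  alone, hence the change to the coefficient \<open>lam1 - lam3\<close>.\<close>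

lemma form_8:
  assumes "x f 3 2 T = 0"
  shows "form lam1 lam2 lam3 8 (\<lambda>_. f) = (lam1 - lam3) * (cmod (x f 4 1 T))\<^sup>2"
proof -
  have "pair_form 1 3 8 (\<lambda>_. f) = (cmod (x f 4 1 T))\<^sup>2"
  proof (rule pair_form_even)
    fix p :: nat assume "p \<le> 8" "p \<noteq> 4"
    then have "p = 0 \<or> p = 1 \<or> p = 2 \<or> p = 3 \<or> p = 5 \<or> p = 6 \<or> p = 7 \<or> p = 8" by auto
    then show "x f p 1 T = 0 \<or> x f (8 - p) 1 T = 0"
      by (elim disjE) (simp_all add: x_0 x_odd x_2_1_eq_0[OF v23 x_1])
  qed simp
  moreover have "pair_form 2 3 8 (\<lambda>_. f) = (cmod (x f 4 2 T))\<^sup>2"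
  proof (rule pair_form_even)
    fix p :: nat assume "p \<le> 8" "p \<noteq> 4"
    then have "p = 0 \<or> p = 1 \<or> p = 2 \<or> p = 3 \<or> p = 5 \<or> p = 6 \<or> p = 7 \<or> p = 8" by auto
    then show "x f p 2 T = 0 \<or> x f (8 - p) 2 T = 0"
      by (elim disjE) (simp_all add: x_1[unfolded One_nat_def] x_even assms)
  qed simp
  ultimately show ?thesis using x_even[of 4] by (simp add: form_def)
qed

end

end

end

section \<open>A control in the kernel of the third order term\<close>

context entire_forms
begin

lemma diag_homogeneous:
  assumes h: "h \<in> L2_space T"
  shows "B n (\<lambda>_ t. s * h t) = s ^ n * B n (\<lambda>_. h)"
proof -
  have sh: "(\<lambda>t. s * h t) \<in> L2_space T" by (rule L2_space_scale[OF h])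
  have "B n (\<lambda>j. if j < m then (\<lambda>t. s * h t) else h) = s ^ m * B n (\<lambda>_. h)" if "m \<le> n" for m
    using that
  proof (induction m)
    case (Suc m)
    let ?v = "\<lambda>j. if j < m then (\<lambda>t. s * h t) else h"
    have "?v j \<in> L2_space T" for j using h sh by simp
    then have "B n (?v(m := (\<lambda>t. s * h t + 0 * h t))) = s * B n (?v(m := h)) + 0 * B n (?v(m := h))"
      using Suc.prems h by (intro linear_slot) auto
    moreover have "?v(m := (\<lambda>t. s * h t + 0 * h t)) = (\<lambda>j. if j < Suc m then (\<lambda>t. s * h t) else h)"
      by (auto simp: fun_eq_iff less_Suc_eq)
    moreover have "?v(m := h) = ?v" by (auto simp: fun_eq_iff)
    ultimately show ?case using Suc by simp
  qed simp
  from this[of n] show ?thesis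
    using local[of n "\<lambda>j. if j < n then (\<lambda>t. s * h t) else h" "\<lambda>_ t. s * h t"] by simp
qed

end

lemma truncated_in_L2:
  assumes \<phi>: "continuous_on UNIV \<phi>" and M: "\<And>t. \<bar>\<phi> t\<bar> \<le> M"
  shows "(\<lambda>t. if t \<le> P then \<phi> t else 0 :: real) \<in> L2_space T"
proof -
  let ?f = "\<lambda>t. if t \<le> P then \<phi> t else 0"
  have [measurable]: "\<phi> \<in> borel_measurable borel" by (rule borel_measurable_continuous_onI[OF \<phi>])
  have "?f \<in> borel_measurable borel" by measurable
  then have m: "?f \<in> borel_measurable (lebesgue_on {0..T})"
    by (intro measurable_restrict_space1 measurable_completion) (simp add: measurable_lborel1)
  have "integrable (lebesgue_on {0..T}) (\<lambda>t. (?f t)\<^sup>2)"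
  proof (rule Bochner_Integration.integrable_bound)
    show "integrable (lebesgue_on {0..T}) (\<lambda>t. M\<^sup>2)" by simp
    show "(\<lambda>t. (?f t)\<^sup>2) \<in> borel_measurable (lebesgue_on {0..T})" using m by (rule borel_measurable_power)
    have "(\<phi> t)\<^sup>2 \<le> M\<^sup>2" for t
      using power_mono[OF M[of t], of 2] by simp
    then show "AE t in lebesgue_on {0..T}. norm ((?f t)\<^sup>2) \<le> norm (M\<^sup>2)" by (intro AE_I2) auto
  qed
  with m show ?thesis by (simp add: L2_space_def)
qed

lemma LINT_vanishing_beyond:
  fixes u :: "real \<Rightarrow> complex"
  assumes u: "integrable (lebesgue_on {0..T}) u" and zero: "\<And>t. P < t \<Longrightarrow> u t = 0"
    and P: "0 \<le> P" "P \<le> s" "s \<le> T"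
  shows "(LINT t|lebesgue_on {0..s}. u t) = (LINT t|lebesgue_on {0..P}. u t)"
proof -
  have "integrable (lebesgue_on {0..s}) u" by (rule integrable_subinterval[OF u]) (use P in auto)
  then have "(LINT t|lebesgue_on {0..s}. u t) = (LINT t|lebesgue_on {0..P}. u t) + (LINT t|lebesgue_on {P..s}. u t)"
    by (rule Equivalence_Measurable_On_Borel.integral_combine) (use P in auto)
  moreover have "(LINT t|lebesgue_on {P..s}. u t) = 0"
  proof (rule integral_eq_zero_AE)
    \<comment> \<open>Vanishing is assumed only strictly beyond \<open>P\<close>; the endpoint is a
      null set.\<close>
    have "AE t in lebesgue. t \<notin> {P}"
      by (intro AE_not_in) (simp add: negligible_iff_null_sets[symmetric])
    then have "AE t in lebesgue. t \<in> {P..s} \<longrightarrow> u t = 0"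
      by eventually_elim (use zero in auto)
    then show "AE t in lebesgue_on {P..s}. u t = 0" by (subst AE_restrict_space_iff) auto
  qed
  ultimately show ?thesis by simp
qed

lemma is_primitive_subinterval:
  assumes F: "is_primitive a b F f" and "c \<le> b"
  shows "is_primitive a c F f"
  unfolding is_primitive_def
proof (intro conjI ballI)
  show "integrable (lebesgue_on {a..c}) f"
    by (rule integrable_subinterval[OF is_primitive_integrable[OF F]]) (use \<open>c \<le> b\<close> in auto)
  show "F t = F a + (LINT s|lebesgue_on {a..t}. f s)" if "t \<in> {a..c}" for t
    by (rule is_primitiveD[OF F]) (use that \<open>c \<le> b\<close> in auto)
qed

section \<open>Trigonometric polynomials over one period\<close>

definition fourier :: "real \<Rightarrow> int \<Rightarrow> real \<Rightarrow> complex" where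
  "fourier \<omega> k t = exp (\<i> * of_int k * of_real (\<omega> * t))"

lemma fourier_add: "fourier \<omega> j t * fourier \<omega> k t = fourier \<omega> (j + k) t"
  by (simp add: fourier_def exp_add[symmetric] algebra_simps)

lemma fourier_0: "fourier \<omega> 0 t = 1"
  by (simp add: fourier_def)

lemma fourier_at_0: "fourier \<omega> k 0 = 1"
  by (simp add: fourier_def)

lemma fourier_numeral:
  "fourier \<omega> (numeral n) t = fourier \<omega> 1 t ^ numeral n"
  "fourier \<omega> (- numeral n) t = fourier \<omega> (- 1) t ^ numeral n"
  by (simp_all add: fourier_def exp_of_nat_mult[symmetric] mult_ac)

lemma fourier_inverse: "fourier \<omega> 1 t * fourier \<omega> (- 1) t = 1"
  by (simp add: fourier_add fourier_0)

lemma fourier_deriv: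
  "(fourier \<omega> k has_vector_derivative (\<i> * of_int k * of_real \<omega>) * fourier \<omega> k t) (at t within S)"
  unfolding fourier_def of_real_mult
  by (rule has_vector_derivative_real_field) (auto intro!: derivative_eq_intros)

lemma continuous_fourier: "continuous_on S (fourier \<omega> k)"
  unfolding fourier_def by (intro continuous_intros)

lemma cos_fourier: "of_real (cos (2 * \<omega> * t)) = (fourier \<omega> 2 t + fourier \<omega> (- 2) t) / 2"
  "of_real (cos (\<omega> * t)) = (fourier \<omega> 1 t + fourier \<omega> (- 1) t) / 2"
  unfolding cos_of_real[symmetric] cos_exp_eq by (simp_all add: fourier_def mult_ac)

lemma fourier_period:
  assumes "\<omega> \<noteq> 0"
  shows "fourier \<omega> k (2 * pi / \<bar>\<omega>\<bar>) = 1"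
proof -
  \<comment> \<open>The period uses the absolute value of \<open>\<omega>\<close>, so a negative
    \<open>\<omega>\<close> flips the sign of the frequency.\<close>
  define n :: int where "n = (if \<omega> > 0 then k else - k)"
  have "\<i> * of_int k * of_real (\<omega> * (2 * pi / \<bar>\<omega>\<bar>)) = (2 * of_int n * of_real pi) * \<i>"
    using assms by (auto simp: n_def)
  then show ?thesis
    unfolding fourier_def using exp_integer_2pi[of "of_int n"] by simp
qed

lemma LINT_fourier:
  assumes \<omega>: "\<omega> \<noteq> 0"
  shows "(LINT t|lebesgue_on {0..2 * pi / \<bar>\<omega>\<bar>}. fourier \<omega> k t) = (if k = 0 then of_real (2 * pi / \<bar>\<omega>\<bar>) else 0)"
proof (cases "k = 0")
  case True
  then show ?thesis by (simp add: fourier_0 measure_restrict_space scaleR_conv_of_real)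
next
  case False
  let ?P = "2 * pi / \<bar>\<omega>\<bar>" and ?c = "\<i> * of_int k * of_real \<omega> :: complex"
  have "is_primitive 0 ?P (\<lambda>t. inverse ?c * fourier \<omega> k t) (\<lambda>t. fourier \<omega> k t)"
  proof (rule is_primitive_C1[OF _ continuous_fourier])
    fix t
    from has_vector_derivative_mult_right[OF fourier_deriv[of \<omega> k t "{0..?P}"], of "inverse ?c"]
    show "((\<lambda>t. inverse ?c * fourier \<omega> k t) has_vector_derivative fourier \<omega> k t) (at t within {0..?P})"
      using False \<omega> by (simp add: field_simps)
  qed
  from is_primitive_integral_eq[OF this] show ?thesis
    using False by (simp add: fourier_period[OF \<omega>] fourier_at_0)
qed

lemma LINT_fourier_sum:
  fixes C :: "nat \<Rightarrow> complex"
  assumes \<omega>: "\<omega> \<noteq> 0"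
  shows "(LINT t|lebesgue_on {0..2 * pi / \<bar>\<omega>\<bar>}. (\<Sum>j<n. C j * fourier \<omega> (\<kappa> j) t)) =
    (\<Sum>j<n. C j * (if \<kappa> j = 0 then of_real (2 * pi / \<bar>\<omega>\<bar>) else 0))"
proof -
  have int: "integrable (lebesgue_on {0..2 * pi / \<bar>\<omega>\<bar>}) (fourier \<omega> k)" for k
    by (rule continuous_imp_integrable_real[OF continuous_fourier])
  have "(LINT t|lebesgue_on {0..2 * pi / \<bar>\<omega>\<bar>}. (\<Sum>j<n. C j * fourier \<omega> (\<kappa> j) t)) =
      (\<Sum>j<n. LINT t|lebesgue_on {0..2 * pi / \<bar>\<omega>\<bar>}. C j * fourier \<omega> (\<kappa> j) t)"
    by (rule Bochner_Integration.integral_sum) (intro integrable_mult_right int)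
  also have "\<dots> = (\<Sum>j<n. C j * (LINT t|lebesgue_on {0..2 * pi / \<bar>\<omega>\<bar>}. fourier \<omega> (\<kappa> j) t))"
    by (intro sum.cong refl integral_mult_right_zero)
  finally show ?thesis by (simp only: LINT_fourier[OF \<omega>])
qed

text \<open>Only the constant terms, \<open>0\<close> and \<open>- 60\<close>, survive integration over a period.\<close>

lemma laurent_square:
  fixes w u :: complex assumes "w * u = 1"
  shows "(3 * w ^ 3 + 2 * w + 3 * u) * (3 * w - 2 * u - u ^ 3) ^ 2 =
    3 * u ^ 7 + 14 * u ^ 5 + 5 * u ^ 3 - 28 * u - 3 * w - 18 * w ^ 3 + 27 * w ^ 5"
  using assms by algebra

lemma laurent_cube:
  fixes w u :: complex assumes "w * u = 1"
  shows "(3 * w ^ 3 + 2 * w + 3 * u) * (3 * w - 2 * u - u ^ 3) ^ 3 =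
    - 3 * u ^ 10 - 20 * u ^ 8 - 24 * u ^ 6 + 60 * u ^ 4 + 74 * u ^ 2 - 60 - 108 * w ^ 4 + 81 * w ^ 6"
  using assms by algebra

section \<open>Two test controls supported on one period\<close>

context ladder_system
begin

context
  fixes P :: real
  assumes \<omega>: "\<omega> \<noteq> 0" and P_eq: "P = 2 * pi / \<bar>\<omega>\<bar>" and P_le: "P \<le> T"
begin

lemma P_pos: "0 < P"
  using \<omega> by (simp add: P_eq)

lemma w_fourier: "w t = fourier \<omega> 1 t" "cnj (w t) = fourier \<omega> (- 1) t"
  by (simp_all add: w_def fourier_def exp_cnj)

text \<open>A resonant control: its first order integral is nonzero, so the second order
  differential is negative on it. It shows that the truncated Taylor polynomial of the trap is not
  identically zero.\<close>

definition \<psi> :: "real \<Rightarrow> real" where "\<psi> t = (if t \<le> P then cos (\<omega> * t) else 0)"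

text \<open>Multiplied by \<open>exp (- \<i> \<omega> t)\<close> it has frequencies 1, -1 and -3,
  none of them zero, so \<open>a\<close> is periodic. After integration the amplitudes are in ratio
  3 : -2 : -1, and their sum is zero exactly because of the coefficient 3. Beyond \<open>P\<close>
  the control is 0, so the integrals keep their values and any \<open>T\<close> not below
  \<open>P\<close> will do.\<close>

definition \<phi> :: "real \<Rightarrow> real" where "\<phi> t = (if t \<le> P then 1 + 3 * cos (2 * \<omega> * t) else 0)"

lemma \<psi>_L2: "\<psi> \<in> L2_space T"
  unfolding \<psi>_def by (rule truncated_in_L2[where M = 1]) (auto intro!: continuous_intros)

lemma \<phi>_L2: "\<phi> \<in> L2_space T"
  unfolding \<phi>_def
proof (rule truncated_in_L2[where M = 4])
  show "\<bar>1 + 3 * cos (2 * \<omega> * t)\<bar> \<le> 4" for t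
    using cos_le_one[of "2 * \<omega> * t"] cos_ge_minus_one[of "2 * \<omega> * t"] by linarith
qed (auto intro!: continuous_intros)

lemma x_\<psi>: "v23 \<noteq> 0 \<Longrightarrow> x \<psi> 1 2 T \<noteq> 0"
proof -
  assume "v23 \<noteq> 0"
  have "a \<psi> T = (LINT t|lebesgue_on {0..P}. g \<psi> t)"
    unfolding a_def[OF \<psi>_L2] by (rule LINT_vanishing_beyond[OF integrable_g(1)[OF \<psi>_L2]])
      (use P_pos P_le in \<open>auto simp: g_def[OF \<psi>_L2] \<psi>_def\<close>)
  also have "\<dots> = (LINT t|lebesgue_on {0..P}. (\<Sum>j<2::nat. (1 / 2) * fourier \<omega> (if j = 0 then 0 else - 2) t))"
  proof (rule Bochner_Integration.integral_cong[OF refl])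
    fix t assume "t \<in> space (lebesgue_on {0..P})"
    then have "of_real (\<psi> t) = (fourier \<omega> 1 t + fourier \<omega> (- 1) t) / 2" by (simp add: \<psi>_def cos_fourier(2))
    then show "g \<psi> t = (\<Sum>j<2::nat. (1 / 2) * fourier \<omega> (if j = 0 then 0 else - 2) t)"
      by (simp add: g_def[OF \<psi>_L2] w_fourier(2) numeral_2_eq_2 add_divide_distrib distrib_right fourier_add fourier_0)
  qed
  also have "\<dots> = of_real P / 2"
    unfolding P_eq LINT_fourier_sum[OF \<omega>] by (simp add: numeral_2_eq_2)
  finally have "a \<psi> T \<noteq> 0" using P_pos by auto
  then show ?thesis using x_1_2[OF \<psi>_L2, of T] T_nn \<open>v23 \<noteq> 0\<close> by simp
qed

lemma a_\<phi>:
  assumes t: "t \<in> {0..P}"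
  shows "a \<phi> t = (1 / (2 * \<i> * of_real \<omega>)) * (3 * fourier \<omega> 1 t - 2 * fourier \<omega> (- 1) t - fourier \<omega> (- 3) t)"
proof -
  let ?F = "\<lambda>t. (1 / (2 * \<i> * of_real \<omega>)) * (3 * fourier \<omega> 1 t - 2 * fourier \<omega> (- 1) t - fourier \<omega> (- 3) t)"
  let ?g = "\<lambda>t. (3 * fourier \<omega> 1 t + 2 * fourier \<omega> (- 1) t + 3 * fourier \<omega> (- 3) t) / 2"
  show "a \<phi> t = ?F t"
  proof (rule is_primitive_unique[OF is_primitive_subinterval[OF prim_a[OF \<phi>_L2] P_le] _ _ _ t])
    show "is_primitive 0 P ?F ?g"
    proof (rule is_primitive_C1)
      fix t
      note d = has_vector_derivative_mult_right[OF has_vector_derivative_diff[OF has_vector_derivative_diff[OF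
            has_vector_derivative_mult_right[OF fourier_deriv[of \<omega> 1 t "{0..P}"], of 3]
            has_vector_derivative_mult_right[OF fourier_deriv[of \<omega> "- 1" t "{0..P}"], of 2]]
            fourier_deriv[of \<omega> "- 3" t "{0..P}"]], of "1 / (2 * \<i> * of_real \<omega>)"]
      show "(?F has_vector_derivative ?g t) (at t within {0..P})"
        by (rule has_vector_derivative_eq_rhs[OF d]) (use \<omega> in \<open>simp add: field_simps\<close>)
      show "continuous_on {0..P} ?g" by (intro continuous_intros continuous_fourier) auto
    qed
    \<comment> \<open>All exponentials are 1 at 0, and 3 - 2 - 1 = 0.\<close>
    show "a \<phi> 0 = ?F 0" by (simp add: a_0[OF \<phi>_L2] fourier_at_0)
    fix s assume "s \<in> {0..P}"
    then have "of_real (\<phi> s) = 1 + 3 * ((fourier \<omega> 2 s + fourier \<omega> (- 2) s) / 2)"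
      by (simp add: \<phi>_def cos_fourier(1))
    then have "g \<phi> s = (1 + 3 * ((fourier \<omega> 2 s + fourier \<omega> (- 2) s) / 2)) * fourier \<omega> (- 1) s"
      by (simp only: g_def[OF \<phi>_L2] w_fourier(2))
    also have "\<dots> = ?g s" by (simp add: field_simps fourier_add)
    finally show "g \<phi> s = ?g s" .
  qed
qed

lemma a_\<phi>_T: "a \<phi> T = 0"
proof -
  have "a \<phi> T = a \<phi> P"
    unfolding a_def[OF \<phi>_L2] by (rule LINT_vanishing_beyond[OF integrable_g(1)[OF \<phi>_L2]])
      (use P_pos P_le in \<open>auto simp: g_def[OF \<phi>_L2] \<phi>_def\<close>)
  also have "\<dots> = 0" using a_\<phi>[of P] P_pos by (simp add: fourier_period[OF \<omega>, folded P_eq])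
  finally show ?thesis .
qed

text \<open>Negative frequencies are kept as powers of \<open>fourier \<omega> (- 1) t\<close>, so
  the integrand is a polynomial in two reciprocal quantities, the shape of the Laurent
  identities.\<close>

lemma c_\<phi>:
  "c \<phi> n T = (LINT t|lebesgue_on {0..P}. (1 / (2 * \<i> * of_real \<omega>)) ^ n * (1 / 2) *
     ((3 * fourier \<omega> 1 t ^ 3 + 2 * fourier \<omega> 1 t + 3 * fourier \<omega> (- 1) t) *
      (3 * fourier \<omega> 1 t - 2 * fourier \<omega> (- 1) t - fourier \<omega> (- 1) t ^ 3) ^ n))"
proof -
  have "c \<phi> n T = (LINT t|lebesgue_on {0..P}. g' \<phi> t * a \<phi> t ^ n)"
    unfolding c_def[OF \<phi>_L2] by (rule LINT_vanishing_beyond[OF is_primitive_integrable[OF prim_c[OF \<phi>_L2]]])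
      (use P_pos P_le in \<open>auto simp: g'_def[OF \<phi>_L2] \<phi>_def\<close>)
  also have "\<dots> = (LINT t|lebesgue_on {0..P}. (1 / (2 * \<i> * of_real \<omega>)) ^ n * (1 / 2) *
     ((3 * fourier \<omega> 1 t ^ 3 + 2 * fourier \<omega> 1 t + 3 * fourier \<omega> (- 1) t) *
      (3 * fourier \<omega> 1 t - 2 * fourier \<omega> (- 1) t - fourier \<omega> (- 1) t ^ 3) ^ n))"
  proof (rule Bochner_Integration.integral_cong[OF refl])
    fix t assume "t \<in> space (lebesgue_on {0..P})"
    then have t: "t \<in> {0..P}" by simp
    then have "of_real (\<phi> t) = 1 + 3 * ((fourier \<omega> 2 t + fourier \<omega> (- 2) t) / 2)"
      by (simp add: \<phi>_def cos_fourier(1))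
    then have "g' \<phi> t = (1 + 3 * ((fourier \<omega> 2 t + fourier \<omega> (- 2) t) / 2)) * fourier \<omega> 1 t"
      by (simp only: g'_def[OF \<phi>_L2] w_fourier(1))
    also have "\<dots> = (1 / 2) * (3 * fourier \<omega> 3 t + 2 * fourier \<omega> 1 t + 3 * fourier \<omega> (- 1) t)"
      by (simp add: field_simps fourier_add)
    finally show "g' \<phi> t * a \<phi> t ^ n = (1 / (2 * \<i> * of_real \<omega>)) ^ n * (1 / 2) *
     ((3 * fourier \<omega> 1 t ^ 3 + 2 * fourier \<omega> 1 t + 3 * fourier \<omega> (- 1) t) *
      (3 * fourier \<omega> 1 t - 2 * fourier \<omega> (- 1) t - fourier \<omega> (- 1) t ^ 3) ^ n)"
      unfolding a_\<phi>[OF t] power_mult_distrib fourier_numeral by (simp only: mult_ac)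
  qed
  finally show ?thesis .
qed

lemma c_\<phi>_2: "c \<phi> 2 T = 0"
proof -
  \<comment> \<open>Coefficients of the frequencies \<open>2 * j - 7\<close>, all odd and therefore
    nonzero.\<close>
  let ?C = "\<lambda>j::nat. [3, 14, 5, - 28, - 3, - 18, 27] ! j :: complex"
  have "c \<phi> 2 T = (1 / (2 * \<i> * of_real \<omega>)) ^ 2 * (1 / 2) *
     (LINT t|lebesgue_on {0..P}. (\<Sum>j<7. ?C j * fourier \<omega> (2 * int j - 7) t))"
    unfolding c_\<phi> integral_mult_right_zero laurent_square[OF fourier_inverse]
    by (simp add: eval_nat_numeral fourier_numeral algebra_simps)
  also have "\<dots> = 0" unfolding P_eq LINT_fourier_sum[OF \<omega>]
    by (simp add: eval_nat_numeral)
  finally show ?thesis .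
qed

lemma c_\<phi>_3: "c \<phi> 3 T \<noteq> 0"
proof -
  \<comment> \<open>Coefficients of the frequencies \<open>2 * j - 10\<close>; frequency zero is
    reached at \<open>j = 5\<close> with -60, and the entry 0 fills the missing frequency 2.\<close>
  let ?C = "\<lambda>j::nat. [- 3, - 20, - 24, 60, 74, - 60, 0, - 108, 81] ! j :: complex"
  have "c \<phi> 3 T = (1 / (2 * \<i> * of_real \<omega>)) ^ 3 * (1 / 2) *
     (LINT t|lebesgue_on {0..P}. (\<Sum>j<9. ?C j * fourier \<omega> (2 * int j - 10) t))"
    unfolding c_\<phi> integral_mult_right_zero laurent_cube[OF fourier_inverse]
    by (simp add: eval_nat_numeral fourier_numeral fourier_0 algebra_simps)
  also have "\<dots> = (1 / (2 * \<i> * of_real \<omega>)) ^ 3 * (1 / 2) * (- 60 * of_real P)"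
    unfolding P_eq LINT_fourier_sum[OF \<omega>] by (simp add: eval_nat_numeral)
  finally show ?thesis using \<omega> P_pos by simp
qed

lemma x_\<phi>: "x \<phi> 1 2 T = 0" "x \<phi> 3 2 T = 0"
  using x_1_2[OF \<phi>_L2, of T] x_3_2[OF \<phi>_L2, of T] T_nn by (simp_all add: a_\<phi>_T c_\<phi>_2)

lemma x_\<phi>_4:
  assumes "v12 \<noteq> 0" "v23 \<noteq> 0" "cmod v12 \<noteq> cmod v23"
  shows "x \<phi> 4 1 T \<noteq> 0"
proof -
  have eq: "x \<phi> 4 1 T = v12 * v23 * ((v23 * cnj v23 - v12 * cnj v12) / 2) * c \<phi> 3 T"
  proof -
    have "x \<phi> 4 1 T = v12 * v23 * ((v12 * cnj v12 / 2 - v23 * cnj v23) * (0 - c \<phi> 3 T) + v23 * cnj v23 * (0 - c \<phi> 3 T / 2))"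
      using x_4_1[OF \<phi>_L2, of T] T_nn by (simp add: a_\<phi>_T c_\<phi>_2)
    also have "\<dots> = v12 * v23 * ((v23 * cnj v23 - v12 * cnj v12) / 2) * c \<phi> 3 T"
      by (simp add: field_simps)
    finally show ?thesis .
  qed
  have "v23 * cnj v23 \<noteq> v12 * cnj v12"
  proof
    assume "v23 * cnj v23 = v12 * cnj v12"
    then have "of_real ((cmod v23)\<^sup>2) = (of_real ((cmod v12)\<^sup>2) :: complex)"
      by (simp only: complex_norm_square)
    then have "(cmod v23)\<^sup>2 = (cmod v12)\<^sup>2" by (simp only: of_real_eq_iff)
    then show False using assms(3) by simp
  qed
  then show ?thesis unfolding eq using assms(1,2) c_\<phi>_3 by simp
qed

end

end

section \<open>The trap\<close>

text \<open>Along a direction \<open>h\<close> the truncated polynomial is \<open>s ^ 2\<close>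
  times \<open>B 2 + s ^ 2 B 4 + s ^ 4 B 6\<close>: a negative first coefficient wins for small
  \<open>s\<close>, and otherwise only a nonpositive sixth order term is left. Along
  \<open>v\<close> the eighth order gain beats the error of ninth order, so zero is no global
  maximum.\<close>

lemma is_trap_of_order_7I:
  assumes F: "entire_forms T B b" and J: "\<And>f. f \<in> L2_space T \<Longrightarrow> J f = (\<Sum>n. B n (\<lambda>_. f))"
    and odd: "\<And>n h. odd n \<Longrightarrow> h \<in> L2_space T \<Longrightarrow> B n (\<lambda>_. h) = 0"
    and sign: "\<And>h. h \<in> L2_space T \<Longrightarrow> B 2 (\<lambda>_. h) < 0 \<or>
      (B 2 (\<lambda>_. h) = 0 \<and> B 4 (\<lambda>_. h) = 0 \<and> B 6 (\<lambda>_. h) \<le> 0)"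
    and neg: "u \<in> L2_space T" "B 2 (\<lambda>_. u) < 0"
    and pos: "v \<in> L2_space T" "B 2 (\<lambda>_. v) = 0" "B 4 (\<lambda>_. v) = 0" "B 6 (\<lambda>_. v) = 0" "0 < B 8 (\<lambda>_. v)"
  shows "trap_of_order T J 7 (\<lambda>t. 0)"
proof -
  interpret entire_forms T B b by (rule F)
  have dd: "diff_diag T J k (\<lambda>t. 0) h / fact k = B k (\<lambda>_. h)" if "h \<in> L2_space T" for k h
    using diff_diag_zero_control[OF J that] by simp
  have R: "(\<Sum>j=2..7. diff_diag T J j (\<lambda>t. 0) h / fact j) = B 2 (\<lambda>_. h) + B 4 (\<lambda>_. h) + B 6 (\<lambda>_. h)"
    if h: "h \<in> L2_space T" for h
  proof -
    have "{2..7::nat} = {2,3,4,5,6,7}" by auto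
    then show ?thesis
      using odd[OF _ h, of 3] odd[OF _ h, of 5] odd[OF _ h, of 7] by (simp add: dd[OF h])
  qed
  let ?q = "\<lambda>h s. B 2 (\<lambda>_. h) + s ^ 2 * B 4 (\<lambda>_. h) + s ^ 4 * B 6 (\<lambda>_. h)"
  have Rs: "(\<Sum>j=2..7. diff_diag T J j (\<lambda>t. 0) (\<lambda>t. s * h t) / fact j) = s ^ 2 * ?q h s"
    if h: "h \<in> L2_space T" for h s
  proof -
    have "s ^ 4 = s ^ 2 * s ^ 2" "s ^ 6 = s ^ 2 * s ^ 4" by (simp_all flip: power_add)
    then show ?thesis
      unfolding R[OF L2_space_scale[OF h]] diag_homogeneous[OF h] by (simp add: algebra_simps)
  qed
  have near: "\<exists>d>0. \<forall>s. \<bar>s\<bar> < d \<longrightarrow> ?q h s < 0" if "B 2 (\<lambda>_. h) < 0" for h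
  proof -
    have "((\<lambda>s. ?q h s) \<longlongrightarrow> B 2 (\<lambda>_. h) + 0 ^ 2 * B 4 (\<lambda>_. h) + 0 ^ 4 * B 6 (\<lambda>_. h)) (nhds 0)"
      by (intro tendsto_intros filterlim_ident)
    then have "eventually (\<lambda>s. ?q h s < 0) (nhds 0)"
      by (rule order_tendstoD) (use that in simp)
    then show ?thesis unfolding eventually_nhds_metric by (simp add: dist_real_def)
  qed
  have "\<exists>\<epsilon>>0. \<forall>s\<in>{- \<epsilon><..<\<epsilon>}. (\<Sum>j=2..7. diff_diag T J j (\<lambda>t. 0) (\<lambda>t. s * h t) / fact j) \<le> 0"
    if h: "h \<in> L2_space T" for h
  proof -
    have "\<exists>\<epsilon>>0. \<forall>s\<in>{- \<epsilon><..<\<epsilon>}. ?q h s \<le> 0"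
    proof (cases "B 2 (\<lambda>_. h) < 0")
      case True
      then obtain d where d: "d > 0" "\<And>s. \<bar>s\<bar> < d \<Longrightarrow> ?q h s < 0" using near by blast
      show ?thesis by (intro exI[of _ d] conjI d(1) ballI less_imp_le d(2)) auto
    next
      case False
      then have "?q h s \<le> 0" for s using sign[OF h] by (auto intro: mult_nonneg_nonpos)
      then show ?thesis by (intro exI[of _ 1]) auto
    qed
    then show ?thesis unfolding Rs[OF h] by (meson mult_nonneg_nonpos zero_le_power2)
  qed
  moreover have "\<exists>h\<in>L2_space T. (\<Sum>j=2..7. diff_diag T J j (\<lambda>t. 0) h / fact j) \<noteq> 0"
  proof -
    \<comment> \<open>The polynomial might vanish at \<open>u\<close> itself because of the fourth
      and sixth order terms, hence the passage to a small multiple.\<close>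
    obtain d where d: "d > 0" "\<And>s. \<bar>s\<bar> < d \<Longrightarrow> ?q u s < 0" using near[OF neg(2)] by blast
    have "?q u (d / 2) < 0" by (rule d(2)) (use d(1) in simp)
    then have "?q u (d / 2) \<noteq> 0" by simp
    then have "(\<Sum>j=2..7. diff_diag T J j (\<lambda>t. 0) (\<lambda>t. d / 2 * u t) / fact j) \<noteq> 0"
      unfolding Rs[OF neg(1)] using d(1) by simp
    then show ?thesis using L2_space_scale[OF neg(1), of "d / 2"] by (rule bexI)
  qed
  moreover have "\<not> (\<forall>g\<in>L2_space T. J g \<le> J (\<lambda>t. 0))"
  proof
    assume max: "\<forall>g\<in>L2_space T. J g \<le> J (\<lambda>t. 0)"
    have "taylor_expansion T J (\<lambda>t. 0) {2, 4, 6, 8} 9"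
    proof (rule taylor_expansion_zero_control[OF J])
      fix k h assume k: "k \<in> {1..9} - {2, 4, 6, 8 :: nat}" and h: "h \<in> L2_space T"
      have "k = 1 \<or> k = 3 \<or> k = 5 \<or> k = 7 \<or> k = 9" using k by auto
      then have "odd k" by auto
      then show "B k (\<lambda>_. h) = 0" using h by (rule odd)
    qed auto
    then have "\<forall>\<^sub>F h in L2_nhds0 T. norm (J (\<lambda>t. 0 + h t) - J (\<lambda>t. 0) - (\<Sum>k\<in>{2, 4, 6, 8}. diff_diag T J k (\<lambda>t. 0) h / fact k))
        \<le> 1 * norm (L2_norm T h ^ 9)"
      unfolding taylor_expansion_def by (intro landau_o.smallD) auto
    then obtain d where d: "d > 0" "\<And>h. h \<in> L2_space T \<Longrightarrow> L2_norm T h < d \<Longrightarrow>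
        \<bar>J h - J (\<lambda>t. 0) - (\<Sum>k\<in>{2, 4, 6, 8}. B k (\<lambda>_. h))\<bar> \<le> L2_norm T h ^ 9"
      unfolding eventually_L2_nhds0 by (auto simp: dd L2_norm_nonneg)
    define H where "H = L2_norm T v + 1"
    have H: "H > 0" "L2_norm T v < H" using L2_norm_nonneg[of T v] by (auto simp: H_def)
    \<comment> \<open>The first bound keeps \<open>s v\<close> where the Taylor estimate holds; the
      second makes the ninth order error at most half of the eighth order gain.\<close>
    define s where "s = min (d / H) (B 8 (\<lambda>_. v) / (2 * H ^ 9))"
    have s: "s > 0" using d(1) H pos(5) by (simp add: s_def)
    have sv: "L2_norm T (\<lambda>t. s * v t) < d"
    proof -
      have "s * L2_norm T v < s * H" using s H by simp
      also have "\<dots> \<le> d / H * H" using H by (intro mult_right_mono) (auto simp: s_def)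
      finally show ?thesis using s H by (simp add: L2_norm_scale)
    qed
    have "J (\<lambda>t. s * v t) \<le> J (\<lambda>t. 0)" using max L2_space_scale[OF pos(1)] by blast
    moreover have "(\<Sum>k\<in>{2, 4, 6, 8}. B k (\<lambda>_. (\<lambda>t. s * v t))) = s ^ 8 * B 8 (\<lambda>_. v)"
      unfolding diag_homogeneous[OF pos(1)] using pos by simp
    ultimately have "s ^ 8 * B 8 (\<lambda>_. v) \<le> L2_norm T (\<lambda>t. s * v t) ^ 9"
      using d(2)[OF L2_space_scale[OF pos(1)] sv] by linarith
    also have "\<dots> = s ^ 8 * (s * L2_norm T v ^ 9)"
      using s by (simp add: L2_norm_scale power_mult_distrib eval_nat_numeral)
    finally have "B 8 (\<lambda>_. v) \<le> s * L2_norm T v ^ 9" using s by simp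
    also have "\<dots> \<le> s * H ^ 9" using s H by (intro mult_left_mono power_mono) (auto simp: L2_norm_nonneg)
    also have "\<dots> \<le> B 8 (\<lambda>_. v) / (2 * H ^ 9) * H ^ 9" using H by (intro mult_right_mono) (auto simp: s_def)
    also have "\<dots> = B 8 (\<lambda>_. v) / 2" using H by simp
    finally show False using pos(5) by simp
  qed
  moreover have "taylor_expansion T J (\<lambda>t. 0) {2..7} 7"
  proof (rule taylor_expansion_zero_control[OF J])
    fix k h assume k: "k \<in> {1..7} - {2..7 :: nat}" and h: "h \<in> L2_space T"
    then have "k = 1" by auto
    then show "B k (\<lambda>_. h) = 0" using odd[OF _ h, of 1] by simp
  qed auto
  ultimately show ?thesis unfolding trap_of_order_def Let_def using L2_space_zero by blast
qed

theorem theorem4: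
  fixes h1 h2 h3 \<omega> lam1 lam2 lam3 T :: real
    and v12 v23 :: complex
    and H0 V Ob \<rho>0 :: "complex^3^3"
    and J :: "(real \<Rightarrow> real) \<Rightarrow> real"
    and f0 :: "real \<Rightarrow> real"
    and \<HH>0 \<HH>1 \<HH>3 :: "(real \<Rightarrow> real) set"
  assumes v_nz: "v12 \<noteq> 0" "v23 \<noteq> 0"
    and H0: "H0 = vector [vector [of_real h1, 0, 0],
                          vector [0, of_real h2, 0],
                          vector [0, 0, of_real h3]]"
    and V: "V = vector [vector [0, v12, 0],
                        vector [cnj v12, 0, v23],
                        vector [0, cnj v23, 0]]"
    and harmonic: "h2 - h1 = \<omega>" "h3 - h2 = \<omega>" "\<omega> \<noteq> 0"
    and lambda: "lam1 > lam3" "lam3 > lam2"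
    and Ob: "Ob = vector [vector [of_real lam1, 0, 0],
                          vector [0, of_real lam2, 0],
                          vector [0, 0, of_real lam3]]"
    and rho0: "\<rho>0 = vector [vector [0, 0, 0],
                            vector [0, 0, 0],
                            vector [0, 0, 1]]"
    and T: "T > 0"
    and J: "J = objective T H0 V \<rho>0 Ob"
    and f0: "f0 = (\<lambda>t. 0)"
    and HH0: "\<HH>0 = L2_space T"
    and HH1: "\<HH>1 = {f \<in> \<HH>0. A_coeff T H0 V 1 2 3 f = 0}"
    and HH3: "\<HH>3 = {f \<in> \<HH>1. A_coeff T H0 V 3 2 3 f = 0}"
  shows "taylor_expansion T J f0 {2, 4, 6, 8} 9
    \<and> (\<forall>\<delta>f \<in> \<HH>0 - \<HH>1. diff_diag T J 2 f0 \<delta>f < 0)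
    \<and> (\<forall>\<delta>f \<in> \<HH>1. diff_diag T J 2 f0 \<delta>f = 0 \<and> diff_diag T J 4 f0 \<delta>f = 0)
    \<and> (\<forall>\<delta>f \<in> \<HH>1 - \<HH>3. diff_diag T J 6 f0 \<delta>f < 0)
    \<and> (\<forall>\<delta>f \<in> \<HH>3. diff_diag T J 6 f0 \<delta>f = 0 \<and> diff_diag T J 8 f0 \<delta>f \<ge> 0)
    \<and> (cmod v12 \<noteq> cmod v23 \<and> T \<ge> 2 * pi / \<bar>\<omega>\<bar> \<longrightarrow>
         (\<exists>\<delta>f \<in> \<HH>3. diff_diag T J 8 f0 \<delta>f > 0) \<and> trap_of_order T J 7 f0)"
proof -
  define h :: "3 \<Rightarrow> real" where "h i = (if i = 1 then h1 else if i = 2 then h2 else h3)" for i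
  have hv: "h 1 = h1" "h 2 = h2" "h 3 = h3" by (simp_all add: h_def)
  have V_herm: "dagger V = V"
    by (simp add: V dagger_def vec_eq_iff forall_3 vector_3)
  interpret ladder_system T h V \<omega> v12 v23
    using T V_herm V harmonic by unfold_locales (simp_all add: hv)
  have H0_diag: "H0 = diag (\<lambda>i. of_real (h i))"
    by (simp add: H0 diag_def vec_eq_iff forall_3 vector_3 hv)
  have Ob_diag: "Ob = diag (\<lambda>i. of_real (if i = 1 then lam1 else if i = 2 then lam2 else lam3))"
    by (simp add: Ob diag_def vec_eq_iff forall_3 vector_3)
  have rho_diag: "\<rho>0 = diag (\<lambda>i. of_real (if i = 3 then 1 else 0))"
    by (simp add: rho0 diag_def vec_eq_iff forall_3 vector_3)
  let ?B = "form lam1 lam2 lam3"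
  obtain b where b: "entire_forms T ?B b" using entire_forms_form by blast
  have Jf: "J f = (\<Sum>n. ?B n (\<lambda>_. f))" if "f \<in> L2_space T" for f
    unfolding J H0_diag Ob_diag rho_diag by (rule objective_sums[OF that])
  have dd: "diff_diag T J k (\<lambda>t. 0) f = fact k * ?B k (\<lambda>_. f)" if "f \<in> L2_space T" for k f
    by (rule entire_forms.diff_diag_zero_control[OF b, of J]) (auto simp: Jf that)
  \<comment> \<open>The coefficients differ from the Dyson entries only by the nonzero factor
    \<open>\<i> ^ n\<close>.\<close>
  have A: "A_coeff T H0 V 1 2 3 f = 0 \<longleftrightarrow> x f 1 2 T = 0" "A_coeff T H0 V 3 2 3 f = 0 \<longleftrightarrow> x f 3 2 T = 0"
    if "f \<in> L2_space T" for f
    using A_coeff_eq_x[OF that] by (simp_all add: H0_diag)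
  have H0D: "f \<in> L2_space T" "x f 1 2 T \<noteq> 0" if "f \<in> \<HH>0 - \<HH>1" for f
    using that A(1)[of f] by (auto simp: HH0 HH1)
  have H1D: "f \<in> L2_space T" "x f 1 2 T = 0" if "f \<in> \<HH>1" for f
    using that A(1)[of f] by (auto simp: HH0 HH1)
  have H13D: "x f 3 2 T \<noteq> 0" if "f \<in> \<HH>1 - \<HH>3" for f
    using that A(2)[OF H1D(1)] by (auto simp: HH3)
  have H3D: "f \<in> \<HH>1" "x f 3 2 T = 0" if "f \<in> \<HH>3" for f
    using that A(2)[OF H1D(1)] by (auto simp: HH3)
  have H3I: "f \<in> \<HH>3" if "f \<in> L2_space T" "x f 1 2 T = 0" "x f 3 2 T = 0" for f
    using that A[OF that(1)] by (simp add: HH3 HH1 HH0)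
  have neg: "?B 2 (\<lambda>_. f) < 0" if "f \<in> L2_space T" "x f 1 2 T \<noteq> 0" for f
    using form_2[OF that(1)] that(2) lambda by (simp add: mult_neg_pos)
  have taylor: "taylor_expansion T J f0 {2, 4, 6, 8} 9"
    unfolding f0
  proof (rule entire_forms.taylor_expansion_zero_control[OF b])
    show "J f = (\<Sum>n. ?B n (\<lambda>_. f))" if "f \<in> L2_space T" for f by (rule Jf[OF that])
    fix k h assume k: "k \<in> {1..9} - {2, 4, 6, 8 :: nat}" and h: "h \<in> L2_space T"
    have "k = 1 \<or> k = 3 \<or> k = 5 \<or> k = 7 \<or> k = 9" using k by auto
    then have "odd k" by auto
    then show "?B k (\<lambda>_. h) = 0" using h by (intro form_odd)
  qed auto
  have J8: "diff_diag T J 8 f0 f = fact 8 * ((lam1 - lam3) * (cmod (x f 4 1 T))\<^sup>2)" if "f \<in> \<HH>3" for f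
    using form_8[OF H1D(1)[OF H3D(1)[OF that]] v_nz(2) H1D(2)[OF H3D(1)[OF that]] H3D(2)[OF that]]
      dd[OF H1D(1)[OF H3D(1)[OF that]]] by (simp add: f0)
  have trap: "(\<exists>\<delta>f \<in> \<HH>3. diff_diag T J 8 f0 \<delta>f > 0) \<and> trap_of_order T J 7 f0"
    if ne: "cmod v12 \<noteq> cmod v23" and P: "2 * pi / \<bar>\<omega>\<bar> \<le> T"
  proof -
    define f where "f = \<phi> (2 * pi / \<bar>\<omega>\<bar>)"
    define u where "u = \<psi> (2 * pi / \<bar>\<omega>\<bar>)"
    \<comment> \<open>These discharge the assumptions under which the test controls were studied;
      \<open>refl\<close> fixes the period as \<open>2 * pi / \<bar>\<omega>\<bar>\<close>.\<close>
    note ex = harmonic(3) refl P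
    have f: "f \<in> L2_space T" "x f 1 2 T = 0" "x f 3 2 T = 0" "x f 4 1 T \<noteq> 0"
      unfolding f_def using \<phi>_L2[OF ex] x_\<phi>[OF ex] x_\<phi>_4[OF ex v_nz ne] by auto
    have u: "u \<in> L2_space T" "x u 1 2 T \<noteq> 0"
      unfolding u_def using \<psi>_L2[OF ex] x_\<psi>[OF ex v_nz(2)] by auto
    have f3: "f \<in> \<HH>3" using f by (intro H3I)
    have "0 < diff_diag T J 8 f0 f" unfolding J8[OF f3] using f(4) lambda by simp
    moreover have "trap_of_order T J 7 f0"
      unfolding f0
    proof (rule is_trap_of_order_7I[OF b])
      show "J f = (\<Sum>n. ?B n (\<lambda>_. f))" if "f \<in> L2_space T" for f by (rule Jf[OF that])
      show "?B n (\<lambda>_. h) = 0" if "odd n" "h \<in> L2_space T" for n h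
        using form_odd[OF that(2,1)] .
      show "?B 2 (\<lambda>_. h) < 0 \<or> (?B 2 (\<lambda>_. h) = 0 \<and> ?B 4 (\<lambda>_. h) = 0 \<and> ?B 6 (\<lambda>_. h) \<le> 0)"
        if h: "h \<in> L2_space T" for h
      proof (cases "x h 1 2 T = 0")
        case True
        then show ?thesis
          using form_2[OF h] form_4[OF h v_nz(2)] form_6[OF h v_nz(2)] lambda by (simp add: mult_nonpos_nonneg)
      qed (use neg[OF h] in blast)
      show "?B 2 (\<lambda>_. u) < 0" by (rule neg[OF u])
      show "?B 2 (\<lambda>_. f) = 0" using form_2[OF f(1)] f(2) by simp
      show "?B 4 (\<lambda>_. f) = 0" by (rule form_4[OF f(1) v_nz(2) f(2)])
      show "?B 6 (\<lambda>_. f) = 0" using form_6[OF f(1) v_nz(2) f(2)] f(3) by simp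
      show "0 < ?B 8 (\<lambda>_. f)" using form_8[OF f(1) v_nz(2) f(2) f(3)] f(4) lambda by simp
    qed (use u f in auto)
    ultimately show ?thesis using f3 by blast
  qed
  show ?thesis
  proof (intro conjI ballI impI taylor)
    fix \<delta>f
    { assume "\<delta>f \<in> \<HH>0 - \<HH>1"
      then show "diff_diag T J 2 f0 \<delta>f < 0"
        using neg[OF H0D] dd[OF H0D(1)] by (simp add: f0 mult_pos_neg) }
    { assume h: "\<delta>f \<in> \<HH>1"
      show "diff_diag T J 2 f0 \<delta>f = 0"
        using dd[OF H1D(1)[OF h]] form_2[OF H1D(1)[OF h]] H1D(2)[OF h] by (simp add: f0)
      show "diff_diag T J 4 f0 \<delta>f = 0"
        using dd[OF H1D(1)[OF h]] form_4[OF H1D(1)[OF h] v_nz(2) H1D(2)[OF h]] by (simp add: f0) }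
    { assume h: "\<delta>f \<in> \<HH>1 - \<HH>3"
      then have h1: "\<delta>f \<in> \<HH>1" by blast
      show "diff_diag T J 6 f0 \<delta>f < 0"
        using dd[OF H1D(1)[OF h1]] form_6[OF H1D(1)[OF h1] v_nz(2) H1D(2)[OF h1]] H13D[OF h] lambda
        by (simp add: f0 mult_pos_neg mult_neg_pos) }
    { assume h: "\<delta>f \<in> \<HH>3"
      note h1 = H3D(1)[OF h]
      show "diff_diag T J 6 f0 \<delta>f = 0"
        using dd[OF H1D(1)[OF h1]] form_6[OF H1D(1)[OF h1] v_nz(2) H1D(2)[OF h1]] H3D(2)[OF h] by (simp add: f0)
      show "0 \<le> diff_diag T J 8 f0 \<delta>f" unfolding J8[OF h] using lambda by simp }
  next
    assume "cmod v12 \<noteq> cmod v23 \<and> T \<ge> 2 * pi / \<bar>\<omega>\<bar>"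
    then show "\<exists>\<delta>f\<in>\<HH>3. 0 < diff_diag T J 8 f0 \<delta>f" "trap_of_order T J 7 f0"
      using trap by blast+
  qed
qed

end
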